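(* Let $k,m,n_1,\dots,n_{k+1}$ be positive integers with $m\le\min(n_1,\dots,n_{k+1})$, let $n=n_1+\dots+n_{k+1}$ and $d_j=n_1+\dots+n_j$. The Laplace--Beltrami operator $\Delta_{F}$ of the partial flag manifold $F=F_{d_1,\dots,d_k}(\mathbb{C}^n)$ acts on smooth zonal spherical functions, i.e. on smooth functions depending only on $(\Lambda_1,\dots,\Lambda_k)$ (up to simultaneous unitary conjugation), as the operator $$\begin{aligned}\Delta^{R,m}:=\;&2\sum_{j=1}^{k}\sum_{\alpha,\beta,\gamma,\delta=1}^{m}(I_m-\Lambda_j)_{\alpha\delta}\,\Lambda_{j,\gamma\beta}\frac{\partial^2}{\partial\Lambda_{j,\alpha\beta}\,\partial\Lambda_{j,\gamma\delta}}\\&-\sum_{1\le j\ne\ell\le k}\sum_{\alpha,\beta,\gamma,\delta=1}^m\left(\Lambda_{j,\alpha\delta}\Lambda_{\ell,\gamma\beta}+\Lambda_{j,\gamma\beta}\Lambda_{\ell,\alpha\delta}\right)\frac{\partial^2}{\partial\Lambda_{j,\alpha\beta}\,\partial\Lambda_{\ell,\gamma\delta}}\\&+2\sum_{j=1}^{k}\sum_{\alpha,\beta=1}^m\left(n_jI_m-n\Lambda_j\right)_{\alpha\beta}\frac{\partial}{\partial\Lambda_{j,\alpha\beta}}.\end{aligned}$$ That is: if $f$ is a smooth function on $\{(\Lambda_1,\dots,\Lambda_k)\in\mathrm{Her}(m)^k:\Lambda_j>0\ (1\le j\le k),\ \sum_{j=1}^k\Lambda_j<I_m\}$ which is invariant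 under $(\Lambda_1,\dots,\Lambda_k)\mapsto(V\Lambda_1V^*,\dots,V\Lambda_kV^* )$ for all $V\in\mathbf{U}(m)$, and $\hat f$ is the function on the open set $\pi_F(\mathcal{D}_m)\subseteq F$ determined by $\hat f\circ\pi_F=f\circ p_m$ on $\mathcal{D}_m$, then $(\Delta_F\hat f)\circ\pi_F=(\Delta^{R,m}f)\circ p_m$ on $\mathcal{D}_m$.
   Context: $\mathrm{Her}(m)$ is the space of $m\times m$ Hermitian matrices and $\Lambda_{j,\alpha\beta}$ denotes the $(\alpha,\beta)$ entry of $\Lambda_j$. The partial derivatives $\partial/\partial\Lambda_{j,\alpha\beta}$ are taken treating the $m^2$ entries of $\Lambda_j$ as independent complex-linear coordinates, i.e. the differential of $f$ in direction $H\in\mathrm{Her}(m)$ in the $j$-th variable is $\sum_{\alpha,\beta}H_{\alpha\beta}\,\partial f/\partial\Lambda_{j,\alpha\beta}$. The sum over $1\le j\neq\ell\le k$ is over ordered pairs. The partial flag manifold is $F_{d_1,\dots,d_k}(\mathbb{C}^n)=\mathbf{U}(n)/(\mathbf{U}(n_1)\times\dots\times\mathbf{U}(n_{k+1}))$ (block-diagonal subgroup), with projection $\pi_F:\mathbf{U}(n)\to F_{d_1,\dots,d_k}(\mathbb{C}^n)$. The group $\mathbf{U}(n)$ carries the bi-invariant Riemannian metric given on $\mathfrak{u}(n)$ by $\langle X,Y\rangle=-\mathrm{Tr}(XY)$, and $F_{d_1,\dots,d_k}(\mathbb{C}^n)$ carries the metric making $\pi_F$ a Riemannian submersion; thus $\Delta_{\mathbf{U}(n)}(g\circ\pi_F)=(\Delta_Fg)\circ\pi_F$.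 The set $\mathcal{D}_m\subseteq\mathbf{U}(n)$ consists of the unitary matrices $\begin{pmatrix}W_1&\dots&W_{k+1}\\Z_1&\dots&Z_{k+1}\end{pmatrix}$ with $Z_j\in\mathbb{C}^{m\times n_j}$ (so $(Z_1,\dots,Z_{k+1})$ are the last $m$ rows) and $\det(Z_jZ_j^* )\neq0$ for $1\le j\le k+1$. The map $p_m$ sends such a matrix to $(\Lambda_1,\dots,\Lambda_k)$ with $\Lambda_j=Z_jZ_j^*$ (note $\Lambda_{k+1}:=Z_{k+1}Z_{k+1}^*=I_m-\sum_{j=1}^k\Lambda_j$). Zonal spherical functions are functions on $\mathbf{U}(n)$ invariant under right multiplication by $\mathbf{U}(n_1)\times\dots\times\mathbf{U}(n_{k+1})$ and left multiplication by $\mathbf{U}(n-m)\times\mathbf{U}(m)$; on $\mathcal{D}_m$ they are identified, via $p_m$, with functions of $(\Lambda_1,\dots,\Lambda_k)$ invariant under simultaneous conjugation by $\mathbf{U}(m)$. *)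

theory Defs
  imports "HOL-Analysis.Analysis"
begin

section \<open>Smooth functions and directional derivatives\<close>

text \<open>
  \<open>V\<close> is a linear subspace of the ambient space and \<open>S\<close> is relatively open in \<open>V\<close>. With
  \<open>V = UNIV\<close> this is the usual notion on an open set; for functions of Hermitian matrices,
  \<open>V\<close> is a space of tuples of Hermitian matrices inside the space of all complex matrices.
  Only the restriction of \<open>f' x\<close> to \<open>V\<close> matters, and it is determined by \<open>f\<close>.
\<close>

primrec Ck_on ::
  "nat \<Rightarrow> 'a::real_normed_vector set \<Rightarrow> 'a set \<Rightarrow> ('a \<Rightarrow> 'b::real_normed_vector) \<Rightarrow> bool" where
  "Ck_on 0 V S f \<longleftrightarrow> continuous_on S f"
| "Ck_on (Suc r) V S f \<longleftrightarrow>
     (\<exists>f'. (\<forall>x\<in>S. (f has_derivative f' x) (at x within S)) \<and>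
           (\<forall>v\<in>V. Ck_on r V S (\<lambda>x. f' x v)))"

definition smooth_on ::
  "'a::real_normed_vector set \<Rightarrow> 'a set \<Rightarrow> ('a \<Rightarrow> 'b::real_normed_vector) \<Rightarrow> bool" where
  "smooth_on V S f \<longleftrightarrow> (\<forall>r. Ck_on r V S f)"

definition dir_deriv ::
  "('a::real_normed_vector \<Rightarrow> 'b::real_normed_vector) \<Rightarrow> 'a \<Rightarrow> 'a \<Rightarrow> 'b" where
  "dir_deriv f x v = vector_derivative (\<lambda>t. f (x + t *\<^sub>R v)) (at 0)"


section \<open>The Laplace--Beltrami operator in local coordinates\<close>

text \<open>
  For a Riemannian metric with Gram matrix \<open>G\<close> in the coordinates \<open>x\<close>:
  \<open>(det G)\<^sup>-\<^sup>1\<^sup>/\<^sup>2 \<Sum>\<^sub>i \<partial>\<^sub>i ((det G)\<^sup>1\<^sup>/\<^sup>2 \<Sum>\<^sub>j G\<^sup>i\<^sup>j \<partial>\<^sub>j u)\<close>.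
\<close>

definition laplace_beltrami ::
  "(real^'d \<Rightarrow> real^'d^'d) \<Rightarrow> (real^'d \<Rightarrow> complex) \<Rightarrow> real^'d \<Rightarrow> complex" where
  "laplace_beltrami G u x =
     (1 / sqrt (det (G x))) *\<^sub>R
       (\<Sum>i\<in>UNIV. dir_deriv
          (\<lambda>y. sqrt (det (G y)) *\<^sub>R
             (\<Sum>j\<in>UNIV. (matrix_inv (G y) $ i $ j) *\<^sub>R dir_deriv u y (axis j 1)))
          x (axis i 1))"


section \<open>Complex matrices\<close>

definition ctranspose :: "complex^'n^'m \<Rightarrow> complex^'m^'n" where
  "ctranspose A = (\<chi> i j. cnj (A $ j $ i))"

definition unitary_group :: "(complex^'n^'n) set" where
  "unitary_group = {U. U ** ctranspose U = mat 1 \<and> ctranspose U ** U = mat 1}"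

definition hermitian :: "complex^'n^'n \<Rightarrow> bool" where
  "hermitian A \<longleftrightarrow> ctranspose A = A"

definition pos_def :: "complex^'n^'n \<Rightarrow> bool" where
  "pos_def A \<longleftrightarrow> hermitian A \<and>
     (\<forall>v. v \<noteq> 0 \<longrightarrow> 0 < Re (\<Sum>i\<in>UNIV. cnj (v $ i) * (A *v v) $ i))"

definition skew_hermitian :: "(complex^'n^'n) set" where
  "skew_hermitian = {X. ctranspose X = - X}"


section \<open>The partial flag manifold\<close>

text \<open>
  The indices \<open>1, \<dots>, n\<close> form the finite type \<open>'n\<close>, and a map \<open>b :: 'n \<Rightarrow> 'b\<close> assigns to each of
  them its block. With consecutive numbers in each block this is the usual block decomposition;
  the order in which the elements of \<open>'n\<close> are listed plays no role. In the theorem \<open>'b\<close> is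
  \<open>'k option\<close>, where \<open>Some j\<close> are the first \<open>k\<close> blocks and \<open>None\<close> is the block number \<open>k+1\<close>.
\<close>

definition block_unitary :: "('n \<Rightarrow> 'b) \<Rightarrow> (complex^'n^'n) set" where
  "block_unitary b = {K \<in> unitary_group. \<forall>i j. b i \<noteq> b j \<longrightarrow> K $ i $ j = 0}"

text \<open>Points of the flag manifold are the left cosets in the unitary group.\<close>

definition flag_proj :: "('n \<Rightarrow> 'b) \<Rightarrow> complex^'n^'n \<Rightarrow> (complex^'n^'n) set" where
  "flag_proj b U = {U ** K | K. K \<in> block_unitary b}"

definition lie_inner :: "complex^'n^'n \<Rightarrow> complex^'n^'n \<Rightarrow> real" where
  "lie_inner X Y = Re (- trace (X ** Y))"

text \<open>
  Tangent vectors to the unitary group at \<open>U\<close> are \<open>U ** X\<close> with \<open>X\<close> skew-Hermitian; the vertical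
  ones (the kernel of the differential of the projection) are those with \<open>X\<close> in the Lie
  algebra of the block-diagonal subgroup.
\<close>

definition vertical :: "('n \<Rightarrow> 'b) \<Rightarrow> (complex^'n^'n) set" where
  "vertical b = {X \<in> skew_hermitian. \<forall>i j. b i \<noteq> b j \<longrightarrow> X $ i $ j = 0}"

definition horizontal :: "('n \<Rightarrow> 'b) \<Rightarrow> (complex^'n^'n) set" where
  "horizontal b = {X \<in> skew_hermitian. \<forall>Y\<in>vertical b. lie_inner X Y = 0}"

definition horizontal_part :: "('n \<Rightarrow> 'b) \<Rightarrow> complex^'n^'n \<Rightarrow> complex^'n^'n" where
  "horizontal_part b X = (THE H. H \<in> horizontal b \<and> X - H \<in> vertical b)"

text \<open>
  The differential at \<open>x\<close> of \<open>flag_proj b \<circ> s\<close>, where \<open>s\<close> takes values in the unitary group. The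
  tangent space of the flag manifold at \<open>flag_proj b U\<close> is identified with \<open>horizontal b\<close> by
  sending \<open>X\<close> to the image of \<open>U ** X\<close> under the differential of the projection.
\<close>

definition flag_diff ::
  "('n \<Rightarrow> 'b) \<Rightarrow> (real^'d \<Rightarrow> complex^'n^'n) \<Rightarrow> real^'d \<Rightarrow> real^'d \<Rightarrow> complex^'n^'n" where
  "flag_diff b s x v = horizontal_part b (ctranspose (s x) ** dir_deriv s x v)"

text \<open>
  Local coordinates on the flag manifold are given by its local parametrizations
  \<open>flag_proj b \<circ> s\<close> on \<open>\<Omega>\<close>: they are injective, have a smooth lift \<open>s\<close> to the unitary group, and
  their differential is an isomorphism at every point. (In the quotient manifold every point has
  such coordinates, since the projection is a submersion.)
\<close>

definition flag_chart ::
  "('n \<Rightarrow> 'b) \<Rightarrow> (real^'d) set \<Rightarrow> (real^'d \<Rightarrow> complex^'n^'n) \<Rightarrow> bool" where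
  "flag_chart b \<Omega> s \<longleftrightarrow>
     open \<Omega> \<and> smooth_on UNIV \<Omega> s \<and> s ` \<Omega> \<subseteq> unitary_group \<and>
     inj_on (flag_proj b \<circ> s) \<Omega> \<and>
     (\<forall>x\<in>\<Omega>. bij_betw (flag_diff b s x) UNIV (horizontal b))"

text \<open>
  The Gram matrix in such coordinates of the metric for which the projection is a Riemannian
  submersion: the length of a tangent vector is that of its horizontal lift.
\<close>

definition flag_metric ::
  "('n \<Rightarrow> 'b) \<Rightarrow> (real^'d \<Rightarrow> complex^'n^'n) \<Rightarrow> real^'d \<Rightarrow> real^'d^'d" where
  "flag_metric b s x =
     (\<chi> i j. lie_inner (flag_diff b s x (axis i 1)) (flag_diff b s x (axis j 1)))"

text \<open>
  The Laplace--Beltrami operator of the flag manifold at the point \<open>p\<close>, as the common value of the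
  coordinate expression in all local coordinates around \<open>p\<close>. The type \<open>'d\<close> only supplies the
  coordinate space \<open>real^'d\<close>; its cardinality has to be the dimension of the flag manifold.
\<close>

definition flag_laplacian ::
  "'d::finite itself \<Rightarrow> ('n::finite \<Rightarrow> 'b) \<Rightarrow>
     ((complex^'n^'n) set \<Rightarrow> complex) \<Rightarrow> (complex^'n^'n) set \<Rightarrow> complex" where
  "flag_laplacian (_ :: 'd itself) b g p =
     (THE L. \<forall>\<Omega> (s :: real^'d \<Rightarrow> complex^'n^'n) x.
        flag_chart b \<Omega> s \<longrightarrow> x \<in> \<Omega> \<longrightarrow> flag_proj b (s x) = p \<longrightarrow>
          laplace_beltrami (flag_metric b s) (\<lambda>y. g (flag_proj b (s y))) x = L)"


section \<open>The radial variables\<close>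

text \<open>
  The last \<open>m\<close> rows of a matrix are the rows with index in the range of an injection
  \<open>r :: 'm \<Rightarrow> 'n\<close>. The columns outside the block \<open>j\<close> are replaced by zero instead of being deleted,
  which does not affect the product of the matrix with its conjugate transpose.
\<close>

definition row_block ::
  "('n \<Rightarrow> 'b) \<Rightarrow> ('m \<Rightarrow> 'n) \<Rightarrow> 'b \<Rightarrow> complex^'n^'n \<Rightarrow> complex^'n^'m" where
  "row_block b r j U = (\<chi> \<alpha> c. if b c = j then U $ r \<alpha> $ c else 0)"

definition regular_set :: "('n \<Rightarrow> 'b) \<Rightarrow> ('m::finite \<Rightarrow> 'n::finite) \<Rightarrow> (complex^'n^'n) set" where
  "regular_set b r =
     {U \<in> unitary_group. \<forall>j. det (row_block b r j U ** ctranspose (row_block b r j U)) \<noteq> 0}"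

definition radial_map ::
  "('n \<Rightarrow> 'k option) \<Rightarrow> ('m \<Rightarrow> 'n) \<Rightarrow> complex^'n^'n \<Rightarrow> complex^'m^'m^'k" where
  "radial_map b r U =
     (\<chi> j. row_block b r (Some j) U ** ctranspose (row_block b r (Some j) U))"

definition hermitian_tuples :: "(complex^'m^'m^'k) set" where
  "hermitian_tuples = {\<Lambda>. \<forall>j. hermitian (\<Lambda> $ j)}"

definition radial_domain :: "(complex^'m^'m^'k) set" where
  "radial_domain = {\<Lambda>. (\<forall>j. pos_def (\<Lambda> $ j)) \<and> pos_def (mat 1 - (\<Sum>j\<in>UNIV. \<Lambda> $ j))}"

text \<open>
  The matrix unit with entry 1 at the position \<open>(\<alpha>, \<beta>)\<close> is \<open>S - \<i> A\<close> with the Hermitian matrices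
  \<open>S = herm_sym \<alpha> \<beta>\<close> and \<open>A = herm_skew \<alpha> \<beta>\<close>. The partial derivative with respect to the entry
  \<open>(\<alpha>, \<beta>)\<close> is the value at this matrix unit of the complex-linear extension of the differential,
  which is a real-linear map on Hermitian matrices.
\<close>

definition herm_sym :: "'m \<Rightarrow> 'm \<Rightarrow> complex^'m^'m" where
  "herm_sym \<alpha> \<beta> =
     (\<chi> \<mu> \<nu>. (of_bool (\<mu> = \<alpha> \<and> \<nu> = \<beta>) + of_bool (\<mu> = \<beta> \<and> \<nu> = \<alpha>)) / 2)"

definition herm_skew :: "'m \<Rightarrow> 'm \<Rightarrow> complex^'m^'m" where
  "herm_skew \<alpha> \<beta> =
     (\<chi> \<mu> \<nu>. \<i> * (of_bool (\<mu> = \<alpha> \<and> \<nu> = \<beta>) - of_bool (\<mu> = \<beta> \<and> \<nu> = \<alpha>)) / 2)"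

definition entry_deriv ::
  "'k \<Rightarrow> 'm \<Rightarrow> 'm \<Rightarrow> (complex^'m^'m^'k \<Rightarrow> complex) \<Rightarrow> complex^'m^'m^'k \<Rightarrow> complex" where
  "entry_deriv j \<alpha> \<beta> f \<Lambda> =
     dir_deriv f \<Lambda> (axis j (herm_sym \<alpha> \<beta>)) - \<i> * dir_deriv f \<Lambda> (axis j (herm_skew \<alpha> \<beta>))"

lemma sum_matrix_unit: "(\<Sum>\<alpha>\<in>UNIV. \<Sum>\<beta>\<in>UNIV. g \<alpha> \<beta> * of_bool (\<mu> = \<alpha> \<and> \<nu> = \<beta>)) = (g (\<mu>::'m::finite) (\<nu>::'m) :: complex)"
proof -
  have "(\<Sum>\<alpha>\<in>UNIV. \<Sum>\<beta>\<in>UNIV. g \<alpha> \<beta> * of_bool (\<mu> = \<alpha> \<and> \<nu> = \<beta>)) = (\<Sum>\<alpha>\<in>UNIV. if \<mu> = \<alpha> then (\<Sum>\<beta>\<in>UNIV. if \<nu> = \<beta> then g \<alpha> \<beta> else 0) else 0)"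
    by (intro sum.cong refl) auto
  also have "\<dots> = g \<mu> \<nu>" by simp
  finally show ?thesis .
qed

lemma hermitian_expansion:
  fixes H :: "complex^'m^'m"
  assumes "hermitian H"
  shows "H = (\<Sum>\<alpha>\<in>UNIV. \<Sum>\<beta>\<in>UNIV.
           Re (H $ \<alpha> $ \<beta>) *\<^sub>R herm_sym \<alpha> \<beta> + Im (H $ \<alpha> $ \<beta>) *\<^sub>R herm_skew \<alpha> \<beta>)" (is "H = ?R")
proof -
  have h: "cnj (H $ j $ i) = H $ i $ j" for i j
    using assms unfolding hermitian_def ctranspose_def by (metis vec_lambda_beta)
  have u2: "(\<Sum>\<alpha>\<in>UNIV. \<Sum>\<beta>\<in>UNIV. g \<alpha> \<beta> * of_bool (\<mu> = \<beta> \<and> \<nu> = \<alpha>)) = (g \<nu> \<mu> :: complex)" for g and \<mu> \<nu> :: 'm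
    using sum_matrix_unit[of g \<nu> \<mu>] by (simp add: conj_commute)
  have "?R $ \<mu> $ \<nu> = H $ \<mu> $ \<nu>" for \<mu> \<nu>
  proof -
    have "?R $ \<mu> $ \<nu> = (\<Sum>\<alpha>\<in>UNIV. \<Sum>\<beta>\<in>UNIV. (H $ \<alpha> $ \<beta> / 2) * of_bool (\<mu> = \<alpha> \<and> \<nu> = \<beta>))
        + (\<Sum>\<alpha>\<in>UNIV. \<Sum>\<beta>\<in>UNIV. (cnj (H $ \<alpha> $ \<beta>) / 2) * of_bool (\<mu> = \<beta> \<and> \<nu> = \<alpha>))"
      unfolding sum.distrib[symmetric] sum_component
      by (intro sum.cong refl) (simp add: herm_sym_def herm_skew_def complex_eq_iff field_simps)
    also have "\<dots> = H $ \<mu> $ \<nu>" by (subst sum_matrix_unit, subst u2) (simp add: h)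
    finally show ?thesis .
  qed
  then show ?thesis by (simp add: vec_eq_iff)
qed

lemma herm_sym_swap: "herm_sym \<beta> \<alpha> = herm_sym \<alpha> \<beta>"
  unfolding herm_sym_def by (subst add.commute) (rule refl)

lemma herm_skew_swap: "herm_skew \<beta> \<alpha> = - herm_skew \<alpha> \<beta>"
proof -
  have "\<i> * (p - q) / 2 = - (\<i> * (q - p) / 2)" for p q :: complex
    by (simp add: complex_eq_iff diff_divide_distrib)
  then have "herm_skew \<beta> \<alpha> $ \<mu> $ \<nu> = (- herm_skew \<alpha> \<beta>) $ \<mu> $ \<nu>" for \<mu> \<nu>
    unfolding herm_skew_def vec_lambda_beta vector_uminus_component .
  then show ?thesis
    unfolding vec_eq_iff by (intro allI)
qed

text \<open>The differential in a Hermitian direction is recovered from these partial derivatives.\<close>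

lemma hermitian_differential:
  fixes H :: "complex^'m^'m" and D :: "complex^'m^'m \<Rightarrow> complex"
  assumes "linear D" "hermitian H"
  shows "(\<Sum>\<alpha>\<in>UNIV. \<Sum>\<beta>\<in>UNIV. H $ \<alpha> $ \<beta> * (D (herm_sym \<alpha> \<beta>) - \<i> * D (herm_skew \<alpha> \<beta>))) = D H" (is "?L = _")
proof -
  have h: "H $ j $ i = cnj (H $ i $ j)" for i j
    using assms(2) unfolding hermitian_def ctranspose_def by (metis vec_lambda_beta)
  have neg: "D (- x) = - D x" for x using linear_neg[OF assms(1)] .
  have sw: "?L = (\<Sum>\<alpha>\<in>UNIV. \<Sum>\<beta>\<in>UNIV. cnj (H $ \<alpha> $ \<beta>) * (D (herm_sym \<alpha> \<beta>) + \<i> * D (herm_skew \<alpha> \<beta>)))"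
  proof (subst sum.swap, intro sum.cong refl)
    fix \<beta> \<alpha> :: 'm
    show "H $ \<alpha> $ \<beta> * (D (herm_sym \<alpha> \<beta>) - \<i> * D (herm_skew \<alpha> \<beta>)) =
        cnj (H $ \<beta> $ \<alpha>) * (D (herm_sym \<beta> \<alpha>) + \<i> * D (herm_skew \<beta> \<alpha>))"
      by (simp only: h[of \<beta> \<alpha>] herm_sym_swap[of \<alpha> \<beta>] herm_skew_swap[of \<alpha> \<beta>] neg) simp
  qed
  have two: "z * (p - \<i> * q) + cnj z * (p + \<i> * q) = 2 * (Re z *\<^sub>R p + Im z *\<^sub>R q)"
    for z p q :: complex
    by (simp add: complex_eq_iff algebra_simps)
  have "2 * ?L = ?L + ?L" by simp
  also have "\<dots> = (\<Sum>\<alpha>\<in>UNIV. \<Sum>\<beta>\<in>UNIV. 2 * (Re (H $ \<alpha> $ \<beta>) *\<^sub>R D (herm_sym \<alpha> \<beta>) + Im (H $ \<alpha> $ \<beta>) *\<^sub>R D (herm_skew \<alpha> \<beta>)))"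
    by (subst (2) sw) (simp only: sum.distrib[symmetric] two)
  also have "\<dots> = 2 * D (\<Sum>\<alpha>\<in>UNIV. \<Sum>\<beta>\<in>UNIV. Re (H $ \<alpha> $ \<beta>) *\<^sub>R herm_sym \<alpha> \<beta> + Im (H $ \<alpha> $ \<beta>) *\<^sub>R herm_skew \<alpha> \<beta>)"
    by (simp add: linear_sum[OF assms(1)] linear_add[OF assms(1)] linear_cmul[OF assms(1)] sum_distrib_left)
  also have "\<dots> = 2 * D H" by (simp only: hermitian_expansion[OF assms(2), symmetric])
  finally show ?thesis by simp
qed

definition radial_laplacian ::
  "('k::finite option \<Rightarrow> nat) \<Rightarrow> (complex^'m^'m^'k \<Rightarrow> complex) \<Rightarrow> complex^'m^'m^'k \<Rightarrow> complex" where
  "radial_laplacian N f \<Lambda> =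
     2 * (\<Sum>j\<in>UNIV. \<Sum>\<alpha>\<in>UNIV. \<Sum>\<beta>\<in>UNIV. \<Sum>\<gamma>\<in>UNIV. \<Sum>\<delta>\<in>UNIV.
            (mat 1 - \<Lambda> $ j) $ \<alpha> $ \<delta> * \<Lambda> $ j $ \<gamma> $ \<beta> *
            entry_deriv j \<alpha> \<beta> (entry_deriv j \<gamma> \<delta> f) \<Lambda>)
     - (\<Sum>j\<in>UNIV. \<Sum>l\<in>UNIV - {j}. \<Sum>\<alpha>\<in>UNIV. \<Sum>\<beta>\<in>UNIV. \<Sum>\<gamma>\<in>UNIV. \<Sum>\<delta>\<in>UNIV.
            (\<Lambda> $ j $ \<alpha> $ \<delta> * \<Lambda> $ l $ \<gamma> $ \<beta> + \<Lambda> $ j $ \<gamma> $ \<beta> * \<Lambda> $ l $ \<alpha> $ \<delta>) *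
            entry_deriv j \<alpha> \<beta> (entry_deriv l \<gamma> \<delta> f) \<Lambda>)
     + 2 * (\<Sum>j\<in>UNIV. \<Sum>\<alpha>\<in>UNIV. \<Sum>\<beta>\<in>UNIV.
            (of_nat (N (Some j)) * mat 1 $ \<alpha> $ \<beta> - of_nat (\<Sum>i\<in>UNIV. N i) * \<Lambda> $ j $ \<alpha> $ \<beta>) *
            entry_deriv j \<alpha> \<beta> f \<Lambda>)"

end

theory Submission
  imports Defs
begin

text \<open>
  In a chart with unitary lift \<open>s\<close> the matrices \<open>A\<^sub>i = s\<^sup>* \<partial>\<^sub>i s\<close> satisfy the Maurer--Cartan
  equation \<open>\<partial>\<^sub>i A\<^sub>j - \<partial>\<^sub>j A\<^sub>i = - [A\<^sub>i, A\<^sub>j]\<close>. If \<open>\<xi>\<close> is an orthonormal basis of the horizontal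
  space and \<open>C\<^sub>i\<^sub>a = \<langle>A\<^sub>i, \<xi>\<^sub>a\<rangle>\<close>, the Gram matrix is \<open>C C\<^sup>T\<close>, and the divergence of the dual frame
  cancels the contribution of the vertical parts of the \<open>A\<^sub>i\<close>: the Laplacian is \<open>\<Sum>\<^sub>a \<xi>\<^sub>a \<xi>\<^sub>a\<close>,
  where the \<open>\<xi>\<^sub>a\<close> act as left-invariant vector fields on the unitary group.

  The \<open>j\<close>-th radial variable is \<open>Z E\<^sub>j Z\<^sup>*\<close> with \<open>Z\<close> the last \<open>m\<close> rows and \<open>E\<^sub>j\<close> the block projections,
  and \<open>X\<close> acts on it by \<open>Z [X, E\<^sub>j] Z\<^sup>*\<close>. The sum over \<open>a\<close> is then evaluated with the
  Casimir identity for \<open>\<Sum>\<^sub>a \<xi>\<^sub>a \<otimes> \<xi>\<^sub>a\<close>.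
\<close>

section \<open>Determinants and inverses of matrix functions\<close>

text \<open>\<open>flag_laplacian\<close> is a definite description, so two things are owed: every
  chart must give the value of the radial operator, and some chart must exist at each point, since
  otherwise the condition is vacuous. A chart carries an arbitrary unitary lift with no preferred
  choice. If \<xi>_a + v_a, with v_a vertical, is the lifted frame field, right invariance of g
  turns v_a \<xi>_a g into [v_a, \<xi>_a] g, and the divergence yields the same sum with the
  opposite sign by the Maurer-Cartan equation and the invariance of the trace form. A second
  obstacle is that f lives on Hermitian tuples, which are not open in the ambient matrix space;
  hence derivatives within the domain, along Hermitian directions, and a calculus built on
  \<open>rel_open\<close>. The Casimir identity pairs p with q' and q with p', whence the index
  pattern of the second-order coefficients. Their factor 2 for j = l comes from two contributions
  exchanged by symmetry of second derivatives. The first-order terms come from the sum of the double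
  commutators [\<xi>_a, [\<xi>_a, E_j]], which is 2 n_j I - 2 n E_j.\<close>

lemma bounded_bilinear_matrix_mult:
  "bounded_bilinear ((**) :: 'f::{real_normed_field,euclidean_space}^'n^'m \<Rightarrow> 'f^'p^'n \<Rightarrow> 'f^'p^'m)"
proof -
  have "bilinear ((**) :: 'f^'n^'m \<Rightarrow> 'f^'p^'n \<Rightarrow> 'f^'p^'m)"
    unfolding bilinear_def
    by (intro conjI allI linearI)
       (simp_all add: vec_eq_iff matrix_matrix_mult_def algebra_simps sum.distrib scaleR_sum_right)
  then show ?thesis by (simp add: bilinear_conv_bounded_bilinear)
qed

lemmas has_derivative_matrix_mult =
  bounded_bilinear.FDERIV[OF bounded_bilinear_matrix_mult]
lemmas has_vector_derivative_matrix_mult =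
  bounded_bilinear.has_vector_derivative[OF bounded_bilinear_matrix_mult]

lemma matrix_inv_inverse:
  fixes A :: "'f::field^'n^'n"
  assumes "det A \<noteq> 0"
  shows "A ** matrix_inv A = mat 1" "matrix_inv A ** A = mat 1"
proof -
  have "\<exists>A'. A ** A' = mat 1 \<and> A' ** A = mat 1"
    using assms by (simp add: invertible_det_nz[symmetric] invertible_def)
  then have "A ** matrix_inv A = mat 1 \<and> matrix_inv A ** A = mat 1"
    unfolding matrix_inv_def by (rule someI_ex)
  then show "A ** matrix_inv A = mat 1" "matrix_inv A ** A = mat 1" by auto
qed

lemma matrix_inv_unique:
  fixes A :: "'f::field^'n^'n"
  assumes "A ** B = mat 1"
  shows "matrix_inv A = B"
proof -
  have "det A * det B = 1" using arg_cong[OF assms, of det] by (simp add: det_mul)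
  then have "det A \<noteq> 0" by auto
  then have "matrix_inv A = matrix_inv A ** (A ** B)" by (simp add: assms)
  also have "\<dots> = B" by (simp add: matrix_mul_assoc matrix_inv_inverse \<open>det A \<noteq> 0\<close>)
  finally show ?thesis .
qed

lemma tendsto_det:
  fixes A :: "'a \<Rightarrow> 'f::real_normed_field^'n^'n"
  assumes "(A \<longlongrightarrow> L) F"
  shows "((\<lambda>y. det (A y)) \<longlongrightarrow> det L) F"
  unfolding det_def by (intro tendsto_intros assms)

lemma eventually_det_nonzero:
  fixes A :: "'a \<Rightarrow> 'f::real_normed_field^'n^'n"
  assumes "(A \<longlongrightarrow> L) F" "det L \<noteq> 0"
  shows "eventually (\<lambda>y. det (A y) \<noteq> 0) F"
  using tendsto_imp_eventually_ne[OF tendsto_det[OF assms(1)] assms(2)] .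

text \<open>Cramer's rule applied to the columns of the inverse. A quotient of determinants is
  visibly continuous, which is what \<open>tendsto_matrix_inv\<close> needs.\<close>

lemma matrix_inv_cramer:
  fixes A :: "'f::field^'n^'n"
  assumes "det A \<noteq> 0"
  shows "matrix_inv A $ k $ c = det (\<chi> i j. if j = k then mat 1 $ i $ c else A $ i $ j) / det A"
proof -
  have "A *v column c (matrix_inv A) = column c (mat 1)"
    using arg_cong[OF matrix_inv_inverse(1)[OF assms], of "column c"]
    by (simp add: vec_eq_iff column_def matrix_matrix_mult_def matrix_vector_mult_def)
  then have "column c (matrix_inv A) =
      (\<chi> k. det (\<chi> i j. if j = k then column c (mat 1) $ i else A $ i $ j) / det A)"
    using cramer[OF assms] by blast
  from arg_cong[OF this, of "\<lambda>v. v $ k"] have "column c (matrix_inv A) $ k =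
      det (\<chi> i j. if j = k then column c (mat 1) $ i else A $ i $ j) / det A" by simp
  then show ?thesis unfolding column_def vec_lambda_beta .
qed

lemma tendsto_matrix_inv:
  fixes A :: "'a \<Rightarrow> 'f::real_normed_field^'n^'n"
  assumes "(A \<longlongrightarrow> L) F" "det L \<noteq> 0"
  shows "((\<lambda>y. matrix_inv (A y)) \<longlongrightarrow> matrix_inv L) F"
proof (intro vec_tendstoI)
  fix k c
  have "((\<lambda>y. det (\<chi> i j. if j = k then mat 1 $ i $ c else A y $ i $ j) / det (A y)) \<longlongrightarrow>
      det (\<chi> i j. if j = k then mat 1 $ i $ c else L $ i $ j) / det L) F"
    by (intro tendsto_divide tendsto_det assms(1) assms(2) tendsto_vec_lambda)
       (auto intro!: tendsto_intros assms(1))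
  moreover have "eventually (\<lambda>y. det (\<chi> i j. if j = k then mat 1 $ i $ c else A y $ i $ j) / det (A y)
      = matrix_inv (A y) $ k $ c) F"
    using eventually_det_nonzero[OF assms] by eventually_elim (simp add: matrix_inv_cramer)
  ultimately show "((\<lambda>y. matrix_inv (A y) $ k $ c) \<longlongrightarrow> matrix_inv L $ k $ c) F"
    unfolding matrix_inv_cramer[OF assms(2)] by (rule Lim_transform_eventually)
qed

text \<open>Where the first factor vanishes, the product rule asks only for continuity of the
  second. This lets the inverse be differentiated before its differentiability is known.\<close>

lemma (in bounded_bilinear) has_derivative_left_zero:
  assumes f: "(f has_derivative f') (at x within S)" and "f x = 0"
    and g: "continuous (at x within S) g"
  shows "((\<lambda>y. prod (f y) (g y)) has_derivative (\<lambda>v. prod (f' v) (g x))) (at x within S)"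
  unfolding has_derivative_within
proof
  have f': "bounded_linear f'" using f by (rule has_derivative_bounded_linear)
  show "bounded_linear (\<lambda>v. prod (f' v) (g x))"
    by (rule bounded_linear_compose[OF bounded_linear_left f'])
  obtain B where B: "\<And>v. norm (f' v) \<le> norm v * B"
    using bounded_linear.bounded[OF f'] by blast
  obtain K where K: "\<And>a b. norm (prod a b) \<le> norm a * norm b * K" "0 < K" using pos_bounded by blast
  have gl: "(g \<longlongrightarrow> g x) (at x within S)" using g by (simp add: continuous_within)
  have e: "((\<lambda>y. (1 / norm (y - x)) *\<^sub>R (f y - f' (y - x))) \<longlongrightarrow> 0) (at x within S)"
    using f \<open>f x = 0\<close> unfolding has_derivative_within by (simp add: algebra_simps)
  have 1: "((\<lambda>y. prod ((1 / norm (y - x)) *\<^sub>R (f y - f' (y - x))) (g y)) \<longlongrightarrow> 0) (at x within S)"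
    using tendsto[OF e gl] by (simp add: zero_left)
  have 2: "((\<lambda>y. (1 / norm (y - x)) *\<^sub>R (prod (f' (y - x)) (g y - g x))) \<longlongrightarrow> 0) (at x within S)"
  proof (rule Lim_null_comparison)
    show "((\<lambda>y. B * K * norm (g y - g x)) \<longlongrightarrow> 0) (at x within S)"
      using tendsto_mult_right_zero[OF tendsto_norm_zero[OF LIM_zero[OF gl]]] by simp
    have "norm ((1 / norm (y - x)) *\<^sub>R (prod (f' (y - x)) (g y - g x))) \<le> B * K * norm (g y - g x)"
      if "y \<noteq> x" for y
    proof -
      have "norm (prod (f' (y - x)) (g y - g x)) \<le> norm (f' (y - x)) * norm (g y - g x) * K" by (rule K)
      also have "\<dots> \<le> (norm (y - x) * B) * norm (g y - g x) * K"
        using B[of "y - x"] K(2) by (intro mult_right_mono) auto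
      finally show ?thesis using that by (simp add: field_simps)
    qed
    then show "\<forall>\<^sub>F y in at x within S. norm ((1 / norm (y - x)) *\<^sub>R (prod (f' (y - x)) (g y - g x)))
        \<le> B * K * norm (g y - g x)"
      by (simp add: eventually_at_filter)
  qed
  \<comment> \<open>The remainder splits into the remainder of \<open>f\<close> times
    \<open>g y\<close>, and \<open>f' (y - x)\<close> times the increment of \<open>g\<close>; both
    tend to 0 after division by the distance.\<close>
  have "prod ((1 / norm (y - x)) *\<^sub>R (f y - f' (y - x))) (g y) + (1 / norm (y - x)) *\<^sub>R (prod (f' (y - x)) (g y - g x))
     = (1 / norm (y - x)) *\<^sub>R (prod (f y) (g y) - (prod (f x) (g x) + prod (f' (y - x)) (g x)))" for y
    by (simp add: \<open>f x = 0\<close> zero_left scaleR_left diff_left diff_right algebra_simps)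
  then show "((\<lambda>y. (1 / norm (y - x)) *\<^sub>R (prod (f y) (g y) - (prod (f x) (g x) + prod (f' (y - x)) (g x)))) \<longlongrightarrow> 0) (at x within S)"
    using tendsto_add[OF 1 2] by simp
qed

text \<open>Uses the resolvent identity A(y)^-1 = A(x)^-1 - A(x)^-1 (A(y) - A(x)) A(y)^-1. The
  middle factor vanishes at x, so continuity of the inverse suffices on the right.\<close>

lemma has_derivative_matrix_inv:
  fixes A :: "'a::real_normed_vector \<Rightarrow> 'f::{real_normed_field,euclidean_space}^'n^'n"
  assumes A: "(A has_derivative A') (at x within S)" and d: "det (A x) \<noteq> 0" and "x \<in> S"
  shows "((\<lambda>y. matrix_inv (A y)) has_derivative (\<lambda>v. - (matrix_inv (A x) ** A' v ** matrix_inv (A x)))) (at x within S)"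
proof -
  interpret m: bounded_bilinear "(**) :: 'f^'n^'n \<Rightarrow> 'f^'n^'n \<Rightarrow> 'f^'n^'n"
    by (rule bounded_bilinear_matrix_mult)
  have cA: "(A \<longlongrightarrow> A x) (at x within S)"
    using has_derivative_continuous[OF A] by (simp add: continuous_within)
  have "((\<lambda>y. A y - A x) has_derivative A') (at x within S)"
    using has_derivative_diff[OF A has_derivative_const[of "A x"]] by simp
  from bounded_linear.has_derivative[OF m.bounded_linear_right this]
  have "((\<lambda>y. matrix_inv (A x) ** (A y - A x)) has_derivative (\<lambda>v. matrix_inv (A x) ** A' v)) (at x within S)" .
  from m.has_derivative_left_zero[OF this]
  have "((\<lambda>y. matrix_inv (A x) ** (A y - A x) ** matrix_inv (A y)) has_derivative
      (\<lambda>v. matrix_inv (A x) ** A' v ** matrix_inv (A x))) (at x within S)"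
    using tendsto_matrix_inv[OF cA d] by (simp add: continuous_within m.zero_right)
  from has_derivative_diff[OF has_derivative_const[of "matrix_inv (A x)"] this]
  have "((\<lambda>y. matrix_inv (A x) - matrix_inv (A x) ** (A y - A x) ** matrix_inv (A y)) has_derivative
      (\<lambda>v. - (matrix_inv (A x) ** A' v ** matrix_inv (A x)))) (at x within S)" by simp
  moreover have "eventually (\<lambda>y. matrix_inv (A x) - matrix_inv (A x) ** (A y - A x) ** matrix_inv (A y)
      = matrix_inv (A y)) (at x within S)"
    using eventually_det_nonzero[OF cA d]
  proof eventually_elim
    case (elim y)
    have "matrix_inv (A x) ** (A y - A x) ** matrix_inv (A y) =
       matrix_inv (A x) ** (A y ** matrix_inv (A y)) - (matrix_inv (A x) ** A x) ** matrix_inv (A y)"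
      by (simp add: m.diff_left m.diff_right matrix_mul_assoc)
    then show ?case by (simp add: matrix_inv_inverse elim d)
  qed
  moreover have "matrix_inv (A x) - matrix_inv (A x) ** (A x - A x) ** matrix_inv (A x) = matrix_inv (A x)"
    by (simp add: m.zero_right m.zero_left)
  ultimately show ?thesis using \<open>x \<in> S\<close> by (rule has_derivative_transform_eventually)
qed

text \<open>A permutation other than the identity moves at least two points, so after one factor of
  its product is differentiated an off-diagonal zero of \<open>mat 1\<close> remains. Only the
  diagonal product contributes.\<close>

lemma has_derivative_det_mat1:
  fixes A :: "'a::real_normed_vector \<Rightarrow> 'f::real_normed_field^'n^'n"
  assumes A: "(A has_derivative A') (at x within S)" and "A x = mat 1"
  shows "((\<lambda>y. det (A y)) has_derivative (\<lambda>v. trace (A' v))) (at x within S)"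
proof -
  let ?P = "{p. p permutes (UNIV :: 'n set)}"
  have A2: "((\<lambda>y. A y $ i $ j) has_derivative (\<lambda>v. A' v $ i $ j)) (at x within S)" for i j
    by (intro bounded_linear.has_derivative[OF bounded_linear_vec_nth] A)
  have D: "((\<lambda>y. det (A y)) has_derivative (\<lambda>v. \<Sum>p\<in>?P. of_int (sign p) *
      (\<Sum>i\<in>UNIV. A' v $ i $ p i * (\<Prod>j\<in>UNIV - {i}. A x $ j $ p j)))) (at x within S)"
    unfolding det_def
    by (intro has_derivative_sum has_derivative_mult_right has_derivative_prod A2)
  have "of_int (sign p) * (\<Sum>i\<in>UNIV. A' v $ i $ p i * (\<Prod>j\<in>UNIV - {i}. A x $ j $ p j))
      = (if p = id then trace (A' v) else 0)" if p: "p \<in> ?P" for p v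
  proof (cases "p = id")
    case True
    then show ?thesis by (simp add: \<open>A x = mat 1\<close> mat_def trace_def sign_id)
  next
    case False
    have "(\<Prod>j\<in>UNIV - {i}. A x $ j $ p j) = 0" for i
    proof -
      have "\<exists>j. j \<noteq> i \<and> p j \<noteq> j"
      proof (rule ccontr)
        assume "\<not> ?thesis"
        then have *: "\<And>j. j \<noteq> i \<Longrightarrow> p j = j" by auto
        moreover have "inj p" using p permutes_inj by auto
        ultimately have "p i = i" by (metis injD)
        then have "p = id" using * by (intro ext) (metis id_apply)
        then show False using False by simp
      qed
      then obtain j where "j \<noteq> i" "p j \<noteq> j" by blast
      then show ?thesis by (intro prod_zero bexI[of _ j]) (auto simp: \<open>A x = mat 1\<close> mat_def)
    qed
    with False show ?thesis by (simp only: mult_zero_right sum.neutral_const if_False)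
  qed
  then have S: "(\<Sum>p\<in>?P. of_int (sign p) * (\<Sum>i\<in>UNIV. A' v $ i $ p i * (\<Prod>j\<in>UNIV - {i}. A x $ j $ p j)))
      = (\<Sum>p\<in>?P. if p = id then trace (A' v) else 0)" for v
    by (rule sum.cong[OF refl])
  have T: "(\<Sum>p\<in>?P. if p = id then trace (A' v) else 0) = trace (A' v)" for v
    by (subst sum.delta) (simp_all add: permutes_id finite_permutations)
  show ?thesis using D unfolding S T .
qed

text \<open>Jacobi's formula, reduced to the case at the identity by multiplying \<open>A y\<close>
  with the fixed matrix \<open>matrix_inv (A x)\<close>.\<close>

lemma has_derivative_det:
  fixes A :: "'a::real_normed_vector \<Rightarrow> 'f::{real_normed_field,euclidean_space}^'n^'n"
  assumes A: "(A has_derivative A') (at x within S)" and d: "det (A x) \<noteq> 0"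
  shows "((\<lambda>y. det (A y)) has_derivative (\<lambda>v. det (A x) * trace (matrix_inv (A x) ** A' v))) (at x within S)"
proof -
  interpret m: bounded_bilinear "(**) :: 'f^'n^'n \<Rightarrow> 'f^'n^'n \<Rightarrow> 'f^'n^'n"
    by (rule bounded_bilinear_matrix_mult)
  have "((\<lambda>y. matrix_inv (A x) ** A y) has_derivative (\<lambda>v. matrix_inv (A x) ** A' v)) (at x within S)"
    by (rule bounded_linear.has_derivative[OF m.bounded_linear_right A])
  from has_derivative_mult_right[OF has_derivative_det_mat1[OF this], of "det (A x)"]
  have "((\<lambda>y. det (A x) * det (matrix_inv (A x) ** A y)) has_derivative
      (\<lambda>v. det (A x) * trace (matrix_inv (A x) ** A' v))) (at x within S)"
    using matrix_inv_inverse[OF d] by simp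
  moreover have "det (A x) * det (matrix_inv (A x) ** A y) = det (A y)" for y
  proof -
    have "det (A x) * det (matrix_inv (A x) ** A y) = det (A x ** (matrix_inv (A x) ** A y))" by (simp add: det_mul)
    also have "\<dots> = det (A y)" by (simp add: matrix_mul_assoc matrix_inv_inverse[OF d])
    finally show ?thesis .
  qed
  ultimately show ?thesis by simp
qed

section \<open>Functions of class $C^r$ on relatively open sets\<close>

text \<open>The subspace condition is included so that short segments through a point of
  \<open>S\<close> in any direction of \<open>V\<close> stay in \<open>S\<close>, which is what
  \<open>dir_deriv\<close> requires.\<close>

definition rel_open :: "'a::real_normed_vector set \<Rightarrow> 'a set \<Rightarrow> bool" where
  "rel_open V S \<longleftrightarrow> subspace V \<and> (\<forall>x\<in>S. \<exists>e>0. \<forall>v\<in>V. norm v < e \<longrightarrow> x + v \<in> S)"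

lemma rel_open_UNIV: "open S \<Longrightarrow> rel_open UNIV S"
  unfolding rel_open_def open_dist
  by (metis (no_types, lifting) add_diff_cancel_left' dist_norm subspace_UNIV)

text \<open>The outer function is differentiable only within \<open>S\<close>. The curve stays in
  \<open>S\<close> on an open set of times, so the derivative can be restricted to the image of that
  set and the chain rule applied there.\<close>

lemma has_vector_derivative_compose_within:
  assumes f: "(f has_derivative f') (at (\<gamma> t) within S)"
    and \<gamma>: "(\<gamma> has_vector_derivative \<gamma>') (at t)"
    and "eventually (\<lambda>u. \<gamma> u \<in> S) (nhds t)"
  shows "((\<lambda>u. f (\<gamma> u)) has_vector_derivative f' \<gamma>') (at t)"
proof -
  obtain T where T: "open T" "t \<in> T" "\<And>u. u \<in> T \<Longrightarrow> \<gamma> u \<in> S"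
    using assms(3) unfolding eventually_nhds by blast
  have "(f has_derivative f') (at (\<gamma> t) within \<gamma> ` T)"
    by (rule has_derivative_subset[OF f]) (use T in auto)
  from vector_derivative_diff_chain_within[OF has_vector_derivative_at_within[OF \<gamma>] this]
  have "((f \<circ> \<gamma>) has_vector_derivative f' \<gamma>') (at t within T)" .
  then show ?thesis using at_within_open[OF T(2,1)] by (simp add: o_def)
qed

lemma rel_open_eventually_line:
  assumes "rel_open V S" "x + t *\<^sub>R v \<in> S" "v \<in> V"
  shows "eventually (\<lambda>u. x + u *\<^sub>R v \<in> S) (nhds t)"
proof -
  obtain e where e: "e > 0" "\<And>w. w \<in> V \<Longrightarrow> norm w < e \<Longrightarrow> x + t *\<^sub>R v + w \<in> S"
    using assms unfolding rel_open_def by blast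
  have "((\<lambda>u. norm ((u - t) *\<^sub>R v)) \<longlongrightarrow> norm ((t - t) *\<^sub>R v)) (nhds t)"
    by (intro tendsto_intros filterlim_ident)
  then have "eventually (\<lambda>u. norm ((u - t) *\<^sub>R v) < e) (nhds t)"
    using \<open>e > 0\<close> by (intro order_tendstoD) auto
  then show ?thesis
  proof eventually_elim
    case (elim u)
    have "(u - t) *\<^sub>R v \<in> V" using assms unfolding rel_open_def by (simp add: subspace_scale)
    from e(2)[OF this elim] show ?case by (simp add: algebra_simps)
  qed
qed

lemma has_vector_derivative_line:
  assumes "rel_open V S" "x + t *\<^sub>R v \<in> S" "v \<in> V" "(f has_derivative f') (at (x + t *\<^sub>R v) within S)"
  shows "((\<lambda>u. f (x + u *\<^sub>R v)) has_vector_derivative f' v) (at t)"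
  by (rule has_vector_derivative_compose_within[where \<gamma> = "\<lambda>u. x + u *\<^sub>R v", OF assms(4)])
     (auto intro!: derivative_eq_intros rel_open_eventually_line[OF assms(1-3)])

text \<open>On \<open>V\<close> this pins down the derivative whose existence is asserted in
  \<open>Ck_on\<close>; outside \<open>V\<close> it remains arbitrary.\<close>

lemma dir_deriv_eq:
  assumes "rel_open V S" "x \<in> S" "v \<in> V" "(f has_derivative f') (at x within S)"
  shows "dir_deriv f x v = f' v"
  unfolding dir_deriv_def using has_vector_derivative_line[of V S x 0 v f f'] assms
  by (simp add: vector_derivative_at)

lemma Ck_on_cong:
  assumes "\<And>x. x \<in> S \<Longrightarrow> f x = g x"
  shows "Ck_on r V S f \<longleftrightarrow> Ck_on r V S g"
proof (cases r)
  case 0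
  then show ?thesis using assms by (auto intro: continuous_on_eq)
next
  case (Suc r)
  have "(f has_derivative D) (at x within S) \<longleftrightarrow> (g has_derivative D) (at x within S)" if "x \<in> S" for x D
    using has_derivative_transform[OF that, of f g] has_derivative_transform[OF that, of g f] assms by metis
  then show ?thesis using Suc by auto
qed

text \<open>The Leibniz rule multiplies the derivative of one factor by the other factor
  undifferentiated, and that one has to be brought down to the lower order.\<close>

lemma Ck_on_pred: "Ck_on (Suc r) V S f \<Longrightarrow> Ck_on r V S f"
proof (induction r arbitrary: f)
  case 0
  then obtain f' where "\<And>x. x \<in> S \<Longrightarrow> (f has_derivative f' x) (at x within S)" by auto
  then show ?case using has_derivative_continuous_on by auto
next
  case (Suc r)
  from Suc.prems obtain f' where f': "\<And>x. x \<in> S \<Longrightarrow> (f has_derivative f' x) (at x within S)"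
     "\<And>v. v \<in> V \<Longrightarrow> Ck_on (Suc r) V S (\<lambda>x. f' x v)" by auto
  have "Ck_on r V S (\<lambda>x. f' x v)" if "v \<in> V" for v by (rule Suc.IH[OF f'(2)[OF that]])
  with f'(1) show ?case by (auto simp del: Ck_on.simps(1))
qed

lemma Ck_on_Suc_dir_deriv:
  assumes "Ck_on (Suc r) V S f" "rel_open V S"
  obtains f' where "\<And>x. x \<in> S \<Longrightarrow> (f has_derivative f' x) (at x within S)"
    "\<And>x v. x \<in> S \<Longrightarrow> v \<in> V \<Longrightarrow> f' x v = dir_deriv f x v"
proof -
  from assms(1) obtain f' where f': "\<And>x. x \<in> S \<Longrightarrow> (f has_derivative f' x) (at x within S)" by auto
  show ?thesis by (rule that[OF f']) (use dir_deriv_eq[OF assms(2) _ _ f'] in auto)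
qed

lemma Ck_on_dir_deriv:
  assumes "Ck_on (Suc r) V S f" "rel_open V S" "v \<in> V"
  shows "Ck_on r V S (\<lambda>x. dir_deriv f x v)"
proof -
  from assms(1) obtain f' where f': "\<And>x. x \<in> S \<Longrightarrow> (f has_derivative f' x) (at x within S)"
     "Ck_on r V S (\<lambda>x. f' x v)" using \<open>v \<in> V\<close> by auto
  then show ?thesis using dir_deriv_eq[OF assms(2) _ assms(3) f'(1)]
    by (subst Ck_on_cong[where g = "\<lambda>x. f' x v"]) auto
qed

lemma Ck_on_const: "Ck_on r V S (\<lambda>x. c)"
proof (induction r arbitrary: c)
  case (Suc r)
  then show ?case by (auto intro!: exI[of _ "\<lambda>_ _. 0"])
qed simp

lemma Ck_on_linear:
  assumes "bounded_linear f" shows "Ck_on r V S f"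
proof (cases r)
  case 0
  then show ?thesis using assms by (simp add: linear_continuous_on)
next
  case (Suc r')
  then show ?thesis using assms by (auto intro!: exI[of _ "\<lambda>_. f"] Ck_on_const bounded_linear_imp_has_derivative)
qed

lemma Ck_on_add:
  assumes "Ck_on r V S f" "Ck_on r V S g"
  shows "Ck_on r V S (\<lambda>x. f x + g x)"
  using assms
proof (induction r arbitrary: f g)
  case (Suc r)
  from Suc.prems(1) obtain f' where "\<And>x. x \<in> S \<Longrightarrow> (f has_derivative f' x) (at x within S)"
    "\<And>v. v \<in> V \<Longrightarrow> Ck_on r V S (\<lambda>x. f' x v)" by auto
  moreover from Suc.prems(2) obtain g' where "\<And>x. x \<in> S \<Longrightarrow> (g has_derivative g' x) (at x within S)"
    "\<And>v. v \<in> V \<Longrightarrow> Ck_on r V S (\<lambda>x. g' x v)" by auto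
  ultimately show ?case using Suc.IH by (auto intro!: exI[of _ "\<lambda>x v. f' x v + g' x v"] has_derivative_add)
qed (auto intro!: continuous_intros)

lemma (in bounded_bilinear) Ck_on_prod:
  assumes "Ck_on r V S f" "Ck_on r V S g"
  shows "Ck_on r V S (\<lambda>x. prod (f x) (g x))"
  using assms
proof (induction r arbitrary: f g)
  case (Suc r)
  from Suc.prems(1) obtain f' where "\<And>x. x \<in> S \<Longrightarrow> (f has_derivative f' x) (at x within S)"
    "\<And>v. v \<in> V \<Longrightarrow> Ck_on r V S (\<lambda>x. f' x v)" by auto
  moreover from Suc.prems(2) obtain g' where "\<And>x. x \<in> S \<Longrightarrow> (g has_derivative g' x) (at x within S)"
    "\<And>v. v \<in> V \<Longrightarrow> Ck_on r V S (\<lambda>x. g' x v)" by auto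
  ultimately show ?case using Suc.IH Suc.prems[THEN Ck_on_pred]
    by (auto intro!: exI[of _ "\<lambda>x v. prod (f x) (g' x v) + prod (f' x v) (g x)"] FDERIV Ck_on_add)
qed (auto intro!: continuous_on)

lemma Ck_on_cmult:
  fixes f :: "'a::real_normed_vector \<Rightarrow> 'b::real_normed_algebra"
  shows "Ck_on r V S f \<Longrightarrow> Ck_on r V S (\<lambda>x. c * f x)"
  by (rule bounded_bilinear.Ck_on_prod[OF bounded_bilinear_mult Ck_on_const])

text \<open>The derivative of the inverse is built from the inverse itself and from A', so each
  order of smoothness follows from the previous one. The induction runs over all orders, hence the
  assumption on \<open>A\<close> for every \<open>r\<close>.\<close>

lemma Ck_on_matrix_inv:
  fixes A :: "'a::real_normed_vector \<Rightarrow> 'f::{real_normed_field,euclidean_space}^'n^'n"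
  assumes A: "\<And>r. Ck_on r V S A" and d: "\<And>x. x \<in> S \<Longrightarrow> det (A x) \<noteq> 0"
  shows "Ck_on r V S (\<lambda>x. matrix_inv (A x))"
proof (induction r)
  case 0
  have "continuous_on S A" using A[of 0] by simp
  then show ?case using d by (auto simp: continuous_on_def intro!: tendsto_matrix_inv)
next
  case (Suc r)
  obtain A' where A': "\<And>x. x \<in> S \<Longrightarrow> (A has_derivative A' x) (at x within S)"
      "\<And>v. v \<in> V \<Longrightarrow> Ck_on r V S (\<lambda>x. A' x v)" using A[of "Suc r"] by auto
  have "Ck_on r V S (\<lambda>x. - (matrix_inv (A x) ** A' x v ** matrix_inv (A x)))" if "v \<in> V" for v
    using bounded_bilinear.Ck_on_prod[OF bounded_bilinear_scaleR Ck_on_const[where c = "-1"]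
      bounded_bilinear.Ck_on_prod[OF bounded_bilinear_matrix_mult
       bounded_bilinear.Ck_on_prod[OF bounded_bilinear_matrix_mult Suc A'(2)[OF that]] Suc]]
    by simp
  then show ?case
    by (auto intro!: exI[of _ "\<lambda>x v. - (matrix_inv (A x) ** A' x v ** matrix_inv (A x))"]
        has_derivative_matrix_inv A' d)
qed

section \<open>Symmetry of second derivatives\<close>

lemma mixed_difference_mean_value:
  fixes F :: "real \<Rightarrow> real \<Rightarrow> real"
  assumes "0 < h"
    and F1: "\<And>s t. 0 \<le> s \<Longrightarrow> s \<le> h \<Longrightarrow> 0 \<le> t \<Longrightarrow> t \<le> h \<Longrightarrow> ((\<lambda>s. F s t) has_real_derivative F1 s t) (at s)"
    and F12: "\<And>s t. 0 \<le> s \<Longrightarrow> s \<le> h \<Longrightarrow> 0 \<le> t \<Longrightarrow> t \<le> h \<Longrightarrow> ((\<lambda>t. F1 s t) has_real_derivative F12 s t) (at t)"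
  obtains s t where "0 < s" "s < h" "0 < t" "t < h" "F h h - F 0 h - F h 0 + F 0 0 = h * h * F12 s t"
proof -
  obtain s where s: "0 < s" "s < h" "(F h h - F h 0) - (F 0 h - F 0 0) = (h - 0) * (F1 s h - F1 s 0)"
    using MVT2[of 0 h "\<lambda>s. F s h - F s 0" "\<lambda>s. F1 s h - F1 s 0"] \<open>0 < h\<close>
    by (force intro!: DERIV_diff F1)
  obtain t where t: "0 < t" "t < h" "F1 s h - F1 s 0 = (h - 0) * F12 s t"
    using MVT2[of 0 h "\<lambda>t. F1 s t" "\<lambda>t. F12 s t"] \<open>0 < h\<close> s by (force intro!: F12)
  show ?thesis by (rule that[OF s(1,2) t(1,2)]) (use s(3) t(3) in \<open>simp add: algebra_simps\<close>)
qed

text \<open>The second difference over the square of side h can be evaluated by the mean value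
  theorem in either order, as h^2 times a value of \<open>F12\<close> or of \<open>F21\<close>
  inside the square. Continuity at the origin then excludes different values there.\<close>

lemma mixed_partials_eq:
  fixes F :: "real \<Rightarrow> real \<Rightarrow> real"
  assumes "0 < e"
    and F1: "\<And>s t. \<bar>s\<bar> < e \<Longrightarrow> \<bar>t\<bar> < e \<Longrightarrow> ((\<lambda>s. F s t) has_real_derivative F1 s t) (at s)"
    and F2: "\<And>s t. \<bar>s\<bar> < e \<Longrightarrow> \<bar>t\<bar> < e \<Longrightarrow> ((\<lambda>t. F s t) has_real_derivative F2 s t) (at t)"
    and F12: "\<And>s t. \<bar>s\<bar> < e \<Longrightarrow> \<bar>t\<bar> < e \<Longrightarrow> ((\<lambda>t. F1 s t) has_real_derivative F12 s t) (at t)"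
    and F21: "\<And>s t. \<bar>s\<bar> < e \<Longrightarrow> \<bar>t\<bar> < e \<Longrightarrow> ((\<lambda>s. F2 s t) has_real_derivative F21 s t) (at s)"
    and c12: "((\<lambda>p. F12 (fst p) (snd p)) \<longlongrightarrow> F12 0 0) (nhds (0, 0))"
    and c21: "((\<lambda>p. F21 (fst p) (snd p)) \<longlongrightarrow> F21 0 0) (nhds (0, 0))"
  shows "F12 0 0 = F21 0 0"
proof (rule ccontr)
  assume ne: "F12 0 0 \<noteq> F21 0 0"
  \<comment> \<open>Half the gap makes the open balls of this radius about the two values
    disjoint.\<close>
  define \<epsilon> where "\<epsilon> = \<bar>F12 0 0 - F21 0 0\<bar> / 2"
  have "\<epsilon> > 0" using ne by (simp add: \<epsilon>_def)
  have "eventually (\<lambda>p. dist (F12 (fst p) (snd p)) (F12 0 0) < \<epsilon> \<and> dist (F21 (fst p) (snd p)) (F21 0 0) < \<epsilon>)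
      (nhds (0, 0))"
    by (intro eventually_conj tendstoD c12 c21 \<open>\<epsilon> > 0\<close>)
  then obtain d where "d > 0" and d: "\<And>p. dist p (0, 0) < d \<Longrightarrow>
      dist (F12 (fst p) (snd p)) (F12 0 0) < \<epsilon> \<and> dist (F21 (fst p) (snd p)) (F21 0 0) < \<epsilon>"
    unfolding eventually_nhds_metric by blast
  \<comment> \<open>Half of \<open>d\<close> suffices because the distance of (s, t) to the origin
    is at most the sum of the absolute values.\<close>
  define h where "h = min (e / 2) (d / 2)"
  have h: "0 < h" "h < e" "h \<le> d / 2" using \<open>0 < e\<close> \<open>d > 0\<close> by (auto simp: h_def)
  have near: "dist (s, t) (0, 0) < d" if "0 < s" "s < h" "0 < t" "t < h" for s t :: real
  proof -
    have "dist (s, t) (0, 0) \<le> \<bar>s\<bar> + \<bar>t\<bar>"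
      using sqrt_sum_squares_le_sum_abs[of s t] by (simp add: dist_Pair_Pair)
    then show ?thesis using that h by linarith
  qed
  obtain s t where st: "0 < s" "s < h" "0 < t" "t < h" "F h h - F 0 h - F h 0 + F 0 0 = h * h * F12 s t"
    by (rule mixed_difference_mean_value[of h F F1 F12]) (use h in \<open>auto intro!: F1 F12\<close>)
  obtain t' s' where st': "0 < t'" "t' < h" "0 < s'" "s' < h" "F h h - F h 0 - F 0 h + F 0 0 = h * h * F21 s' t'"
    by (rule mixed_difference_mean_value[of h "\<lambda>t s. F s t" "\<lambda>t s. F2 s t" "\<lambda>t s. F21 s t"])
       (use h in \<open>auto intro!: F2 F21\<close>)
  have "h * h * F12 s t = h * h * F21 s' t'" using st(5) st'(5) by linarith
  then have "F12 s t = F21 s' t'" using h by simp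
  moreover have "dist (F12 s t) (F12 0 0) < \<epsilon>" using d[OF near[OF st(1-4)]] by simp
  moreover have "dist (F21 s' t') (F21 0 0) < \<epsilon>" using d[OF near[OF st'(3,4,1,2)]] by simp
  ultimately show False unfolding \<epsilon>_def dist_real_def by (auto simp: abs_if split: if_splits)
qed

text \<open>Restriction to the plane spanned by \<open>v\<close> and \<open>w\<close>, followed by a
  coordinate of the target, leaves a real function of two real variables.\<close>

lemma dir_deriv_commute:
  fixes f :: "'a::real_normed_vector \<Rightarrow> 'b::euclidean_space"
  assumes f: "Ck_on 2 V S f" and o: "rel_open V S" and x: "x \<in> S" and v: "v \<in> V" and w: "w \<in> V"
  shows "dir_deriv (\<lambda>y. dir_deriv f y v) x w = dir_deriv (\<lambda>y. dir_deriv f y w) x v"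
proof (rule euclidean_eqI)
  fix i :: 'b
  assume "i \<in> Basis"
  obtain e0 where e0: "e0 > 0" "\<And>u. u \<in> V \<Longrightarrow> norm u < e0 \<Longrightarrow> x + u \<in> S"
    using o x unfolding rel_open_def by blast
  \<comment> \<open>Makes the parallelogram with both parameters below \<open>e\<close> lie within
    norm \<open>e0\<close>; the added 1 keeps the denominator positive and the estimate
    strict.\<close>
  define e where "e = e0 / (norm v + norm w + 1)"
  have n: "0 < norm v + norm w + 1" by (simp add: add_nonneg_pos)
  have "e > 0" using e0 n by (simp add: e_def)
  have inV: "s *\<^sub>R v + t *\<^sub>R w \<in> V" for s t
    using o v w unfolding rel_open_def by (simp add: subspace_add subspace_scale)
  have S: "x + s *\<^sub>R v + t *\<^sub>R w \<in> S" if "\<bar>s\<bar> < e" "\<bar>t\<bar> < e" for s t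
  proof -
    have "norm (s *\<^sub>R v + t *\<^sub>R w) \<le> \<bar>s\<bar> * norm v + \<bar>t\<bar> * norm w"
      by (rule order_trans[OF norm_triangle_ineq]) simp
    also have "\<dots> \<le> e * norm v + e * norm w" using that by (intro add_mono mult_right_mono) auto
    also have "\<dots> < e * (norm v + norm w + 1)" using \<open>e > 0\<close> by (simp add: algebra_simps)
    also have "\<dots> = e0" using n by (simp add: e_def)
    finally show ?thesis using e0(2)[OF inV] by (simp add: add.assoc)
  qed
  have line: "((\<lambda>u. g (y + u *\<^sub>R z) \<bullet> i) has_real_derivative dir_deriv g (y + t *\<^sub>R z) z \<bullet> i) (at t)"
    if g: "Ck_on (Suc r) V S g" and "y + t *\<^sub>R z \<in> S" "z \<in> V" for g y t z r
  proof -
    obtain g' where g': "\<And>x. x \<in> S \<Longrightarrow> (g has_derivative g' x) (at x within S)"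
      "\<And>x v. x \<in> S \<Longrightarrow> v \<in> V \<Longrightarrow> g' x v = dir_deriv g x v"
      by (rule Ck_on_Suc_dir_deriv[OF g o]) (rule that)
    from has_vector_derivative_line[OF o that(2,3) g'(1)[OF that(2)]]
    have "((\<lambda>u. g (y + u *\<^sub>R z)) has_vector_derivative dir_deriv g (y + t *\<^sub>R z) z) (at t)"
      using g'(2)[OF that(2,3)] by simp
    from bounded_linear.has_vector_derivative[OF bounded_linear_inner_left this]
    show ?thesis by (simp add: has_real_derivative_iff_has_vector_derivative)
  qed
  have f2: "Ck_on (Suc (Suc 0)) V S f" using f by (simp add: numeral_2_eq_2)
  have f1: "Ck_on (Suc 0) V S (\<lambda>y. dir_deriv f y z)" if "z \<in> V" for z
    by (rule Ck_on_dir_deriv[OF f2 o that])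
  have f0: "continuous_on S (\<lambda>y. dir_deriv (\<lambda>y. dir_deriv f y z) y z')" if "z \<in> V" "z' \<in> V" for z z'
    using Ck_on_dir_deriv[OF f1[OF that(1)] o that(2)] by simp
  have lim: "((\<lambda>p. dir_deriv (\<lambda>y. dir_deriv f y z) (x + fst p *\<^sub>R v + snd p *\<^sub>R w) z' \<bullet> i) \<longlongrightarrow>
      dir_deriv (\<lambda>y. dir_deriv f y z) (x + 0 *\<^sub>R v + 0 *\<^sub>R w) z' \<bullet> i) (nhds (0, 0))"
    if "z \<in> V" "z' \<in> V" for z z'
  proof -
    define T where "T = {-e<..<e} \<times> {-e<..<e}"
    have T: "open T" "(0, 0) \<in> T" using \<open>e > 0\<close> by (auto simp: T_def intro: open_Times)
    have "continuous_on T (\<lambda>p. dir_deriv (\<lambda>y. dir_deriv f y z) (x + fst p *\<^sub>R v + snd p *\<^sub>R w) z')"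
      by (rule continuous_on_compose2[OF f0[OF that]])
         (auto simp: T_def intro!: continuous_intros S)
    then have "continuous_on T (\<lambda>p. dir_deriv (\<lambda>y. dir_deriv f y z) (x + fst p *\<^sub>R v + snd p *\<^sub>R w) z' \<bullet> i)"
      by (intro continuous_intros)
    then have "isCont (\<lambda>p. dir_deriv (\<lambda>y. dir_deriv f y z) (x + fst p *\<^sub>R v + snd p *\<^sub>R w) z' \<bullet> i) (0, 0)"
      using T by (simp add: continuous_on_eq_continuous_at)
    then have "((\<lambda>p. dir_deriv (\<lambda>y. dir_deriv f y z) (x + fst p *\<^sub>R v + snd p *\<^sub>R w) z' \<bullet> i) \<longlongrightarrow>
        (\<lambda>p. dir_deriv (\<lambda>y. dir_deriv f y z) (x + fst p *\<^sub>R v + snd p *\<^sub>R w) z' \<bullet> i) (0, 0)) (nhds (0, 0))"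
      by (rule tendsto_at_iff_tendsto_nhds[THEN iffD1, OF isCont_def[THEN iffD1]])
    then show ?thesis by simp
  qed
  have sw: "x + s *\<^sub>R v + t *\<^sub>R w = x + t *\<^sub>R w + s *\<^sub>R v" for s t by simp
  have "dir_deriv (\<lambda>y. dir_deriv f y v) (x + 0 *\<^sub>R v + 0 *\<^sub>R w) w \<bullet> i =
     dir_deriv (\<lambda>y. dir_deriv f y w) (x + 0 *\<^sub>R v + 0 *\<^sub>R w) v \<bullet> i"
  proof (rule mixed_partials_eq[OF \<open>e > 0\<close>, where F = "\<lambda>s t. f (x + s *\<^sub>R v + t *\<^sub>R w) \<bullet> i"
      and ?F1.0 = "\<lambda>s t. dir_deriv f (x + s *\<^sub>R v + t *\<^sub>R w) v \<bullet> i"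
      and ?F2.0 = "\<lambda>s t. dir_deriv f (x + s *\<^sub>R v + t *\<^sub>R w) w \<bullet> i"
      and ?F12.0 = "\<lambda>s t. dir_deriv (\<lambda>y. dir_deriv f y v) (x + s *\<^sub>R v + t *\<^sub>R w) w \<bullet> i"
      and ?F21.0 = "\<lambda>s t. dir_deriv (\<lambda>y. dir_deriv f y w) (x + s *\<^sub>R v + t *\<^sub>R w) v \<bullet> i"])
    fix s t :: real
    assume st: "\<bar>s\<bar> < e" "\<bar>t\<bar> < e"
    note S1 = S[OF st] and S2 = S[OF st, unfolded sw]
    show "((\<lambda>s. f (x + s *\<^sub>R v + t *\<^sub>R w) \<bullet> i) has_real_derivative dir_deriv f (x + s *\<^sub>R v + t *\<^sub>R w) v \<bullet> i) (at s)"
      unfolding sw by (rule line[OF f2 S2 v])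
    show "((\<lambda>t. f (x + s *\<^sub>R v + t *\<^sub>R w) \<bullet> i) has_real_derivative dir_deriv f (x + s *\<^sub>R v + t *\<^sub>R w) w \<bullet> i) (at t)"
      by (rule line[OF f2 S1 w])
    show "((\<lambda>t. dir_deriv f (x + s *\<^sub>R v + t *\<^sub>R w) v \<bullet> i) has_real_derivative
        dir_deriv (\<lambda>y. dir_deriv f y v) (x + s *\<^sub>R v + t *\<^sub>R w) w \<bullet> i) (at t)"
      by (rule line[OF f1[OF v] S1 w])
    show "((\<lambda>s. dir_deriv f (x + s *\<^sub>R v + t *\<^sub>R w) w \<bullet> i) has_real_derivative
        dir_deriv (\<lambda>y. dir_deriv f y w) (x + s *\<^sub>R v + t *\<^sub>R w) v \<bullet> i) (at s)"
      unfolding sw by (rule line[OF f1[OF w] S2 v])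
  qed (rule lim v w)+
  then show "dir_deriv (\<lambda>y. dir_deriv f y v) x w \<bullet> i = dir_deriv (\<lambda>y. dir_deriv f y w) x v \<bullet> i"
    by simp
qed

lemma has_vector_derivative_cong_nhds:
  assumes "(f has_vector_derivative D) (at t)" "eventually (\<lambda>u. f u = g u) (nhds t)"
  shows "(g has_vector_derivative D) (at t)"
  using assms has_vector_derivative_cong_ev[where S = UNIV and x = t and f = f and g = g] eventually_nhds_x_imp_x[OF assms(2)]
  by (auto elim: eventually_mono)

lemma has_vector_derivative_vec_lambda:
  assumes "\<And>i. ((\<lambda>t. f t i) has_vector_derivative D i) (at x)"
  shows "((\<lambda>t. \<chi> i. f t i) has_vector_derivative (\<chi> i. D i)) (at x)"
  unfolding has_vector_derivative_def has_derivative_within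
proof (intro conjI vec_tendstoI)
  show "bounded_linear (\<lambda>h. h *\<^sub>R (\<chi> i. D i))" by (rule bounded_linear_scaleR_left)
  fix i
  show "((\<lambda>y. ((1 / norm (y - x)) *\<^sub>R ((\<chi> i. f y i) - ((\<chi> i. f x i) + (y - x) *\<^sub>R (\<chi> i. D i)))) $ i) \<longlongrightarrow> 0 $ i) (at x)"
    using assms[of i] unfolding has_vector_derivative_def has_derivative_within by simp
qed

lemma eventually_line:
  fixes x e :: "'a::real_normed_vector"
  assumes "eventually P (nhds x)"
  shows "eventually (\<lambda>t. P (x + t *\<^sub>R e)) (nhds 0)"
proof -
  have "filterlim (\<lambda>t. x + t *\<^sub>R e) (nhds (x + 0 *\<^sub>R e)) (nhds (0::real))"
    by (intro tendsto_intros filterlim_ident)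
  then show ?thesis using assms by (simp add: filterlim_iff)
qed

section \<open>Skew-Hermitian matrices and horizontal spaces\<close>

lemma ctranspose_nth [simp]: "ctranspose A $ i $ j = cnj (A $ j $ i)"
  by (simp add: ctranspose_def)

lemma ctranspose_mult: "ctranspose (A ** B) = ctranspose B ** ctranspose A"
  by (simp add: vec_eq_iff matrix_matrix_mult_def mult.commute)

lemma ctranspose_ctranspose [simp]: "ctranspose (ctranspose A) = A"
  by (simp add: vec_eq_iff)

lemma ctranspose_add: "ctranspose (A + B) = ctranspose A + ctranspose B"
  and ctranspose_diff: "ctranspose (A - B) = ctranspose A - ctranspose B"
  and ctranspose_minus: "ctranspose (- A) = - ctranspose A"
  and ctranspose_scaleR: "ctranspose (c *\<^sub>R A) = c *\<^sub>R ctranspose A"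
  and ctranspose_mat: "ctranspose (mat 1) = mat 1"
  by (auto simp: vec_eq_iff mat_def)

lemma bounded_linear_ctranspose: "bounded_linear (ctranspose :: complex^'n^'m \<Rightarrow> complex^'m^'n)"
  by (intro linear_conv_bounded_linear[THEN iffD1] linearI) (simp_all add: ctranspose_add ctranspose_scaleR)

lemma matrix_mult_minus_left: "(- A) ** B = - (A ** (B :: 'f::ring_1^'p^'n))"
  and matrix_mult_minus_right: "A ** (- B) = - (A ** B)"
  by (simp_all add: vec_eq_iff matrix_matrix_mult_def sum_negf)

lemmas matrix_diff_left = bounded_bilinear.diff_left[OF bounded_bilinear_matrix_mult]
lemmas matrix_diff_right = bounded_bilinear.diff_right[OF bounded_bilinear_matrix_mult]

definition comm :: "complex^'n^'n \<Rightarrow> complex^'n^'n \<Rightarrow> complex^'n^'n" where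
  "comm A B = A ** B - B ** A"

lemma bilinear_comm: "bilinear comm"
proof -
  interpret m: bounded_bilinear "(**) :: complex^'n^'n \<Rightarrow> complex^'n^'n \<Rightarrow> complex^'n^'n"
    by (rule bounded_bilinear_matrix_mult)
  show ?thesis unfolding bilinear_def comm_def
    by (intro conjI allI linearI)
       (simp_all add: m.add_left m.add_right m.scaleR_left m.scaleR_right algebra_simps)
qed

lemma skew_hermitian_nth: "X \<in> skew_hermitian \<longleftrightarrow> (\<forall>i j. cnj (X $ j $ i) = - X $ i $ j)"
  unfolding skew_hermitian_def by (auto simp: vec_eq_iff)

text \<open>A skew-Hermitian X is minus its adjoint, so the trace form becomes the real Frobenius
  product. Orthonormal bases and projections can then be taken in the Euclidean structure of the
  matrix space.\<close>

lemma lie_inner_eq_inner: "X \<in> skew_hermitian \<Longrightarrow> lie_inner X Y = inner X Y"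
proof -
  assume X: "X \<in> skew_hermitian"
  have "lie_inner X Y = (\<Sum>i\<in>UNIV. \<Sum>j\<in>UNIV. - Re (X $ i $ j * Y $ j $ i))"
    by (simp add: lie_inner_def trace_def matrix_matrix_mult_def flip: sum_negf)
  also have "\<dots> = (\<Sum>i\<in>UNIV. \<Sum>j\<in>UNIV. inner (X $ j $ i) (Y $ j $ i))"
  proof (intro sum.cong refl)
    fix i j
    have "X $ i $ j = - cnj (X $ j $ i)" using X unfolding skew_hermitian_nth by simp
    then show "- Re (X $ i $ j * Y $ j $ i) = inner (X $ j $ i) (Y $ j $ i)"
      by (simp add: inner_complex_def)
  qed
  also have "\<dots> = inner X Y" unfolding inner_vec_def by (rule sum.swap)
  finally show ?thesis .
qed

lemma subspace_skew_hermitian: "subspace skew_hermitian"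
  unfolding subspace_def skew_hermitian_def
  by (auto simp: ctranspose_add ctranspose_scaleR) (simp add: vec_eq_iff)

lemma subspace_vertical: "subspace (vertical b)"
  using subspace_skew_hermitian unfolding vertical_def subspace_def by auto

lemma comm_skew: "X \<in> skew_hermitian \<Longrightarrow> Y \<in> skew_hermitian \<Longrightarrow> comm X Y \<in> skew_hermitian"
  unfolding skew_hermitian_def comm_def
  by (simp add: ctranspose_diff ctranspose_mult matrix_mult_minus_left matrix_mult_minus_right)

text \<open>Infinitesimal Ad-invariance of the metric, from cyclicity of the trace. It drives the
  cancellation of the vertical terms in the divergence.\<close>

lemma inner_comm_comm:
  assumes "X \<in> skew_hermitian" "Y \<in> skew_hermitian"
  shows "inner X (comm Y Z) = - inner (comm Y X) Z"
proof -
  have a: "trace (X ** Z ** Y) = trace (Y ** X ** Z)"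
    by (metis matrix_mul_assoc trace_mul_sym)
  have "lie_inner X (comm Y Z) = - lie_inner (comm Y X) Z"
    unfolding lie_inner_def comm_def
    by (simp add: matrix_diff_left matrix_diff_right trace_sub a matrix_mul_assoc)
  then show ?thesis using assms(1) comm_skew[OF assms(2,1)] by (simp add: lie_inner_eq_inner)
qed

lemma inner_comm_self:
  assumes "X \<in> skew_hermitian" "Y \<in> skew_hermitian"
  shows "inner (comm Y X) X = 0"
  using inner_comm_comm[OF assms, of X] by (simp add: inner_commute)

text \<open>On skew-Hermitian matrices this is the orthogonal projection to the horizontal space, in
  a form free of the description operator of \<open>horizontal_part\<close>.\<close>

definition off_block :: "('n \<Rightarrow> 'b) \<Rightarrow> complex^'n^'n \<Rightarrow> complex^'n^'n" where
  "off_block b X = (\<chi> i j. if b i = b j then 0 else X $ i $ j)"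

lemma off_block_skew: "X \<in> skew_hermitian \<Longrightarrow> off_block b X \<in> skew_hermitian"
  unfolding skew_hermitian_nth off_block_def by auto

lemma vertical_diff_off_block: "X \<in> skew_hermitian \<Longrightarrow> X - off_block b X \<in> vertical b"
  unfolding vertical_def
  using subspace_diff[OF subspace_skew_hermitian _ off_block_skew] by (auto simp: off_block_def)

lemma inner_off_block_vertical:
  "X \<in> skew_hermitian \<Longrightarrow> Y \<in> vertical b \<Longrightarrow> inner (off_block b X) Y = 0"
  unfolding inner_vec_def by (intro sum.neutral ballI) (auto simp: vertical_def off_block_def)

text \<open>For X in the orthogonal complement, the difference of X and its off-block part is
  vertical and orthogonal to both of them, hence to itself, so it vanishes.\<close>

lemma horizontal_iff: "X \<in> horizontal b \<longleftrightarrow> X \<in> skew_hermitian \<and> (\<forall>i j. b i = b j \<longrightarrow> X $ i $ j = 0)"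
proof
  assume "X \<in> horizontal b"
  then have X: "X \<in> skew_hermitian" and o: "\<And>Y. Y \<in> vertical b \<Longrightarrow> inner X Y = 0"
    unfolding horizontal_def by (auto simp: lie_inner_eq_inner)
  have "inner X (X - off_block b X) = 0" by (rule o[OF vertical_diff_off_block[OF X]])
  moreover have "inner (off_block b X) (X - off_block b X) = 0"
    by (rule inner_off_block_vertical[OF X vertical_diff_off_block[OF X]])
  ultimately have "X - off_block b X = 0"
    by (metis diff_self inner_diff_left inner_eq_zero_iff)
  then have e: "X $ i $ j = off_block b X $ i $ j" for i j by simp
  have "X $ i $ j = 0" if "b i = b j" for i j
    using e[of i j] that by (simp add: off_block_def)
  with X show "X \<in> skew_hermitian \<and> (\<forall>i j. b i = b j \<longrightarrow> X $ i $ j = 0)" by blast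
next
  assume X: "X \<in> skew_hermitian \<and> (\<forall>i j. b i = b j \<longrightarrow> X $ i $ j = 0)"
  then have "off_block b X = X" by (auto simp: off_block_def vec_eq_iff)
  then show "X \<in> horizontal b"
    using X inner_off_block_vertical[of X _ b] by (auto simp: horizontal_def lie_inner_eq_inner)
qed

lemma off_block_horizontal: "X \<in> skew_hermitian \<Longrightarrow> off_block b X \<in> horizontal b"
  unfolding horizontal_iff using off_block_skew by (auto simp: off_block_def)

lemma subspace_horizontal: "subspace (horizontal b)"
  using subspace_skew_hermitian unfolding subspace_def by (auto simp: horizontal_iff)

lemma horizontal_vertical_orth: "X \<in> horizontal b \<Longrightarrow> V \<in> vertical b \<Longrightarrow> inner X V = 0"
  unfolding horizontal_def by (auto simp: lie_inner_eq_inner)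

lemma horizontal_part_eq:
  assumes "X \<in> skew_hermitian"
  shows "horizontal_part b X = off_block b X"
  unfolding horizontal_part_def
proof (rule the_equality)
  show "off_block b X \<in> horizontal b \<and> X - off_block b X \<in> vertical b"
    using assms by (simp add: off_block_horizontal vertical_diff_off_block)
  fix H
  assume H: "H \<in> horizontal b \<and> X - H \<in> vertical b"
  have "(X - H) - (X - off_block b X) \<in> vertical b"
    by (rule subspace_diff[OF subspace_vertical]) (use H vertical_diff_off_block[OF assms] in auto)
  then have "off_block b X - H \<in> vertical b" by simp
  moreover have "off_block b X - H \<in> horizontal b"
    by (rule subspace_diff[OF subspace_horizontal off_block_horizontal[OF assms]]) (use H in auto)
  ultimately have "inner (off_block b X - H) (off_block b X - H) = 0"
    using horizontal_vertical_orth by blast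
  then show "H = off_block b X" by simp
qed

lemma comm_vertical: "X \<in> vertical b \<Longrightarrow> Y \<in> vertical b \<Longrightarrow> comm X Y \<in> vertical b"
proof -
  have "(X ** Y) $ i $ j = 0" if "\<And>i j. b i \<noteq> b j \<Longrightarrow> X $ i $ j = 0" "\<And>i j. b i \<noteq> b j \<Longrightarrow> Y $ i $ j = 0" "b i \<noteq> b j"
    for i j and X Y :: "complex^'a^'a"
    unfolding matrix_matrix_mult_def vec_lambda_beta
    by (intro sum.neutral ballI) (use that in \<open>metis mult_eq_0_iff\<close>)
  then show "X \<in> vertical b \<Longrightarrow> Y \<in> vertical b \<Longrightarrow> comm X Y \<in> vertical b"
    unfolding vertical_def using comm_skew by (auto simp: comm_def)
qed

section \<open>The Laplacian in a horizontal frame\<close>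

definition maurer_cartan :: "(real^'d \<Rightarrow> complex^'n^'n) \<Rightarrow> 'd \<Rightarrow> real^'d \<Rightarrow> complex^'n^'n" where
  "maurer_cartan s i y = ctranspose (s y) ** dir_deriv s y (axis i 1)"

lemma has_vector_derivative_chart_line:
  fixes f :: "real^'d \<Rightarrow> 'b::real_normed_vector"
  assumes "open \<Omega>" "x \<in> \<Omega>" "Ck_on (Suc r) UNIV \<Omega> f"
  shows "((\<lambda>t. f (x + t *\<^sub>R v)) has_vector_derivative dir_deriv f x v) (at 0)"
proof -
  obtain f' where f': "\<And>x. x \<in> \<Omega> \<Longrightarrow> (f has_derivative f' x) (at x within \<Omega>)"
    "\<And>x v. x \<in> \<Omega> \<Longrightarrow> v \<in> UNIV \<Longrightarrow> f' x v = dir_deriv f x v"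
    by (rule Ck_on_Suc_dir_deriv[OF assms(3) rel_open_UNIV[OF assms(1)]]) (rule that)
  show ?thesis
    using has_vector_derivative_line[OF rel_open_UNIV[OF assms(1)], of x 0 v f "f' x"] f' assms(2) by simp
qed

text \<open>Separated from \<open>flag_chart\<close> because the construction of a chart needs the
  Maurer-Cartan calculus before injectivity and the isomorphism condition are established.\<close>

definition unitary_lift :: "(real^'d) set \<Rightarrow> (real^'d \<Rightarrow> complex^'n^'n) \<Rightarrow> bool" where
  "unitary_lift \<Omega> s \<longleftrightarrow> open \<Omega> \<and> smooth_on UNIV \<Omega> s \<and> s ` \<Omega> \<subseteq> unitary_group"

lemma flag_chart_unitary_lift: "flag_chart b \<Omega> s \<Longrightarrow> unitary_lift \<Omega> s"
  by (simp add: flag_chart_def unitary_lift_def)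

context
  fixes \<Omega> :: "(real^'d) set" and s :: "real^'d \<Rightarrow> complex^'n^'n"
  assumes chart: "unitary_lift \<Omega> s"
begin

lemma chart_open: "open \<Omega>" and chart_Ck: "Ck_on r UNIV \<Omega> s"
  and chart_unitary: "x \<in> \<Omega> \<Longrightarrow> ctranspose (s x) ** s x = mat 1" "x \<in> \<Omega> \<Longrightarrow> s x ** ctranspose (s x) = mat 1"
  using chart by (auto simp: unitary_lift_def smooth_on_def unitary_group_def)

lemma chart_has_vector_derivative:
  "x \<in> \<Omega> \<Longrightarrow> ((\<lambda>t. s (x + t *\<^sub>R v)) has_vector_derivative dir_deriv s x v) (at 0)"
  by (rule has_vector_derivative_chart_line[OF chart_open _ chart_Ck])

lemma chart_eventually: "x \<in> \<Omega> \<Longrightarrow> eventually (\<lambda>y. y \<in> \<Omega>) (nhds x)"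
  using chart_open eventually_nhds by blast

text \<open>Differentiation of the constant product of the adjoint of \<open>s\<close> with
  \<open>s\<close>.\<close>

lemma chart_logderiv_skew:
  assumes "x \<in> \<Omega>"
  shows "ctranspose (s x) ** dir_deriv s x v \<in> skew_hermitian"
proof -
  note D = chart_has_vector_derivative[OF assms, of v]
  have "((\<lambda>t. ctranspose (s (x + t *\<^sub>R v)) ** s (x + t *\<^sub>R v)) has_vector_derivative
      ctranspose (s (x + 0 *\<^sub>R v)) ** dir_deriv s x v + ctranspose (dir_deriv s x v) ** s (x + 0 *\<^sub>R v)) (at 0)"
    by (rule has_vector_derivative_matrix_mult[OF bounded_linear.has_vector_derivative[OF bounded_linear_ctranspose D] D])
  moreover have "((\<lambda>t. ctranspose (s (x + t *\<^sub>R v)) ** s (x + t *\<^sub>R v)) has_vector_derivative 0) (at 0)"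
    by (rule has_vector_derivative_cong_nhds[OF has_vector_derivative_const[of "mat 1"]])
       (use eventually_line[OF chart_eventually[OF assms], of v] in \<open>auto elim!: eventually_mono simp: chart_unitary\<close>)
  ultimately have "ctranspose (s x) ** dir_deriv s x v + ctranspose (dir_deriv s x v) ** s x = 0"
    using vector_derivative_unique_at by fastforce
  then show ?thesis
    by (simp add: skew_hermitian_def ctranspose_mult eq_neg_iff_add_eq_0 add.commute)
qed

lemma maurer_cartan_skew: "x \<in> \<Omega> \<Longrightarrow> maurer_cartan s i x \<in> skew_hermitian"
  unfolding maurer_cartan_def by (rule chart_logderiv_skew)

text \<open>With the derivative of \<open>s\<close> written as \<open>s\<close> times A_i, the
  derivative of the adjoint contributes the adjoint of A_i times A_j, that is -A_i A_j; the
  remaining term contains the second derivative of \<open>s\<close>.\<close>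

lemma maurer_cartan_has_vector_derivative:
  assumes "x \<in> \<Omega>"
  shows "((\<lambda>t. maurer_cartan s j (x + t *\<^sub>R axis i 1)) has_vector_derivative
    - (maurer_cartan s i x ** maurer_cartan s j x) + ctranspose (s x) ** dir_deriv (\<lambda>y. dir_deriv s y (axis j 1)) x (axis i 1)) (at 0)"
proof -
  note D = chart_has_vector_derivative[OF assms, of "axis i 1"]
  have "Ck_on (Suc 0) UNIV \<Omega> (\<lambda>y. dir_deriv s y (axis j 1))"
    by (rule Ck_on_dir_deriv[OF chart_Ck rel_open_UNIV[OF chart_open]]) simp
  note D2 = has_vector_derivative_chart_line[OF chart_open assms this, of "axis i 1"]
  have "((\<lambda>t. maurer_cartan s j (x + t *\<^sub>R axis i 1)) has_vector_derivative
      ctranspose (s (x + 0 *\<^sub>R axis i 1)) ** dir_deriv (\<lambda>y. dir_deriv s y (axis j 1)) x (axis i 1) +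
      ctranspose (dir_deriv s x (axis i 1)) ** dir_deriv s (x + 0 *\<^sub>R axis i 1) (axis j 1)) (at 0)"
    unfolding maurer_cartan_def
    by (rule has_vector_derivative_matrix_mult[OF bounded_linear.has_vector_derivative[OF bounded_linear_ctranspose D] D2])
  moreover have "dir_deriv s x (axis k 1) = s x ** maurer_cartan s k x" for k
    by (simp add: maurer_cartan_def matrix_mul_assoc chart_unitary(2)[OF assms])
  then have "ctranspose (dir_deriv s x (axis i 1)) ** dir_deriv s x (axis j 1) =
     ctranspose (maurer_cartan s i x) ** (ctranspose (s x) ** s x) ** maurer_cartan s j x"
    by (simp add: ctranspose_mult matrix_mul_assoc)
  then have "ctranspose (dir_deriv s x (axis i 1)) ** dir_deriv s x (axis j 1) = - (maurer_cartan s i x ** maurer_cartan s j x)"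
    using maurer_cartan_skew[OF assms, of i]
    by (simp add: chart_unitary(1)[OF assms] skew_hermitian_def matrix_mult_minus_left)
  ultimately show ?thesis by (simp add: add.commute)
qed

text \<open>The terms with second derivatives of \<open>s\<close> are symmetric in i and j and
  cancel; the products of first derivatives leave the commutator.\<close>

lemma maurer_cartan_equation:
  assumes "x \<in> \<Omega>"
    and "((\<lambda>t. maurer_cartan s j (x + t *\<^sub>R axis i 1)) has_vector_derivative D) (at 0)"
    and "((\<lambda>t. maurer_cartan s i (x + t *\<^sub>R axis j 1)) has_vector_derivative D') (at 0)"
  shows "D - D' = - comm (maurer_cartan s i x) (maurer_cartan s j x)"
proof -
  have "dir_deriv (\<lambda>y. dir_deriv s y (axis j 1)) x (axis i 1) = dir_deriv (\<lambda>y. dir_deriv s y (axis i 1)) x (axis j 1)"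
    by (rule dir_deriv_commute[OF chart_Ck rel_open_UNIV[OF chart_open] assms(1)]) simp_all
  then show ?thesis
    using vector_derivative_unique_at[OF assms(2) maurer_cartan_has_vector_derivative[OF assms(1)]]
      vector_derivative_unique_at[OF assms(3) maurer_cartan_has_vector_derivative[OF assms(1)]]
    by (simp add: comm_def)
qed

lemma flag_diff_axis:
  assumes "y \<in> \<Omega>"
  shows "flag_diff b s y (axis i 1) = off_block b (maurer_cartan s i y)"
  unfolding flag_diff_def using horizontal_part_eq[OF chart_logderiv_skew[OF assms]] by (simp add: maurer_cartan_def)

end

text \<open>The frame is indexed by the coordinate type, so that passing from coordinate fields to
  frame fields is a square matrix with a determinant.\<close>

locale flag_frame =
  fixes b :: "'n::finite \<Rightarrow> 'b" and \<xi> :: "'d::finite \<Rightarrow> complex^'n^'n"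
  assumes frame_horizontal: "\<xi> a \<in> horizontal b"
    and frame_orthonormal: "inner (\<xi> a) (\<xi> c) = of_bool (a = c)"
    and frame_expansion: "X \<in> horizontal b \<Longrightarrow> X = (\<Sum>a\<in>UNIV. inner X (\<xi> a) *\<^sub>R \<xi> a)"
begin

lemma frame_skew: "\<xi> a \<in> skew_hermitian"
  using frame_horizontal horizontal_iff by blast

lemma inner_vertical_frame: "V \<in> vertical b \<Longrightarrow> inner V (\<xi> a) = 0"
  using horizontal_vertical_orth[OF frame_horizontal] by (simp add: inner_commute)

lemma off_block_expansion:
  assumes "X \<in> skew_hermitian"
  shows "off_block b X = (\<Sum>a\<in>UNIV. inner X (\<xi> a) *\<^sub>R \<xi> a)"
proof -
  have "inner X (\<xi> a) = inner (off_block b X) (\<xi> a)" for a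
    using inner_vertical_frame[OF vertical_diff_off_block[OF assms]] by (simp add: inner_diff_left)
  then show ?thesis using frame_expansion[OF off_block_horizontal[OF assms]] by simp
qed

text \<open>Meant for derivatives of right-invariant functions: these vanish in vertical directions
  and so see only the horizontal part.\<close>

lemma linear_frame_expansion:
  assumes "linear L" "\<And>V. V \<in> vertical b \<Longrightarrow> L V = 0" "X \<in> skew_hermitian"
  shows "L X = (\<Sum>a\<in>UNIV. inner X (\<xi> a) *\<^sub>R L (\<xi> a))"
proof -
  have "L X = L (off_block b X)"
    using assms(2)[OF vertical_diff_off_block[OF assms(3)]] by (simp add: linear_diff[OF assms(1)])
  then show ?thesis
    by (simp add: off_block_expansion[OF assms(3)] linear_sum[OF assms(1)] linear_cmul[OF assms(1)])
qed

definition frame_matrix :: "(real^'d \<Rightarrow> complex^'n^'n) \<Rightarrow> real^'d \<Rightarrow> real^'d^'d" where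
  "frame_matrix s y = (\<chi> i a. inner (maurer_cartan s i y) (\<xi> a))"

lemma flag_metric_eq:
  assumes "unitary_lift \<Omega> s" "y \<in> \<Omega>"
  shows "flag_metric b s y = frame_matrix s y ** transpose (frame_matrix s y)"
proof -
  have "lie_inner (off_block b (maurer_cartan s i y)) (off_block b (maurer_cartan s j y)) =
      (\<Sum>a\<in>UNIV. inner (maurer_cartan s i y) (\<xi> a) * inner (maurer_cartan s j y) (\<xi> a))" for i j
    unfolding lie_inner_eq_inner[OF off_block_skew[OF maurer_cartan_skew[OF assms]]]
    by (simp add: off_block_expansion maurer_cartan_skew[OF assms] inner_sum_left inner_sum_right frame_orthonormal mult.commute)
  then show ?thesis
    by (simp add: flag_metric_def flag_diff_axis[OF assms] vec_eq_iff frame_matrix_def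
        matrix_matrix_mult_def transpose_def)
qed

lemma linear_flag_diff:
  assumes "unitary_lift \<Omega> s" "y \<in> \<Omega>"
  shows "flag_diff b s y v = (\<Sum>i\<in>UNIV. v $ i *\<^sub>R off_block b (maurer_cartan s i y))"
proof -
  obtain s' where s': "\<And>x. x \<in> \<Omega> \<Longrightarrow> (s has_derivative s' x) (at x within \<Omega>)"
    "\<And>x v. x \<in> \<Omega> \<Longrightarrow> v \<in> UNIV \<Longrightarrow> s' x v = dir_deriv s x v"
    by (rule Ck_on_Suc_dir_deriv[OF chart_Ck[OF assms(1)] rel_open_UNIV[OF chart_open[OF assms(1)]]]) (rule that)
  \<comment> \<open>Linearity in the direction is not built into \<open>dir_deriv\<close>; it is
    inherited from the Frechet derivative.\<close>
  have lin: "linear (dir_deriv s y)"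
    using has_derivative_linear[OF s'(1)[OF assms(2)]] s'(2)[OF assms(2)] by (simp add: linear_iff)
  have "v = (\<Sum>i\<in>UNIV. v $ i *\<^sub>R axis i 1)"
    by (simp add: vec_eq_iff axis_def if_distrib[of "\<lambda>x. _ * x"] cong: if_cong)
  then have "dir_deriv s y v = dir_deriv s y (\<Sum>i\<in>UNIV. v $ i *\<^sub>R axis i 1)" by simp
  then have "dir_deriv s y v = (\<Sum>i\<in>UNIV. v $ i *\<^sub>R dir_deriv s y (axis i 1))"
    by (simp only: linear_sum[OF lin] linear_cmul[OF lin])
  then have "ctranspose (s y) ** dir_deriv s y v = (\<Sum>i\<in>UNIV. v $ i *\<^sub>R maurer_cartan s i y)"
    by (simp add: maurer_cartan_def bounded_bilinear.sum_right[OF bounded_bilinear_matrix_mult]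
        bounded_bilinear.scaleR_right[OF bounded_bilinear_matrix_mult])
  then have "flag_diff b s y v = off_block b (\<Sum>i\<in>UNIV. v $ i *\<^sub>R maurer_cartan s i y)"
    unfolding flag_diff_def horizontal_part_eq[OF chart_logderiv_skew[OF assms]] by simp
  also have "\<dots> = (\<Sum>i\<in>UNIV. v $ i *\<^sub>R off_block b (maurer_cartan s i y))"
    by (simp add: vec_eq_iff off_block_def)
  finally show ?thesis .
qed

text \<open>Surjectivity of the differential provides preimages of the frame vectors; their
  coordinates are the rows of a left inverse.\<close>

lemma det_frame_matrix:
  assumes "flag_chart b \<Omega> s" "y \<in> \<Omega>"
  shows "det (frame_matrix s y) \<noteq> 0"
proof -
  note lift = flag_chart_unitary_lift[OF assms(1)] assms(2)
  have "\<exists>v. flag_diff b s y v = \<xi> a" for a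
    using assms frame_horizontal unfolding flag_chart_def bij_betw_def by (metis UNIV_I imageE)
  then obtain w where w: "\<And>a. flag_diff b s y (w a) = \<xi> a" by metis
  have "(\<Sum>i\<in>UNIV. w a $ i * inner (maurer_cartan s i y) (\<xi> c)) = of_bool (a = c)" for a c
  proof -
    have "inner (flag_diff b s y (w a)) (\<xi> c) = of_bool (a = c)" by (simp add: w frame_orthonormal)
    moreover have "inner (off_block b (maurer_cartan s i y)) (\<xi> c) = inner (maurer_cartan s i y) (\<xi> c)" for i
      using maurer_cartan_skew[OF lift] by (simp add: off_block_expansion inner_sum_left frame_orthonormal)
    ultimately show ?thesis by (simp add: linear_flag_diff[OF lift] inner_sum_left)
  qed
  then have "(\<chi> a i. w a $ i) ** frame_matrix s y = mat 1"
    by (simp add: vec_eq_iff matrix_matrix_mult_def frame_matrix_def mat_def)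
  from arg_cong[OF this, of det] show ?thesis by (auto simp: det_mul)
qed

lemma tendsto_frame_matrix:
  assumes chart: "unitary_lift \<Omega> s" and x: "x \<in> \<Omega>"
  shows "(frame_matrix s \<longlongrightarrow> frame_matrix s x) (nhds x)"
  unfolding frame_matrix_def
proof (intro vec_tendstoI)
    fix i a
    have "Ck_on 0 UNIV \<Omega> (\<lambda>y. dir_deriv s y (axis i 1))" "Ck_on 0 UNIV \<Omega> s"
      by (rule Ck_on_dir_deriv[OF chart_Ck[OF chart] rel_open_UNIV[OF chart_open[OF chart]]], simp)
         (rule chart_Ck[OF chart])
    then have "continuous_on \<Omega> (\<lambda>y. inner (maurer_cartan s i y) (\<xi> a))"
      unfolding maurer_cartan_def
      by (intro continuous_on_inner continuous_on_const bounded_bilinear.continuous_on[OF bounded_bilinear_matrix_mult]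
          bounded_linear.continuous_on[OF bounded_linear_ctranspose]) simp_all
    then have "isCont (\<lambda>y. inner (maurer_cartan s i y) (\<xi> a)) x"
      using continuous_on_eq_continuous_at[OF chart_open[OF chart]] x by blast
    then show "((\<lambda>y. (\<chi> i a. inner (maurer_cartan s i y) (\<xi> a)) $ i $ a) \<longlongrightarrow> (\<chi> i a. inner (maurer_cartan s i x) (\<xi> a)) $ i $ a) (nhds x)"
      unfolding isCont_def using tendsto_at_iff_tendsto_nhds[of "\<lambda>y. inner (maurer_cartan s i y) (\<xi> a)" x] by simp
  qed

text \<open>
  \<open>L X\<close> and \<open>L2 Y X\<close> stand for the derivatives \<open>X g\<close> and \<open>Y X g\<close> along left-invariant fields of a
  function \<open>g\<close> on the unitary group that is right invariant under the block-diagonal subgroup;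
  invariance enters through \<open>V g = 0\<close> and \<open>V X g = [V, X] g\<close> for vertical \<open>V\<close>.
\<close>

lemma laplace_beltrami_eq:
  fixes u :: "real^'d \<Rightarrow> complex" and L L2 :: "complex^'n^'n \<Rightarrow> complex^'n^'n \<Rightarrow> complex"
  assumes fchart: "flag_chart b \<Omega> s" and x: "x \<in> \<Omega>"
    and L: "\<And>U. linear (\<lambda>X. L X U)" and L_vertical: "\<And>V U. V \<in> vertical b \<Longrightarrow> L V U = 0"
    and L2: "\<And>X. linear (\<lambda>Y. L2 Y X)"
    and L2_vertical: "\<And>V X. V \<in> vertical b \<Longrightarrow> L2 V X = L (comm V X) (s x)"
    and u: "eventually (\<lambda>y. \<forall>i. dir_deriv u y (axis i 1) = L (maurer_cartan s i y) (s y)) (nhds x)"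
    and DL: "\<And>a i. ((\<lambda>t. L (\<xi> a) (s (x + t *\<^sub>R axis i 1))) has_vector_derivative L2 (maurer_cartan s i x) (\<xi> a)) (at 0)"
  shows "laplace_beltrami (flag_metric b s) u x = (\<Sum>a\<in>UNIV. L2 (\<xi> a) (\<xi> a))"
proof -
  note chart = flag_chart_unitary_lift[OF fchart]
  define C where "C = frame_matrix s"
  \<comment> \<open>The root of det (C C^T) is the absolute value of det C. Near \<open>x\<close>
    the sign is constant, so the root equals \<open>\<sigma> * det (C y)\<close> and is
    differentiable.\<close>
  define \<sigma> where "\<sigma> = sgn (det (C x))"
  define K where "K = matrix_inv (C x)"
  define l where "l a = L (\<xi> a) (s x)" for a
  have dC: "det (C y) \<noteq> 0" if "y \<in> \<Omega>" for y
    unfolding C_def by (rule det_frame_matrix[OF fchart that])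
  define DA where "DA i j = - (maurer_cartan s i x ** maurer_cartan s j x) + ctranspose (s x) ** dir_deriv (\<lambda>y. dir_deriv s y (axis j 1)) x (axis i 1)" for i j
  have DA: "((\<lambda>t. maurer_cartan s j (x + t *\<^sub>R axis i 1)) has_vector_derivative DA i j) (at 0)" for i j
    unfolding DA_def by (rule maurer_cartan_has_vector_derivative[OF chart x])
  define C' where "C' i = (\<chi> j a. inner (DA i j) (\<xi> a))" for i
  have C': "((\<lambda>t. C (x + t *\<^sub>R axis i 1)) has_vector_derivative C' i) (at 0)" for i
    unfolding C_def frame_matrix_def C'_def
    by (intro has_vector_derivative_vec_lambda bounded_linear.has_vector_derivative[OF bounded_linear_inner_left DA])
  have Cd: "((\<lambda>t. C (x + t *\<^sub>R axis i 1)) has_derivative (\<lambda>h. h *\<^sub>R C' i)) (at 0)" for i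
    using C' by (simp add: has_vector_derivative_def)
  have dx: "det (C (x + 0 *\<^sub>R axis i 1)) \<noteq> 0" for i using dC[OF x] by simp
  interpret m: bounded_bilinear "(**) :: real^'d^'d \<Rightarrow> real^'d^'d \<Rightarrow> real^'d^'d"
    by (rule bounded_bilinear_matrix_mult)
  have detD: "((\<lambda>t. det (C (x + t *\<^sub>R axis i 1))) has_vector_derivative det (C x) * trace (K ** C' i)) (at 0)" for i
    using has_derivative_det[OF Cd dx]
    by (simp add: has_vector_derivative_def K_def m.scaleR_right trace_def mult_ac flip: sum_distrib_left)
  have invD: "((\<lambda>t. matrix_inv (C (x + t *\<^sub>R axis i 1)) $ a $ c) has_vector_derivative - (K ** C' i ** K) $ a $ c) (at 0)" for i a c
  proof -
    have "((\<lambda>t. matrix_inv (C (x + t *\<^sub>R axis i 1))) has_vector_derivative - (K ** C' i ** K)) (at 0)"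
      using has_derivative_matrix_inv[OF Cd dx]
      by (simp add: has_vector_derivative_def K_def m.scaleR_right m.scaleR_left)
    from bounded_linear.has_vector_derivative[OF bounded_linear_compose[OF bounded_linear_vec_nth bounded_linear_vec_nth] this]
    show ?thesis by simp
  qed
  \<comment> \<open>The inverse Gram matrix is C^-T C^-1 and the partial derivatives of u are C
    applied to the frame derivatives, so one factor C cancels and C^-T remains.\<close>
  have flux: "eventually (\<lambda>y. sqrt (det (flag_metric b s y)) *\<^sub>R
      (\<Sum>j\<in>UNIV. (matrix_inv (flag_metric b s y) $ i $ j) *\<^sub>R dir_deriv u y (axis j 1)) =
      (\<sigma> * det (C y)) *\<^sub>R (\<Sum>a\<in>UNIV. (matrix_inv (C y) $ a $ i) *\<^sub>R L (\<xi> a) (s y))) (nhds x)" for i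
  proof -
    have "((\<lambda>t. C t) \<longlongrightarrow> C x) (nhds x)"
      unfolding C_def by (rule tendsto_frame_matrix[OF chart x])
    from tendsto_mult[OF tendsto_const[of "\<sigma>"] tendsto_det[OF this]]
    have "((\<lambda>y. \<sigma> * det (C y)) \<longlongrightarrow> \<sigma> * det (C x)) (nhds x)" .
    moreover have "\<sigma> * det (C x) > 0" using dC[OF x] by (cases "det (C x) > 0") (auto simp: \<sigma>_def)
    ultimately have "eventually (\<lambda>y. \<sigma> * det (C y) > 0) (nhds x)" by (rule order_tendstoD)
    with chart_eventually[OF chart x] u show ?thesis
    proof eventually_elim
      case (elim y)
      have "\<bar>\<sigma>\<bar> = 1" using dC[OF x] by (simp add: \<sigma>_def abs_sgn_eq)
      then have det: "sqrt (det (flag_metric b s y)) = \<sigma> * det (C y)"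
        using elim(3) abs_mult[of \<sigma> "det (C y)"]
        by (simp add: flag_metric_eq[OF chart elim(1)] C_def[symmetric] det_mul)
      let ?M = "matrix_inv (C y)"
      note inv = matrix_inv_inverse[OF dC[OF elim(1)]]
      have "C y ** transpose (C y) ** (transpose ?M ** ?M) = C y ** (transpose (?M ** C y)) ** ?M"
        by (simp add: matrix_transpose_mul matrix_mul_assoc)
      then have ginv: "matrix_inv (flag_metric b s y) = transpose ?M ** ?M"
        unfolding flag_metric_eq[OF chart elim(1)] C_def[symmetric]
        by (intro matrix_inv_unique) (simp add: inv)
      have "(\<Sum>j\<in>UNIV. (matrix_inv (flag_metric b s y) $ i $ j) *\<^sub>R dir_deriv u y (axis j 1)) =
         (\<Sum>j\<in>UNIV. \<Sum>a\<in>UNIV. ((transpose ?M ** ?M) $ i $ j * C y $ j $ a) *\<^sub>R L (\<xi> a) (s y))"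
        using elim(2) linear_frame_expansion[OF L L_vertical maurer_cartan_skew[OF chart elim(1)]]
        by (simp add: ginv C_def frame_matrix_def scaleR_sum_right)
      also have "\<dots> = (\<Sum>a\<in>UNIV. ((transpose ?M ** ?M ** C y) $ i $ a) *\<^sub>R L (\<xi> a) (s y))"
        by (subst sum.swap) (simp add: matrix_matrix_mult_def[of "transpose ?M ** ?M"] scaleR_sum_left)
      also have "transpose ?M ** ?M ** C y = transpose ?M" by (simp add: matrix_mul_assoc[symmetric] inv)
      finally show ?case by (simp add: det transpose_def)
    qed
  qed
  \<comment> \<open>Product rule, with det C tr(K C') for the determinant and -K C' K for the
    inverse.\<close>
  define D where "D i = \<sigma> *\<^sub>R (det (C x) *\<^sub>R ((\<Sum>a\<in>UNIV. K $ a $ i *\<^sub>R L2 (maurer_cartan s i x) (\<xi> a) - (K ** C' i ** K) $ a $ i *\<^sub>R l a)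
      + trace (K ** C' i) *\<^sub>R (\<Sum>a\<in>UNIV. K $ a $ i *\<^sub>R l a)))" for i
  have D: "dir_deriv (\<lambda>y. sqrt (det (flag_metric b s y)) *\<^sub>R
             (\<Sum>j\<in>UNIV. (matrix_inv (flag_metric b s y) $ i $ j) *\<^sub>R dir_deriv u y (axis j 1))) x (axis i 1) = D i" for i
    unfolding dir_deriv_def[of _ x]
  proof (rule vector_derivative_at, rule has_vector_derivative_cong_nhds)
    show "eventually (\<lambda>t. (\<sigma> * det (C (x + t *\<^sub>R axis i 1))) *\<^sub>R (\<Sum>a\<in>UNIV. (matrix_inv (C (x + t *\<^sub>R axis i 1)) $ a $ i) *\<^sub>R L (\<xi> a) (s (x + t *\<^sub>R axis i 1))) =
       sqrt (det (flag_metric b s (x + t *\<^sub>R axis i 1))) *\<^sub>R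
         (\<Sum>j\<in>UNIV. (matrix_inv (flag_metric b s (x + t *\<^sub>R axis i 1)) $ i $ j) *\<^sub>R dir_deriv u (x + t *\<^sub>R axis i 1) (axis j 1))) (nhds 0)"
      using eventually_line[OF flux[of i], of "axis i 1"] by (rule eventually_mono) simp
    have S: "((\<lambda>t. \<Sum>a\<in>UNIV. (matrix_inv (C (x + t *\<^sub>R axis i 1)) $ a $ i) *\<^sub>R L (\<xi> a) (s (x + t *\<^sub>R axis i 1))) has_vector_derivative
       (\<Sum>a\<in>UNIV. K $ a $ i *\<^sub>R L2 (maurer_cartan s i x) (\<xi> a) - (K ** C' i ** K) $ a $ i *\<^sub>R l a)) (at 0)"
    proof (rule has_vector_derivative_sum)
      fix a
      show "((\<lambda>t. (matrix_inv (C (x + t *\<^sub>R axis i 1)) $ a $ i) *\<^sub>R L (\<xi> a) (s (x + t *\<^sub>R axis i 1))) has_vector_derivative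
        (K $ a $ i *\<^sub>R L2 (maurer_cartan s i x) (\<xi> a) - (K ** C' i ** K) $ a $ i *\<^sub>R l a)) (at 0)"
        using bounded_bilinear.has_vector_derivative[OF bounded_bilinear_scaleR invD[of i a i] DL[of a i]]
        by (simp add: K_def l_def)
    qed
    have S': "((\<lambda>t. \<sigma> * det (C (x + t *\<^sub>R axis i 1))) has_vector_derivative \<sigma> * (det (C x) * trace (K ** C' i))) (at 0)"
      by (rule has_vector_derivative_mult_right[OF detD])
    show "((\<lambda>t. (\<sigma> * det (C (x + t *\<^sub>R axis i 1))) *\<^sub>R (\<Sum>a\<in>UNIV. (matrix_inv (C (x + t *\<^sub>R axis i 1)) $ a $ i) *\<^sub>R L (\<xi> a) (s (x + t *\<^sub>R axis i 1))))
       has_vector_derivative D i) (at 0)"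
      using bounded_bilinear.has_vector_derivative[OF bounded_bilinear_scaleR S' S]
      by (simp add: D_def scaleR_add_right K_def[symmetric] l_def[symmetric])
  qed
  \<comment> \<open>The rows of K = C^-1 combine the A_i into matrices with horizontal part \<xi>_a.
    The vertical remainder \<open>v a\<close> depends on the lift and has to drop out.\<close>
  define v where "v a = (\<Sum>i\<in>UNIV. K $ a $ i *\<^sub>R maurer_cartan s i x) - \<xi> a" for a
  have e: "(\<Sum>i\<in>UNIV. K $ a $ i *\<^sub>R maurer_cartan s i x) = \<xi> a + v a" for a by (simp add: v_def)
  have v: "v a \<in> vertical b" for a
  proof -
    have sk: "(\<Sum>i\<in>UNIV. K $ a $ i *\<^sub>R maurer_cartan s i x) \<in> skew_hermitian"
      by (intro subspace_sum subspace_scale subspace_skew_hermitian maurer_cartan_skew[OF chart x])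
    have "(\<Sum>i\<in>UNIV. K $ a $ i * C x $ i $ c) = of_bool (a = c)" for c
      using arg_cong[OF matrix_inv_inverse(2)[OF dC[OF x]], of "\<lambda>M. M $ a $ c"]
      by (simp add: K_def matrix_matrix_mult_def mat_def)
    then have "off_block b (\<Sum>i\<in>UNIV. K $ a $ i *\<^sub>R maurer_cartan s i x) = \<xi> a"
      unfolding off_block_expansion[OF sk] by (simp add: inner_sum_left C_def frame_matrix_def of_bool_def if_distrib[of "\<lambda>z. z *\<^sub>R _"] cong: if_cong)
    then show ?thesis using vertical_diff_off_block[OF sk, of b] by (simp add: v_def)
  qed
  have vs: "v a \<in> skew_hermitian" for a using v by (auto simp: vertical_def)
  interpret c: bounded_bilinear "comm :: complex^'n^'n \<Rightarrow> _"
    using bilinear_comm bilinear_conv_bounded_bilinear by blast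
  have MC: "C' i $ j $ c - C' j $ i $ c = - inner (comm (maurer_cartan s i x) (maurer_cartan s j x)) (\<xi> c)" for i j c
    using maurer_cartan_equation[OF chart x DA DA, of i j]
    by (simp add: C'_def flip: inner_diff_left)
  \<comment> \<open>This is the divergence of the dual frame with the density factor removed, the
    coefficient of the first-order term in \<xi>_a.\<close>
  have div: "(\<Sum>i\<in>UNIV. trace (K ** C' i) * K $ a $ i - (K ** C' i ** K) $ a $ i)
      = - (\<Sum>c\<in>UNIV. inner (comm (v c) (\<xi> c)) (\<xi> a))" for a
  proof -
    have "(\<Sum>i\<in>UNIV. trace (K ** C' i) * K $ a $ i) = (\<Sum>i\<in>UNIV. \<Sum>c\<in>UNIV. \<Sum>j\<in>UNIV. K $ c $ j * C' i $ j $ c * K $ a $ i)"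
      by (simp add: trace_def matrix_matrix_mult_def sum_distrib_right)
    moreover have "(\<Sum>i\<in>UNIV. (K ** C' i ** K) $ a $ i) = (\<Sum>i\<in>UNIV. \<Sum>c\<in>UNIV. \<Sum>j\<in>UNIV. K $ a $ j * C' i $ j $ c * K $ c $ i)"
      by (simp add: matrix_matrix_mult_def sum_distrib_right)
    \<comment> \<open>Interchanging i and j aligns the coefficients, so that only the
      antisymmetrised derivative of C is left, which the Maurer-Cartan equation evaluates.\<close>
    moreover have "\<dots> = (\<Sum>i\<in>UNIV. \<Sum>c\<in>UNIV. \<Sum>j\<in>UNIV. K $ a $ i * C' j $ i $ c * K $ c $ j)"
      by (subst sum.swap, subst (2) sum.swap, subst sum.swap) (rule refl)
    ultimately have "(\<Sum>i\<in>UNIV. trace (K ** C' i) * K $ a $ i - (K ** C' i ** K) $ a $ i)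
       = (\<Sum>i\<in>UNIV. \<Sum>c\<in>UNIV. \<Sum>j\<in>UNIV. K $ c $ j * K $ a $ i * (C' i $ j $ c - C' j $ i $ c))"
      by (simp add: sum_subtractf algebra_simps)
    also have "\<dots> = - (\<Sum>c\<in>UNIV. inner (comm (\<Sum>i\<in>UNIV. K $ a $ i *\<^sub>R maurer_cartan s i x) (\<Sum>j\<in>UNIV. K $ c $ j *\<^sub>R maurer_cartan s j x)) (\<xi> c))"
    proof -
      have "inner (comm (\<Sum>i\<in>UNIV. K $ a $ i *\<^sub>R maurer_cartan s i x) (\<Sum>j\<in>UNIV. K $ c $ j *\<^sub>R maurer_cartan s j x)) (\<xi> c)
        = (\<Sum>i\<in>UNIV. \<Sum>j\<in>UNIV. K $ c $ j * K $ a $ i * inner (comm (maurer_cartan s i x) (maurer_cartan s j x)) (\<xi> c))" for c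
        unfolding c.sum_left unfolding c.sum_right inner_sum_left c.scaleR_left c.scaleR_right inner_scaleR_left
        by (simp add: mult_ac)
      then show ?thesis unfolding MC by (simp only: mult_minus_right sum_negf) (subst sum.swap, rule refl)
    qed
    \<comment> \<open>Of the four commutators of \<xi>_a + v_a with \<xi>_c + v_c, those with
      \<xi>_c in the second slot are orthogonal to \<xi>_c, and [v_a, v_c] is vertical. Only
      [\<xi>_a, v_c] survives.\<close>
    also have "(\<Sum>c\<in>UNIV. inner (comm (\<Sum>i\<in>UNIV. K $ a $ i *\<^sub>R maurer_cartan s i x) (\<Sum>j\<in>UNIV. K $ c $ j *\<^sub>R maurer_cartan s j x)) (\<xi> c))
       = (\<Sum>c\<in>UNIV. inner (comm (v c) (\<xi> c)) (\<xi> a))"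
    proof (rule sum.cong[OF refl])
      fix c
      have "inner (comm (\<xi> a) (v c)) (\<xi> c) = - inner (\<xi> c) (comm (v c) (\<xi> a))"
        by (simp add: comm_def inner_commute flip: inner_minus_right)
      also have "\<dots> = inner (comm (v c) (\<xi> c)) (\<xi> a)"
        using inner_comm_comm[OF frame_skew[of c] vs[of c], of "\<xi> a"] by simp
      finally show "inner (comm (\<Sum>i\<in>UNIV. K $ a $ i *\<^sub>R maurer_cartan s i x) (\<Sum>j\<in>UNIV. K $ c $ j *\<^sub>R maurer_cartan s j x)) (\<xi> c) =
          inner (comm (v c) (\<xi> c)) (\<xi> a)"
        unfolding e c.add_left c.add_right inner_add_left
        using inner_comm_self[OF frame_skew[of c] frame_skew[of a]] inner_comm_self[OF frame_skew[of c] vs[of a]]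
          inner_vertical_frame[OF comm_vertical[OF v[of a] v[of c]]] by simp
    qed
    finally show ?thesis .
  qed
  have "laplace_beltrami (flag_metric b s) u x = (1 / \<bar>det (C x)\<bar>) *\<^sub>R (\<Sum>i\<in>UNIV. D i)"
    unfolding laplace_beltrami_def D
    by (simp add: flag_metric_eq[OF chart x] C_def[symmetric] det_mul)
  also have "(\<Sum>i\<in>UNIV. D i) = \<bar>det (C x)\<bar> *\<^sub>R (\<Sum>i\<in>UNIV.
      ((\<Sum>a\<in>UNIV. K $ a $ i *\<^sub>R L2 (maurer_cartan s i x) (\<xi> a) - (K ** C' i ** K) $ a $ i *\<^sub>R l a)
      + trace (K ** C' i) *\<^sub>R (\<Sum>a\<in>UNIV. K $ a $ i *\<^sub>R l a)))"
    unfolding D_def scaleR_scaleR scaleR_sum_right[symmetric] by (simp add: \<sigma>_def abs_sgn mult.commute)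
  also have "(1 / \<bar>det (C x)\<bar>) *\<^sub>R \<dots> = (\<Sum>i\<in>UNIV.
      ((\<Sum>a\<in>UNIV. K $ a $ i *\<^sub>R L2 (maurer_cartan s i x) (\<xi> a) - (K ** C' i ** K) $ a $ i *\<^sub>R l a)
      + trace (K ** C' i) *\<^sub>R (\<Sum>a\<in>UNIV. K $ a $ i *\<^sub>R l a)))"
    using dC[OF x] by simp
  also have "\<dots> = (\<Sum>i\<in>UNIV. \<Sum>a\<in>UNIV. K $ a $ i *\<^sub>R L2 (maurer_cartan s i x) (\<xi> a)
       + (trace (K ** C' i) * K $ a $ i - (K ** C' i ** K) $ a $ i) *\<^sub>R l a)"
    by (simp add: sum.distrib sum_subtractf scaleR_sum_right algebra_simps)
  also have "\<dots> = (\<Sum>a\<in>UNIV. (\<Sum>i\<in>UNIV. K $ a $ i *\<^sub>R L2 (maurer_cartan s i x) (\<xi> a))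
       + (\<Sum>i\<in>UNIV. trace (K ** C' i) * K $ a $ i - (K ** C' i ** K) $ a $ i) *\<^sub>R l a)"
    by (subst sum.swap) (simp add: sum.distrib scaleR_sum_left)
  also have "\<dots> = (\<Sum>a\<in>UNIV. L2 (\<Sum>i\<in>UNIV. K $ a $ i *\<^sub>R maurer_cartan s i x) (\<xi> a))
       - (\<Sum>a\<in>UNIV. \<Sum>c\<in>UNIV. inner (comm (v c) (\<xi> c)) (\<xi> a) *\<^sub>R l a)"
    unfolding div linear_sum[OF L2] linear_cmul[OF L2]
    by (simp add: sum_subtractf scaleR_sum_left)
  also have "(\<Sum>a\<in>UNIV. \<Sum>c\<in>UNIV. inner (comm (v c) (\<xi> c)) (\<xi> a) *\<^sub>R l a) = (\<Sum>c\<in>UNIV. L (comm (v c) (\<xi> c)) (s x))"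
    unfolding l_def
    by (subst sum.swap)
       (intro sum.cong refl linear_frame_expansion[OF L L_vertical, symmetric] comm_skew vs frame_skew)
  \<comment> \<open>The vertical part of the lifted field contributes L [v_a, \<xi>_a] to the second
    derivatives, exactly what the divergence subtracts.\<close>
  also have "(\<Sum>a\<in>UNIV. L2 (\<Sum>i\<in>UNIV. K $ a $ i *\<^sub>R maurer_cartan s i x) (\<xi> a)) =
     (\<Sum>a\<in>UNIV. L2 (\<xi> a) (\<xi> a)) + (\<Sum>c\<in>UNIV. L (comm (v c) (\<xi> c)) (s x))"
    unfolding e linear_add[OF L2] by (simp add: L2_vertical[OF v] sum.distrib)
  finally show ?thesis by simp
qed

end

section \<open>The radial domain\<close>

lemma inner_matrix_vector_mult: "inner v (M *v w) = inner (ctranspose M *v v) w"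
  for M :: "complex^'n^'m"
proof -
  have "inner v (M *v w) = (\<Sum>i\<in>UNIV. \<Sum>j\<in>UNIV. inner (v $ i) (M $ i $ j * w $ j))"
    by (simp add: inner_vec_def matrix_vector_mult_def inner_sum_right)
  also have "\<dots> = (\<Sum>j\<in>UNIV. \<Sum>i\<in>UNIV. inner (cnj (M $ i $ j) * v $ i) (w $ j))"
    by (subst sum.swap) (simp add: inner_complex_def algebra_simps)
  also have "\<dots> = inner (ctranspose M *v v) w"
    by (simp add: inner_vec_def matrix_vector_mult_def inner_sum_left)
  finally show ?thesis .
qed

lemma pos_def_iff: "pos_def A \<longleftrightarrow> hermitian A \<and> (\<forall>v. v \<noteq> 0 \<longrightarrow> 0 < inner v (A *v v))"
proof -
  have "Re (\<Sum>i\<in>UNIV. cnj (v $ i) * (A *v v) $ i) = inner v (A *v v)" for v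
    by (simp add: inner_vec_def inner_complex_def)
  then show ?thesis unfolding pos_def_def by simp
qed

text \<open>The quadratic form at v is the squared norm of the adjoint of M applied to v; a zero
  there would put v in the kernel of the invertible Gram matrix.\<close>

lemma pos_def_gram:
  fixes M :: "complex^'n^'m"
  assumes "det (M ** ctranspose M) \<noteq> 0"
  shows "pos_def (M ** ctranspose M)"
  unfolding pos_def_iff
proof (intro conjI allI impI)
  show "hermitian (M ** ctranspose M)" by (simp add: hermitian_def ctranspose_mult)
  fix v :: "complex^'m"
  assume "v \<noteq> 0"
  have "ctranspose M *v v \<noteq> 0"
  proof
    assume "ctranspose M *v v = 0"
    then have "(M ** ctranspose M) *v v = 0" by (simp add: matrix_vector_mul_assoc[symmetric])
    then have "matrix_inv (M ** ctranspose M) *v ((M ** ctranspose M) *v v) = 0" by simp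
    then show False
      using \<open>v \<noteq> 0\<close> matrix_inv_inverse(2)[OF assms] by (simp only: matrix_vector_mul_assoc matrix_vector_mul_lid)
  qed
  then show "0 < inner v ((M ** ctranspose M) *v v)"
    unfolding matrix_vector_mul_assoc[symmetric] by (subst inner_matrix_vector_mult) simp
qed

lemma bounded_bilinear_matrix_vector_mult:
  "bounded_bilinear ((*v) :: complex^'n^'m \<Rightarrow> complex^'n \<Rightarrow> complex^'m)"
proof -
  have "bilinear ((*v) :: complex^'n^'m \<Rightarrow> complex^'n \<Rightarrow> complex^'m)"
    unfolding bilinear_def
    by (intro conjI allI linearI)
       (simp_all add: vec_eq_iff matrix_vector_mult_def algebra_simps sum.distrib scaleR_sum_right)
  then show ?thesis by (simp add: bilinear_conv_bounded_bilinear)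
qed

text \<open>The quadratic form has a positive minimum c on the compact unit sphere, and a
  perturbation of norm below c / K changes it by less than c there. Being Hermitian is not an open
  condition, so it is assumed of B.\<close>

lemma eventually_pos_def:
  fixes A :: "complex^'m^'m"
  assumes "pos_def A"
  shows "eventually (\<lambda>B. hermitian B \<longrightarrow> pos_def B) (nhds A)"
proof -
  interpret m: bounded_bilinear "(*v) :: complex^'m^'m \<Rightarrow> complex^'m \<Rightarrow> complex^'m"
    by (rule bounded_bilinear_matrix_vector_mult)
  have cont: "continuous_on (sphere 0 1) (\<lambda>v. inner v (A *v v))"
    by (intro continuous_intros m.continuous_on)
  have "sphere (0 :: complex^'m) 1 \<noteq> {}" by simp
  then obtain v0 where v0: "v0 \<in> sphere 0 1" "\<And>v. v \<in> sphere 0 1 \<Longrightarrow> inner v0 (A *v v0) \<le> inner v (A *v v)"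
    using continuous_attains_inf[OF compact_sphere _ cont] by blast
  define c where "c = inner v0 (A *v v0)"
  have "v0 \<noteq> 0" using v0(1) by auto
  then have "c > 0" using assms by (simp add: pos_def_iff c_def)
  have lower: "c * (norm v)\<^sup>2 \<le> inner v (A *v v)" for v
  proof (cases "v = 0")
    case False
    then have "c \<le> inner ((1 / norm v) *\<^sub>R v) (A *v ((1 / norm v) *\<^sub>R v))"
      unfolding c_def by (intro v0(2)) simp
    also have "\<dots> = inner v (A *v v) / (norm v)\<^sup>2"
      by (simp add: m.scaleR_right power2_eq_square)
    finally show ?thesis using False by (simp add: field_simps)
  qed (simp add: m.zero_right)
  obtain K where K: "K > 0" "\<And>(H :: complex^'m^'m) v. norm (H *v v) \<le> norm H * norm v * K"
    using m.pos_bounded by blast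
  have "pos_def B" if B: "hermitian B" "dist B A < c / K" for B
    unfolding pos_def_iff
  proof (intro conjI allI impI B(1))
    fix v :: "complex^'m"
    assume "v \<noteq> 0"
    have "\<bar>inner v ((B - A) *v v)\<bar> \<le> norm v * norm ((B - A) *v v)" by (rule Cauchy_Schwarz_ineq2)
    also have "\<dots> \<le> norm v * (norm (B - A) * norm v * K)" by (intro mult_left_mono K) simp
    also have "\<dots> = (norm (B - A) * K) * (norm v)\<^sup>2" by (simp add: power2_eq_square)
    also have "\<dots> < c * (norm v)\<^sup>2"
      using B(2) K(1) \<open>v \<noteq> 0\<close> by (intro mult_strict_right_mono) (auto simp: dist_norm field_simps)
    finally have "\<bar>inner v ((B - A) *v v)\<bar> < c * (norm v)\<^sup>2" .
    moreover have "inner v (B *v v) = inner v (A *v v) + inner v ((B - A) *v v)"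
      by (simp add: m.diff_left inner_diff_right)
    ultimately show "0 < inner v (B *v v)" using lower[of v] by linarith
  qed
  moreover have "c / K > 0" using \<open>c > 0\<close> K(1) by simp
  ultimately show ?thesis unfolding eventually_nhds_metric by blast
qed

lemma hermitian_add: "hermitian A \<Longrightarrow> hermitian B \<Longrightarrow> hermitian (A + B)"
  and hermitian_diff: "hermitian A \<Longrightarrow> hermitian B \<Longrightarrow> hermitian (A - B)"
  and hermitian_scaleR: "hermitian A \<Longrightarrow> hermitian (c *\<^sub>R A)"
  by (simp_all add: hermitian_def ctranspose_add ctranspose_diff ctranspose_scaleR)

lemma hermitian_zero: "hermitian 0"
  by (simp add: hermitian_def vec_eq_iff)

lemma hermitian_mat: "hermitian (mat 1)"
  by (simp add: hermitian_def ctranspose_mat)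

lemma hermitian_sum: "(\<And>i. i \<in> I \<Longrightarrow> hermitian (A i)) \<Longrightarrow> hermitian (\<Sum>i\<in>I. A i)"
  by (induction I rule: infinite_finite_induct) (auto simp: hermitian_zero hermitian_add)

lemma subspace_hermitian_tuples: "subspace hermitian_tuples"
  unfolding subspace_def hermitian_tuples_def
  by (auto simp: hermitian_zero hermitian_add hermitian_scaleR)

lemma rel_open_radial_domain:
  "rel_open hermitian_tuples (radial_domain :: (complex^'m^'m^'k) set)"
  unfolding rel_open_def
proof (intro conjI ballI subspace_hermitian_tuples)
  fix \<Lambda> :: "complex^'m^'m^'k"
  assume \<Lambda>: "\<Lambda> \<in> radial_domain"
  have "eventually (\<lambda>\<Lambda>'. \<forall>j. hermitian (\<Lambda>' $ j) \<longrightarrow> pos_def (\<Lambda>' $ j)) (nhds \<Lambda>)"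
  proof (rule eventually_all_finite)
    fix j
    have "filterlim (\<lambda>\<Lambda>'. \<Lambda>' $ j) (nhds (\<Lambda> $ j)) (nhds \<Lambda>)" by (intro tendsto_intros filterlim_ident)
    then show "eventually (\<lambda>\<Lambda>'. hermitian (\<Lambda>' $ j) \<longrightarrow> pos_def (\<Lambda>' $ j)) (nhds \<Lambda>)"
      using \<Lambda> by (intro eventually_compose_filterlim[OF eventually_pos_def]) (auto simp: radial_domain_def)
  qed
  moreover have "filterlim (\<lambda>\<Lambda>'. mat 1 - (\<Sum>j\<in>UNIV. \<Lambda>' $ j)) (nhds (mat 1 - (\<Sum>j\<in>UNIV. \<Lambda> $ j))) (nhds \<Lambda>)"
    by (intro tendsto_intros filterlim_ident)
  then have "eventually (\<lambda>\<Lambda>'. hermitian (mat 1 - (\<Sum>j\<in>UNIV. \<Lambda>' $ j)) \<longrightarrow> pos_def (mat 1 - (\<Sum>j\<in>UNIV. \<Lambda>' $ j))) (nhds \<Lambda>)"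
    using \<Lambda> by (intro eventually_compose_filterlim[OF eventually_pos_def]) (auto simp: radial_domain_def)
  ultimately have "eventually (\<lambda>\<Lambda>'. \<Lambda>' \<in> hermitian_tuples \<longrightarrow> \<Lambda>' \<in> radial_domain) (nhds \<Lambda>)"
    by eventually_elim (auto simp: hermitian_tuples_def radial_domain_def intro!: hermitian_diff hermitian_sum hermitian_mat)
  then obtain e where e: "e > 0" "\<And>\<Lambda>'. dist \<Lambda>' \<Lambda> < e \<Longrightarrow> \<Lambda>' \<in> hermitian_tuples \<Longrightarrow> \<Lambda>' \<in> radial_domain"
    unfolding eventually_nhds_metric by blast
  have "\<Lambda> \<in> hermitian_tuples" using \<Lambda> by (auto simp: radial_domain_def hermitian_tuples_def pos_def_def)
  then have "\<Lambda> + v \<in> radial_domain" if "v \<in> hermitian_tuples" "norm v < e" for v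
    using that by (intro e(2)) (auto simp: dist_norm intro: subspace_add[OF subspace_hermitian_tuples])
  with e(1) show "\<exists>e>0. \<forall>v\<in>hermitian_tuples. norm v < e \<longrightarrow> \<Lambda> + v \<in> radial_domain" by blast
qed

section \<open>Entry derivatives along Hermitian directions\<close>

lemma axis_hermitian_tuples: "hermitian H \<Longrightarrow> axis j H \<in> hermitian_tuples"
  by (auto simp: hermitian_tuples_def axis_def hermitian_zero)

lemma hermitian_herm_sym: "hermitian (herm_sym \<alpha> \<beta>)" and hermitian_herm_skew: "hermitian (herm_skew \<alpha> \<beta>)"
proof -
  have "cnj (herm_sym \<alpha> \<beta> $ \<nu> $ \<mu>) = herm_sym \<alpha> \<beta> $ \<mu> $ \<nu>" for \<mu> \<nu>
    unfolding herm_sym_def vec_lambda_beta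
    by (cases "\<mu> = \<alpha>"; cases "\<nu> = \<beta>"; cases "\<mu> = \<beta>"; cases "\<nu> = \<alpha>"; simp)
  then show "hermitian (herm_sym \<alpha> \<beta>)" by (simp add: hermitian_def vec_eq_iff)
  have "cnj (herm_skew \<alpha> \<beta> $ \<nu> $ \<mu>) = herm_skew \<alpha> \<beta> $ \<mu> $ \<nu>" for \<mu> \<nu>
    unfolding herm_skew_def vec_lambda_beta
    by (cases "\<mu> = \<alpha>"; cases "\<nu> = \<beta>"; cases "\<mu> = \<beta>"; cases "\<nu> = \<alpha>"; simp)
  then show "hermitian (herm_skew \<alpha> \<beta>)" by (simp add: hermitian_def vec_eq_iff)
qed

lemmas herm_tuple_sym = axis_hermitian_tuples[OF hermitian_herm_sym]
lemmas herm_tuple_skew = axis_hermitian_tuples[OF hermitian_herm_skew]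

lemma Ck_on_entry_deriv:
  assumes "Ck_on (Suc r) hermitian_tuples radial_domain h"
  shows "Ck_on r hermitian_tuples radial_domain (entry_deriv j \<alpha> \<beta> h)"
proof -
  have "Ck_on r hermitian_tuples radial_domain (\<lambda>\<Lambda>. dir_deriv h \<Lambda> (axis j (herm_sym \<alpha> \<beta>))
      + (- \<i>) * dir_deriv h \<Lambda> (axis j (herm_skew \<alpha> \<beta>)))"
    by (intro Ck_on_add Ck_on_cmult Ck_on_dir_deriv[OF assms rel_open_radial_domain] herm_tuple_sym herm_tuple_skew)
  then show ?thesis by (simp add: entry_deriv_def[abs_def])
qed

text \<open>The velocity is split into its matrix components, and
  \<open>hermitian_differential\<close> turns the real-linear differential on each Hermitian
  component into complex entry derivatives.\<close>

lemma has_vector_derivative_entry_chain: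
  fixes h :: "complex^'m^'m^'k \<Rightarrow> complex"
  assumes h: "Ck_on (Suc r) hermitian_tuples radial_domain h"
    and ev: "eventually (\<lambda>t. \<gamma> t \<in> radial_domain) (nhds t0)"
    and \<gamma>: "(\<gamma> has_vector_derivative \<gamma>') (at t0)" and H: "\<gamma>' \<in> hermitian_tuples"
  shows "((\<lambda>t. h (\<gamma> t)) has_vector_derivative
    (\<Sum>j\<in>UNIV. \<Sum>\<alpha>\<in>UNIV. \<Sum>\<beta>\<in>UNIV. \<gamma>' $ j $ \<alpha> $ \<beta> * entry_deriv j \<alpha> \<beta> h (\<gamma> t0))) (at t0)"
proof -
  obtain h' where h': "\<And>x. x \<in> radial_domain \<Longrightarrow> (h has_derivative h' x) (at x within radial_domain)"
    "\<And>x v. x \<in> radial_domain \<Longrightarrow> v \<in> hermitian_tuples \<Longrightarrow> h' x v = dir_deriv h x v"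
    by (rule Ck_on_Suc_dir_deriv[OF h rel_open_radial_domain]) (rule that)
  have x: "\<gamma> t0 \<in> radial_domain" using ev eventually_nhds_x_imp_x by blast
  have lin: "linear (h' (\<gamma> t0))" by (rule has_derivative_linear[OF h'(1)[OF x]])
  have ax: "linear (\<lambda>H. axis j H :: complex^'m^'m^'k)" for j
    by (rule linearI) (auto simp: axis_def vec_eq_iff)
  have "\<gamma>' = (\<Sum>j\<in>UNIV. axis j (\<gamma>' $ j))"
    by (simp add: vec_eq_iff axis_def)
  then have "h' (\<gamma> t0) \<gamma>' = (\<Sum>j\<in>UNIV. h' (\<gamma> t0) (axis j (\<gamma>' $ j)))"
    by (metis linear_sum[OF lin])
  also have "\<dots> = (\<Sum>j\<in>UNIV. \<Sum>\<alpha>\<in>UNIV. \<Sum>\<beta>\<in>UNIV. \<gamma>' $ j $ \<alpha> $ \<beta> * entry_deriv j \<alpha> \<beta> h (\<gamma> t0))"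
  proof (rule sum.cong[OF refl])
    fix j
    have "hermitian (\<gamma>' $ j)" using H by (simp add: hermitian_tuples_def)
    from hermitian_differential[OF linear_compose[OF ax lin] this]
    show "h' (\<gamma> t0) (axis j (\<gamma>' $ j)) = (\<Sum>\<alpha>\<in>UNIV. \<Sum>\<beta>\<in>UNIV. \<gamma>' $ j $ \<alpha> $ \<beta> * entry_deriv j \<alpha> \<beta> h (\<gamma> t0))"
      by (simp add: o_def entry_deriv_def h'(2)[OF x] herm_tuple_sym herm_tuple_skew)
  qed
  finally show ?thesis using has_vector_derivative_compose_within[OF h'(1)[OF x] \<gamma> ev] by simp
qed

lemma dir_deriv_combine:
  fixes g h :: "'a::real_normed_vector \<Rightarrow> complex"
  assumes "Ck_on (Suc r) V S g" "Ck_on (Suc r) V S h" "rel_open V S" "x \<in> S" "v \<in> V"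
  shows "dir_deriv (\<lambda>y. g y - c * h y) x v = dir_deriv g x v - c * dir_deriv h x v"
proof -
  obtain g' where g': "\<And>x. x \<in> S \<Longrightarrow> (g has_derivative g' x) (at x within S)"
    "\<And>x v. x \<in> S \<Longrightarrow> v \<in> V \<Longrightarrow> g' x v = dir_deriv g x v"
    by (rule Ck_on_Suc_dir_deriv[OF assms(1,3)]) (rule that)
  obtain h' where h': "\<And>x. x \<in> S \<Longrightarrow> (h has_derivative h' x) (at x within S)"
    "\<And>x v. x \<in> S \<Longrightarrow> v \<in> V \<Longrightarrow> h' x v = dir_deriv h x v"
    by (rule Ck_on_Suc_dir_deriv[OF assms(2,3)]) (rule that)
  have "((\<lambda>y. g y - c * h y) has_derivative (\<lambda>v. g' x v - c * h' x v)) (at x within S)"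
    by (intro has_derivative_diff has_derivative_mult_right g'(1) h'(1) assms)
  from dir_deriv_eq[OF assms(3-5) this] show ?thesis using g'(2) h'(2) assms by simp
qed

text \<open>Each entry derivative is a complex combination of two Hermitian directional derivatives;
  the four resulting pairs commute by \<open>dir_deriv_commute\<close>.\<close>

lemma entry_deriv_commute:
  fixes f :: "complex^'m^'m^'k \<Rightarrow> complex"
  assumes f: "Ck_on 2 hermitian_tuples radial_domain f" and x: "\<Lambda> \<in> radial_domain"
  shows "entry_deriv j \<alpha> \<beta> (entry_deriv l \<gamma> \<delta> f) \<Lambda> = entry_deriv l \<gamma> \<delta> (entry_deriv j \<alpha> \<beta> f) \<Lambda>"
proof -
  have d: "Ck_on (Suc 0) hermitian_tuples radial_domain (\<lambda>y. dir_deriv f y v)" if "v \<in> hermitian_tuples" for v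
    using Ck_on_dir_deriv[OF _ rel_open_radial_domain that, of "Suc 0" f] f by (simp add: numeral_2_eq_2)
  note c = dir_deriv_combine[OF d d rel_open_radial_domain x]
  note sw = dir_deriv_commute[OF f rel_open_radial_domain x]
  show ?thesis
    unfolding entry_deriv_def
    by (simp add: c herm_tuple_sym herm_tuple_skew
      sw[OF herm_tuple_sym[of l \<gamma> \<delta>] herm_tuple_sym[of j \<alpha> \<beta>]] sw[OF herm_tuple_sym[of l \<gamma> \<delta>] herm_tuple_skew[of j \<alpha> \<beta>]]
      sw[OF herm_tuple_skew[of l \<gamma> \<delta>] herm_tuple_sym[of j \<alpha> \<beta>]] sw[OF herm_tuple_skew[of l \<gamma> \<delta>] herm_tuple_skew[of j \<alpha> \<beta>]])
      (simp add: algebra_simps)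
qed

section \<open>Derivatives of the radial map\<close>

definition block_proj :: "('n \<Rightarrow> 'b) \<Rightarrow> 'b \<Rightarrow> complex^'n^'n" where
  "block_proj b j = (\<chi> p q. of_bool (p = q \<and> b p = j))"

definition rows_of :: "('m \<Rightarrow> 'n) \<Rightarrow> complex^'n^'n \<Rightarrow> complex^'n^'m" where
  "rows_of r U = (\<chi> \<alpha>. U $ r \<alpha>)"

text \<open>For fixed \<open>U\<close> this is linear in \<open>M\<close>, and right translation or
  differentiation of \<open>U\<close> only changes \<open>M\<close>. Computations with the radial
  variables thus become algebra of commutators.\<close>

definition compress :: "('m \<Rightarrow> 'n) \<Rightarrow> complex^'n^'n \<Rightarrow> complex^'n^'n \<Rightarrow> complex^'m^'m" where
  "compress r M U = rows_of r U ** M ** ctranspose (rows_of r U)"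

lemma mult_diagonal:
  fixes D :: "'f::semiring_1^'n^'n"
  assumes D: "\<And>p q. p \<noteq> q \<Longrightarrow> D $ p $ q = 0"
  shows "(X ** D) $ p $ q = X $ p $ q * D $ q $ q" and "(D ** Y) $ q $ p = D $ q $ q * Y $ q $ p"
proof -
  have "(X ** D) $ p $ q = (\<Sum>k\<in>UNIV. if k = q then X $ p $ q * D $ q $ q else 0)"
    unfolding matrix_matrix_mult_def vec_lambda_beta by (intro sum.cong refl) (use D in auto)
  then show "(X ** D) $ p $ q = X $ p $ q * D $ q $ q" by simp
  have "(D ** Y) $ q $ p = (\<Sum>k\<in>UNIV. if k = q then D $ q $ q * Y $ q $ p else 0)"
    unfolding matrix_matrix_mult_def vec_lambda_beta by (intro sum.cong refl) (use D in auto)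
  then show "(D ** Y) $ q $ p = D $ q $ q * Y $ q $ p" by simp
qed

lemma mult_block_proj: "(X ** block_proj b j) $ \<alpha> $ q = X $ \<alpha> $ q * of_bool (b q = j)"
  and block_proj_mult: "(block_proj b j ** Y) $ q $ \<alpha> = of_bool (b q = j) * Y $ q $ \<alpha>"
  by (simp_all add: mult_diagonal block_proj_def)

lemma comm_block_proj: "comm X (block_proj b j) $ p $ q = X $ p $ q * (of_bool (b q = j) - of_bool (b p = j))"
  by (simp add: comm_def mult_block_proj block_proj_mult algebra_simps)

lemma block_diagonal_commute:
  assumes "\<And>p q. b p \<noteq> b q \<Longrightarrow> X $ p $ q = 0"
  shows "X ** block_proj b j = block_proj b j ** X"
  using assms by (auto simp: vec_eq_iff mult_block_proj block_proj_mult of_bool_def)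

lemma comm_vertical_block_proj: "V \<in> vertical b \<Longrightarrow> comm V (block_proj b j) = 0"
  using block_diagonal_commute[of b V j] by (simp add: comm_def vertical_def)

lemma block_proj_idem: "block_proj b j ** block_proj b j = block_proj b j"
  by (simp add: vec_eq_iff mult_block_proj) (simp add: block_proj_def)

lemma ctranspose_block_proj: "ctranspose (block_proj b j) = block_proj b j"
  by (auto simp: vec_eq_iff block_proj_def of_bool_def)

lemma sum_block_proj:
  fixes b :: "'n::finite \<Rightarrow> 'b::finite"
  shows "(\<Sum>j\<in>UNIV. block_proj b j) = (mat 1 :: complex^'n^'n)"
  by (auto simp: vec_eq_iff block_proj_def mat_def of_bool_def)

lemma row_block_eq: "row_block b r j U = rows_of r U ** block_proj b j"
  by (simp add: vec_eq_iff mult_block_proj row_block_def rows_of_def)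

lemma row_block_gram: "row_block b r j U ** ctranspose (row_block b r j U) = compress r (block_proj b j) U"
  unfolding compress_def row_block_eq ctranspose_mult ctranspose_block_proj
  by (metis block_proj_idem matrix_mul_assoc)

lemma radial_map_nth: "radial_map b r U $ j = compress r (block_proj b (Some j)) U"
  by (simp add: radial_map_def row_block_gram)

lemma regular_set_iff:
  "U \<in> regular_set b r \<longleftrightarrow> U \<in> unitary_group \<and> (\<forall>j. det (compress r (block_proj b j) U) \<noteq> 0)"
  by (simp add: regular_set_def row_block_gram)

lemma rows_of_mult: "rows_of r (U ** X) = rows_of r U ** X"
  by (simp add: vec_eq_iff rows_of_def matrix_matrix_mult_def)

lemma compress_mult: "compress r M (U ** K) = compress r (K ** M ** ctranspose K) U"
  by (simp add: compress_def rows_of_mult ctranspose_mult matrix_mul_assoc)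

lemma linear_compress: "linear (\<lambda>M. compress r M U)"
  unfolding compress_def
  by (rule linearI) (simp_all add: bounded_bilinear.add_left[OF bounded_bilinear_matrix_mult]
      bounded_bilinear.add_right[OF bounded_bilinear_matrix_mult]
      bounded_bilinear.scaleR_left[OF bounded_bilinear_matrix_mult]
      bounded_bilinear.scaleR_right[OF bounded_bilinear_matrix_mult])

lemma hermitian_compress: "hermitian M \<Longrightarrow> hermitian (compress r M U)"
  by (simp add: hermitian_def compress_def ctranspose_mult matrix_mul_assoc)

lemma compress_mat:
  assumes "U \<in> unitary_group" "inj r"
  shows "compress r (mat 1) U = mat 1"
proof -
  have "U ** ctranspose U = mat 1" using assms(1) by (simp add: unitary_group_def)
  then have "(U ** ctranspose U) $ r \<alpha> $ r \<beta> = mat 1 $ r \<alpha> $ r \<beta>" for \<alpha> \<beta> by simp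
  then have "(\<Sum>k\<in>UNIV. U $ r \<alpha> $ k * cnj (U $ r \<beta> $ k)) = of_bool (\<alpha> = \<beta>)" for \<alpha> \<beta>
    using inj_eq[OF assms(2)] by (simp add: matrix_matrix_mult_def mat_def)
  then have "rows_of r U ** ctranspose (rows_of r U) = mat 1"
    by (simp add: rows_of_def matrix_matrix_mult_def vec_eq_iff mat_def)
  then show ?thesis by (simp add: compress_def)
qed

lemma sum_UNIV_option: "(\<Sum>j\<in>UNIV. g j) = g None + (\<Sum>j\<in>UNIV. g (Some j))"
  for g :: "'k::finite option \<Rightarrow> 'a::comm_monoid_add"
  by (simp add: UNIV_option_conv sum.reindex)

text \<open>The block projections sum to the identity and the selected rows are orthonormal, so the
  Gram matrix of the block \<open>None\<close> is I minus the sum of the others. Its regularity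
  gives the upper bound in the domain.\<close>

lemma radial_map_regular:
  fixes b :: "'n::finite \<Rightarrow> 'k::finite option"
  assumes "U \<in> regular_set b r" "inj r"
  shows "radial_map b r U \<in> radial_domain"
proof -
  have pd: "pos_def (compress r (block_proj b j) U)" for j
    using assms(1) pos_def_gram[of "row_block b r j U"] by (simp add: regular_set_iff row_block_gram)
  have "compress r (block_proj b None) U + (\<Sum>j\<in>UNIV. compress r (block_proj b (Some j)) U)
      = compress r (\<Sum>j\<in>UNIV. block_proj b j) U"
    by (simp add: sum_UNIV_option linear_add[OF linear_compress] linear_sum[OF linear_compress])
  also have "\<dots> = mat 1" using assms by (simp add: sum_block_proj compress_mat regular_set_iff)
  finally have "mat 1 - (\<Sum>j\<in>UNIV. compress r (block_proj b (Some j)) U) = compress r (block_proj b None) U"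
    by (simp add: algebra_simps flip: eq_diff_eq)
  then show ?thesis using pd by (simp add: radial_domain_def radial_map_nth)
qed

lemma flag_proj_eqE:
  assumes "flag_proj b U = flag_proj b W"
  obtains K where "K \<in> block_unitary b" "U = W ** K"
proof -
  have "(mat 1 :: complex^'a^'a) $ i $ j = 0" if "b i \<noteq> b j" for i j
    using that by (auto simp: mat_def)
  then have "mat 1 \<in> block_unitary b" by (auto simp: block_unitary_def unitary_group_def ctranspose_mat)
  then have "U ** mat 1 \<in> flag_proj b U" unfolding flag_proj_def by blast
  then show ?thesis unfolding assms using that by (auto simp: flag_proj_def)
qed

text \<open>A block-diagonal unitary commutes with every block projection and so cancels in the
  compression. A lift \<open>s x\<close> may therefore replace any other representative of its
  coset.\<close>

lemma regular_set_coset: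
  assumes "flag_proj b U = flag_proj b W" "W \<in> regular_set b r" "U \<in> unitary_group"
  shows "U \<in> regular_set b r" "radial_map b r U = radial_map b r W"
proof -
  obtain K where K: "K \<in> block_unitary b" "U = W ** K" using assms(1) by (rule flag_proj_eqE)
  have "compress r (block_proj b j) U = compress r (block_proj b j) W" for j
  proof -
    have "K ** block_proj b j ** ctranspose K = block_proj b j ** (K ** ctranspose K)"
      using K(1) block_diagonal_commute[of b K j] by (simp add: block_unitary_def matrix_mul_assoc)
    then show ?thesis using K by (simp add: compress_mult block_unitary_def unitary_group_def)
  qed
  then show "U \<in> regular_set b r" "radial_map b r U = radial_map b r W"
    using assms(2,3) by (simp_all add: regular_set_iff radial_map_def row_block_gram)
qed

lemma bounded_linear_rows_of: "bounded_linear (rows_of r :: complex^'n^'n \<Rightarrow> complex^'n^'m)"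
  by (intro linear_conv_bounded_linear[THEN iffD1] linearI) (simp_all add: rows_of_def vec_eq_iff)

text \<open>The left factor contributes A M and the adjoint factor -M A, since A is
  skew-Hermitian.\<close>

lemma has_vector_derivative_compress:
  fixes \<gamma> :: "real \<Rightarrow> complex^'n^'n"
  assumes \<gamma>: "(\<gamma> has_vector_derivative \<gamma> t ** A) (at t)" and A: "A \<in> skew_hermitian"
  shows "((\<lambda>t. compress r M (\<gamma> t)) has_vector_derivative compress r (comm A M) (\<gamma> t)) (at t)"
proof -
  let ?Z = "\<lambda>t. rows_of r (\<gamma> t)"
  have Z: "(?Z has_vector_derivative ?Z t ** A) (at t)"
    using bounded_linear.has_vector_derivative[OF bounded_linear_rows_of \<gamma>] by (simp add: rows_of_mult)
  have "((\<lambda>t. ?Z t ** M) has_vector_derivative ?Z t ** A ** M) (at t)"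
    using has_vector_derivative_matrix_mult[OF Z has_vector_derivative_const[of M]]
    by (simp add: bounded_bilinear.zero_right[OF bounded_bilinear_matrix_mult])
  from has_vector_derivative_matrix_mult[OF this bounded_linear.has_vector_derivative[OF bounded_linear_ctranspose Z]]
  have "((\<lambda>t. compress r M (\<gamma> t)) has_vector_derivative
      ?Z t ** M ** ctranspose (?Z t ** A) + ?Z t ** A ** M ** ctranspose (?Z t)) (at t)"
    unfolding compress_def .
  moreover have "?Z t ** M ** ctranspose (?Z t ** A) = - (?Z t ** (M ** A) ** ctranspose (?Z t))"
    using A by (simp add: skew_hermitian_def ctranspose_mult matrix_mult_minus_left matrix_mult_minus_right matrix_mul_assoc)
  ultimately show ?thesis
    by (simp add: compress_def comm_def matrix_diff_left matrix_diff_right matrix_mul_assoc)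
qed

lemma hermitian_block_proj: "hermitian (block_proj b j)"
  by (simp add: hermitian_def ctranspose_block_proj)

lemma hermitian_comm: "A \<in> skew_hermitian \<Longrightarrow> hermitian M \<Longrightarrow> hermitian (comm A M)"
  by (simp add: hermitian_def skew_hermitian_def comm_def ctranspose_diff ctranspose_mult
      matrix_mult_minus_left matrix_mult_minus_right)

lemma has_vector_derivative_radial_chain:
  fixes h :: "complex^'m^'m^'k \<Rightarrow> complex" and \<gamma> :: "real \<Rightarrow> complex^'n^'n"
  assumes h: "Ck_on (Suc q) hermitian_tuples radial_domain h" and r: "inj r"
    and reg: "eventually (\<lambda>t. \<gamma> t \<in> regular_set b r) (nhds t)"
    and \<gamma>: "(\<gamma> has_vector_derivative \<gamma> t ** A) (at t)" and A: "A \<in> skew_hermitian"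
  shows "((\<lambda>t. h (radial_map b r (\<gamma> t))) has_vector_derivative
    (\<Sum>j\<in>UNIV. \<Sum>\<alpha>\<in>UNIV. \<Sum>\<beta>\<in>UNIV. compress r (comm A (block_proj b (Some j))) (\<gamma> t) $ \<alpha> $ \<beta> *
       entry_deriv j \<alpha> \<beta> h (radial_map b r (\<gamma> t)))) (at t)"
proof -
  let ?d = "\<chi> j. compress r (comm A (block_proj b (Some j))) (\<gamma> t)"
  have "((\<lambda>t. radial_map b r (\<gamma> t)) has_vector_derivative ?d) (at t)"
    unfolding radial_map_def row_block_gram
    by (intro has_vector_derivative_vec_lambda has_vector_derivative_compress \<gamma> A)
  moreover have "eventually (\<lambda>t. radial_map b r (\<gamma> t) \<in> radial_domain) (nhds t)"
    using reg by eventually_elim (rule radial_map_regular[OF _ r])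
  moreover have "?d \<in> hermitian_tuples"
    by (auto simp: hermitian_tuples_def intro!: hermitian_compress hermitian_comm A hermitian_block_proj)
  ultimately show ?thesis using has_vector_derivative_entry_chain[OF h] by fastforce
qed

text \<open>
  The derivatives \<open>X g\<close> and \<open>Y X g\<close> of \<open>g = f \<circ> radial_map b r\<close> at \<open>U\<close> along left-invariant vector fields.
\<close>

definition radial_d1 ::
  "('n::finite \<Rightarrow> 'k::finite option) \<Rightarrow> ('m::finite \<Rightarrow> 'n) \<Rightarrow> (complex^'m^'m^'k \<Rightarrow> complex) \<Rightarrow>
     complex^'n^'n \<Rightarrow> complex^'n^'n \<Rightarrow> complex" where
  "radial_d1 b r f X U = (\<Sum>j\<in>UNIV. \<Sum>\<alpha>\<in>UNIV. \<Sum>\<beta>\<in>UNIV.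
     compress r (comm X (block_proj b (Some j))) U $ \<alpha> $ \<beta> * entry_deriv j \<alpha> \<beta> f (radial_map b r U))"

definition radial_d2 ::
  "('n::finite \<Rightarrow> 'k::finite option) \<Rightarrow> ('m::finite \<Rightarrow> 'n) \<Rightarrow> (complex^'m^'m^'k \<Rightarrow> complex) \<Rightarrow>
     complex^'n^'n \<Rightarrow> complex^'n^'n \<Rightarrow> complex^'n^'n \<Rightarrow> complex" where
  "radial_d2 b r f U Y X = (\<Sum>j\<in>UNIV. \<Sum>\<alpha>\<in>UNIV. \<Sum>\<beta>\<in>UNIV.
     compress r (comm X (block_proj b (Some j))) U $ \<alpha> $ \<beta> * radial_d1 b r (entry_deriv j \<alpha> \<beta> f) Y U
     + compress r (comm Y (comm X (block_proj b (Some j)))) U $ \<alpha> $ \<beta> * entry_deriv j \<alpha> \<beta> f (radial_map b r U))"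

lemma linear_comm_left: "linear (\<lambda>X. comm X M)" and linear_comm_right: "linear (\<lambda>M. comm X M)"
  using bilinear_comm unfolding bilinear_def by auto

lemma linear_compress_nth: "linear (\<lambda>M. compress r M U $ \<alpha> $ \<beta>)"
  by (intro linearI) (simp_all add: linear_add[OF linear_compress] linear_cmul[OF linear_compress])

lemma linear_mult_complex_right: "linear g \<Longrightarrow> linear (\<lambda>x. g x * (c :: complex))"
  and linear_mult_complex_left: "linear g \<Longrightarrow> linear (\<lambda>x. c * (g x :: complex))"
  by (simp_all add: linear_iff algebra_simps)

lemma linear_radial_d1: "linear (\<lambda>X. radial_d1 b r f X U)"
  unfolding radial_d1_def
  by (intro linear_compose_sum ballI linear_mult_complex_right
      linear_compose[OF linear_comm_left linear_compress_nth, unfolded o_def])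

lemma linear_radial_d2: "linear (\<lambda>Y. radial_d2 b r f U Y X)"
  unfolding radial_d2_def
  by (intro linear_compose_sum ballI linear_compose_add linear_mult_complex_right linear_mult_complex_left
      linear_radial_d1 linear_compose[OF linear_comm_left linear_compress_nth, unfolded o_def])

lemma radial_d1_vertical: "V \<in> vertical b \<Longrightarrow> radial_d1 b r f V U = 0"
  by (simp add: radial_d1_def comm_vertical_block_proj linear_0[OF linear_compress_nth])

lemma comm_jacobi: "comm V (comm X E) = comm (comm V X) E + comm X (comm V E)"
  by (simp add: comm_def matrix_diff_left matrix_diff_right matrix_mul_assoc)

text \<open>Vertical V commutes with the block projections, so the Jacobi identity reduces [V,
  [X, E]] to [[V, X], E], while the second-order part contains V g-type factors and
  vanishes.\<close>

lemma radial_d2_vertical: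
  "V \<in> vertical b \<Longrightarrow> radial_d2 b r f U V X = radial_d1 b r f (comm V X) U"
  by (simp add: radial_d2_def radial_d1_vertical comm_jacobi comm_vertical_block_proj linear_0[OF linear_comm_right])
     (simp add: radial_d1_def)

lemma has_vector_derivative_radial_d1:
  fixes \<gamma> :: "real \<Rightarrow> complex^'n^'n"
  assumes f: "Ck_on 2 hermitian_tuples radial_domain f" and r: "inj r"
    and reg: "eventually (\<lambda>t. \<gamma> t \<in> regular_set b r) (nhds t)"
    and \<gamma>: "(\<gamma> has_vector_derivative \<gamma> t ** A) (at t)" and A: "A \<in> skew_hermitian"
  shows "((\<lambda>t. radial_d1 b r f X (\<gamma> t)) has_vector_derivative radial_d2 b r f (\<gamma> t) A X) (at t)"
  unfolding radial_d1_def[of b r f X] radial_d2_def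
proof (intro has_vector_derivative_sum has_vector_derivative_mult)
  fix j \<alpha> \<beta>
  have "Ck_on (Suc 0) hermitian_tuples radial_domain (entry_deriv j \<alpha> \<beta> f)"
    using f by (intro Ck_on_entry_deriv) (simp add: numeral_2_eq_2)
  from has_vector_derivative_radial_chain[OF this r reg \<gamma> A]
  show "((\<lambda>t. entry_deriv j \<alpha> \<beta> f (radial_map b r (\<gamma> t))) has_vector_derivative
      radial_d1 b r (entry_deriv j \<alpha> \<beta> f) A (\<gamma> t)) (at t)" by (simp add: radial_d1_def)
  from bounded_linear.has_vector_derivative[OF bounded_linear_compose[OF bounded_linear_vec_nth bounded_linear_vec_nth]
      has_vector_derivative_compress[OF \<gamma> A]]
  show "((\<lambda>t. compress r (comm X (block_proj b (Some j))) (\<gamma> t) $ \<alpha> $ \<beta>) has_vector_derivative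
      compress r (comm A (comm X (block_proj b (Some j)))) (\<gamma> t) $ \<alpha> $ \<beta>) (at t)" .
qed

section \<open>Sums over a horizontal frame\<close>

lemma sum_delta_pair:
  fixes x :: "'a::finite" and y :: "'b::finite" and F :: "'a \<Rightarrow> 'b \<Rightarrow> 'c::comm_monoid_add"
  shows "(\<Sum>i\<in>UNIV. \<Sum>j\<in>UNIV. if i = x then if j = y then F i j else 0 else 0) = F x y"
proof -
  have "(\<Sum>j\<in>UNIV. if i = x then if j = y then F i j else 0 else 0) = (if i = x then F i y else 0)" for i
    by (cases "i = x") simp_all
  then show ?thesis by simp
qed

lemma sum_pair_product:
  fixes F :: "'a \<Rightarrow> 'b \<Rightarrow> 'c::semiring_0"
  shows "(\<Sum>p\<in>A. \<Sum>q\<in>B. F p q) * (\<Sum>p\<in>A'. \<Sum>q\<in>B'. G p q) =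
    (\<Sum>p\<in>A. \<Sum>q\<in>B. \<Sum>p'\<in>A'. \<Sum>q'\<in>B'. F p q * G p' q')"
  unfolding sum_distrib_right unfolding sum_distrib_left ..

context flag_frame
begin

text \<open>The Casimir identity is read off from the expansions of the horizontal parts of the matrices with entries \<open>1\<close> and \<open>\<i>\<close> at the position \<open>(p', q')\<close>.\<close>

lemma frame_casimir:
  "(\<Sum>a\<in>UNIV. \<xi> a $ p $ q * \<xi> a $ p' $ q') = - of_bool (p = q' \<and> q = p' \<and> b p \<noteq> b q)"
proof -
  \<comment> \<open>Twice the orthogonal projection to the horizontal space of the matrix with entry
    z at (p', q'); hence the factor 2 in \<open>inn\<close>.\<close>
  define M where "M z = ((\<chi> i j. if b i = b j then 0 else (if i = p' \<and> j = q' then z else 0) -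
      (if i = q' \<and> j = p' then cnj z else 0)) :: complex^'n^'n)" for z
  have sk: "cnj (\<xi> a $ i $ j) = - \<xi> a $ j $ i" for a i j
    using frame_skew[of a] by (simp add: skew_hermitian_nth)
  have hz: "\<xi> a $ i $ j = 0" if "b i = b j" for a i j
    using frame_horizontal[of a] that by (simp add: horizontal_iff)
  have hM: "M z \<in> horizontal b" for z
  proof -
    have "cnj (M z $ j $ i) = - M z $ i $ j" for i j
      unfolding M_def vec_lambda_beta
      by (cases "b i = b j"; cases "i = p'"; cases "j = q'"; cases "i = q'"; cases "j = p'"; simp)
    moreover have "M z $ i $ j = 0" if "b i = b j" for i j using that by (simp add: M_def)
    ultimately show ?thesis unfolding horizontal_iff skew_hermitian_nth by blast
  qed
  have inn: "inner (M z) (\<xi> a) = 2 * inner z (\<xi> a $ p' $ q')" for z a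
  proof -
    have "inner (M z) (\<xi> a) = (\<Sum>i\<in>UNIV. \<Sum>j\<in>UNIV. (if i = p' then if j = q' then inner z (\<xi> a $ i $ j) else 0 else 0)
        - (if i = q' then if j = p' then inner (cnj z) (\<xi> a $ i $ j) else 0 else 0))"
      unfolding inner_vec_def
    proof (intro sum.cong refl)
      fix i j
      show "inner (M z $ i $ j) (\<xi> a $ i $ j) = (if i = p' then if j = q' then inner z (\<xi> a $ i $ j) else 0 else 0)
        - (if i = q' then if j = p' then inner (cnj z) (\<xi> a $ i $ j) else 0 else 0)"
      proof (cases "b i = b j")
        case True
        show ?thesis unfolding hz[OF True] by simp
      next
        case False
        then have e: "M z $ i $ j = (if i = p' \<and> j = q' then z else 0) - (if i = q' \<and> j = p' then cnj z else 0)"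
          by (simp add: M_def)
        show ?thesis unfolding e inner_diff_left
          by (cases "i = p'"; cases "j = q'"; cases "i = q'"; cases "j = p'"; simp)
      qed
    qed
    also have "\<dots> = inner z (\<xi> a $ p' $ q') - inner (cnj z) (\<xi> a $ q' $ p')"
      by (simp add: sum_subtractf sum_delta_pair)
    also have "inner (cnj z) (\<xi> a $ q' $ p') = - inner z (\<xi> a $ p' $ q')"
    proof -
      have "\<xi> a $ q' $ p' = - cnj (\<xi> a $ p' $ q')" using sk[of a p' q'] by simp
      then show ?thesis by (simp add: inner_complex_def)
    qed
    finally show ?thesis by simp
  qed
  have M: "M z $ p $ q = (\<Sum>a\<in>UNIV. (2 * inner z (\<xi> a $ p' $ q')) *\<^sub>R \<xi> a $ p $ q)" for z
    using arg_cong[OF frame_expansion[OF hM[of z]], of "\<lambda>X. X $ p $ q"] by (simp add: inn)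
  \<comment> \<open>The products with 1 and \<i> are the real and imaginary part, so this
    combination restores the complex entry. On the right the terms at (p', q') cancel because
    \<i>\<i> = -1, and those at (q', p') double.\<close>
  have "(\<Sum>a\<in>UNIV. 2 * (\<xi> a $ p $ q * \<xi> a $ p' $ q')) = M 1 $ p $ q + \<i> * M \<i> $ p $ q"
    unfolding M sum_distrib_left sum.distrib[symmetric]
    by (intro sum.cong refl) (simp add: complex_eq_iff inner_complex_def algebra_simps)
  also have "\<dots> = - 2 * of_bool (p = q' \<and> q = p' \<and> b p \<noteq> b q)"
    unfolding M_def vec_lambda_beta
    by (cases "b p = b q"; cases "p = p'"; cases "q = q'"; cases "p = q'"; cases "q = p'"; simp)
  finally show ?thesis by (simp flip: sum_distrib_left)
qed

text \<open>The Casimir identity forces equal outer indices and equal inner indices, so of M only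
  the trace over the other blocks remains.\<close>

lemma frame_casimir_mult:
  "(\<Sum>a\<in>UNIV. (\<xi> a ** M ** \<xi> a) $ p $ q) = - of_bool (p = q) * (\<Sum>k\<in>UNIV. of_bool (b k \<noteq> b p) * M $ k $ k)"
proof -
  have "(\<Sum>a\<in>UNIV. (\<xi> a ** M ** \<xi> a) $ p $ q) = (\<Sum>l\<in>UNIV. \<Sum>k\<in>UNIV. M $ k $ l * (\<Sum>a\<in>UNIV. \<xi> a $ p $ k * \<xi> a $ l $ q))"
    by (simp add: matrix_matrix_mult_def sum_distrib_left sum_distrib_right mult_ac)
       (subst sum.swap, intro sum.cong refl, rule sum.swap)
  also have "\<dots> = (\<Sum>l\<in>UNIV. \<Sum>k\<in>UNIV. if k = l then - of_bool (p = q) * (of_bool (b k \<noteq> b p) * M $ k $ k) else 0)"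
    by (intro sum.cong refl) (auto simp: frame_casimir)
  also have "\<dots> = - of_bool (p = q) * (\<Sum>k\<in>UNIV. of_bool (b k \<noteq> b p) * M $ k $ k)"
    by (simp only: sum.delta finite_class.finite_UNIV UNIV_I if_True sum_distrib_left)
  finally show ?thesis .
qed

text \<open>Source of the first-order coefficients. With n the size of the matrices, the double
  commutator is \<xi>\<xi>E - 2 \<xi>E\<xi> + E\<xi>\<xi>; after summation the outer terms give -2(n
  - N j) on block j and the middle one gives 2 N j off block j.\<close>

lemma frame_double_comm:
  fixes N :: "'b \<Rightarrow> nat"
  assumes N: "\<And>j. card {c. b c = j} = N j"
  shows "(\<Sum>a\<in>UNIV. comm (\<xi> a) (comm (\<xi> a) (block_proj b j))) =
    (2 * real (N j)) *\<^sub>R mat 1 - (2 * real CARD('n)) *\<^sub>R block_proj b j"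
proof -
  let ?E = "block_proj b j"
  have c: "(\<Sum>k\<in>UNIV. of_bool (b k = i)) = (of_nat (N i) :: complex)" for i
    by (simp add: N[symmetric] of_bool_def sum.If_cases)
  have cn: "(\<Sum>k\<in>UNIV. of_bool (b k \<noteq> i)) = (of_nat CARD('n) - of_nat (N i) :: complex)" for i
  proof -
    have "(\<Sum>k\<in>UNIV. of_bool (b k \<noteq> i)) = (\<Sum>k\<in>UNIV. 1 - of_bool (b k = i) :: complex)"
      by (intro sum.cong refl) simp
    then show ?thesis by (simp add: sum_subtractf c)
  qed
  have 1: "(\<Sum>a\<in>UNIV. (\<xi> a ** \<xi> a) $ p $ q) = - of_bool (p = q) * (of_nat CARD('n) - of_nat (N (b p)))" for p q
  proof -
    have "(mat 1 :: complex^'n^'n) $ k $ k = 1" for k by (simp add: mat_def)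
    then show ?thesis using frame_casimir_mult[of "mat 1" p q] by (simp only: mult_1_right matrix_mul_rid cn)
  qed
  have 2: "(\<Sum>a\<in>UNIV. (\<xi> a ** ?E ** \<xi> a) $ p $ q) = - of_bool (p = q) * (of_bool (b p \<noteq> j) * of_nat (N j))" for p q
  proof -
    have "(\<Sum>k\<in>UNIV. of_bool (b k \<noteq> b p) * ?E $ k $ k) = (\<Sum>k\<in>UNIV. of_bool (b p \<noteq> j) * of_bool (b k = j))"
      by (intro sum.cong refl) (auto simp: block_proj_def)
    also have "\<dots> = of_bool (b p \<noteq> j) * of_nat (N j)" by (simp add: c flip: sum_distrib_left)
    finally show ?thesis by (simp add: frame_casimir_mult)
  qed
  have "comm (\<xi> a) (comm (\<xi> a) ?E) $ p $ q = (\<xi> a ** \<xi> a) $ p $ q * of_bool (b q = j)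
      - 2 * (\<xi> a ** ?E ** \<xi> a) $ p $ q + of_bool (b p = j) * (\<xi> a ** \<xi> a) $ p $ q" for a p q
  proof -
    have "comm (\<xi> a) (comm (\<xi> a) ?E) = (\<xi> a ** \<xi> a) ** ?E - \<xi> a ** ?E ** \<xi> a - \<xi> a ** ?E ** \<xi> a + ?E ** (\<xi> a ** \<xi> a)"
      by (simp add: comm_def matrix_diff_left matrix_diff_right matrix_mul_assoc)
    then show ?thesis by (simp add: mult_block_proj[of "\<xi> a ** \<xi> a"] block_proj_mult[of _ _ "\<xi> a ** \<xi> a"])
  qed
  then have "(\<Sum>a\<in>UNIV. comm (\<xi> a) (comm (\<xi> a) ?E)) $ p $ q = ((2 * real (N j)) *\<^sub>R mat 1 - (2 * real CARD('n)) *\<^sub>R ?E) $ p $ q" for p q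
    by (simp add: sum.distrib sum_subtractf 1 2 flip: sum_distrib_left sum_distrib_right)
       (auto simp: mat_def block_proj_def scaleR_conv_of_real algebra_simps)
  then show ?thesis by (simp add: vec_eq_iff)
qed

text \<open>Source of the second-order coefficients. The pairing of p with q' and of q with p'
  regroups the four row factors into a product of an (\<alpha>, \<delta>) entry and a (\<gamma>,
  \<beta>) entry.\<close>

lemma frame_compress:
  fixes r :: "'m::finite \<Rightarrow> 'n"
  assumes U: "U \<in> unitary_group" "inj r"
  shows "(\<Sum>a\<in>UNIV. compress r (comm (\<xi> a) (block_proj b j)) U $ \<alpha> $ \<beta> * compress r (comm (\<xi> a) (block_proj b l)) U $ \<gamma> $ \<delta>) =
   of_bool (j = l) * (mat 1 $ \<alpha> $ \<delta> * compress r (block_proj b j) U $ \<gamma> $ \<beta> + compress r (block_proj b j) U $ \<alpha> $ \<delta> * mat 1 $ \<gamma> $ \<beta>)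
   - compress r (block_proj b l) U $ \<alpha> $ \<delta> * compress r (block_proj b j) U $ \<gamma> $ \<beta>
   - compress r (block_proj b j) U $ \<alpha> $ \<delta> * compress r (block_proj b l) U $ \<gamma> $ \<beta>"
proof -
  define Z where "Z = rows_of r U"
  define e where "e i p = (of_bool (b p = i) :: complex)" for i p
  have cp: "compress r M U $ \<mu> $ \<nu> = (\<Sum>p\<in>UNIV. \<Sum>q\<in>UNIV. Z $ \<mu> $ p * M $ p $ q * cnj (Z $ \<nu> $ q))" for M \<mu> \<nu>
    unfolding compress_def Z_def[symmetric] by (subst sum.swap) (simp add: matrix_matrix_mult_def sum_distrib_right)
  have E: "(\<Sum>p\<in>UNIV. e i p * (Z $ \<mu> $ p * cnj (Z $ \<nu> $ p))) = compress r (block_proj b i) U $ \<mu> $ \<nu>" for i \<mu> \<nu>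
  proof -
    have "compress r (block_proj b i) U $ \<mu> $ \<nu> = (\<Sum>p\<in>UNIV. \<Sum>q\<in>UNIV. if q = p then e i p * (Z $ \<mu> $ p * cnj (Z $ \<nu> $ p)) else 0)"
      unfolding cp by (intro sum.cong refl) (auto simp: block_proj_def e_def)
    then show ?thesis by simp
  qed
  have I: "(\<Sum>p\<in>UNIV. Z $ \<mu> $ p * cnj (Z $ \<nu> $ p)) = mat 1 $ \<mu> $ \<nu>" for \<mu> \<nu>
  proof -
    have "Z ** ctranspose Z = mat 1" using compress_mat[OF U] by (simp add: compress_def Z_def)
    from arg_cong[OF this, of "\<lambda>M. M $ \<mu> $ \<nu>"] show ?thesis by (simp add: matrix_matrix_mult_def)
  qed
  have "(\<Sum>a\<in>UNIV. compress r (comm (\<xi> a) (block_proj b j)) U $ \<alpha> $ \<beta> * compress r (comm (\<xi> a) (block_proj b l)) U $ \<gamma> $ \<delta>)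
    = (\<Sum>a\<in>UNIV. \<Sum>p\<in>UNIV. \<Sum>q\<in>UNIV. \<Sum>p'\<in>UNIV. \<Sum>q'\<in>UNIV.
        (Z $ \<alpha> $ p * cnj (Z $ \<beta> $ q) * Z $ \<gamma> $ p' * cnj (Z $ \<delta> $ q') * (e j q - e j p) * (e l q' - e l p')) * (\<xi> a $ p $ q * \<xi> a $ p' $ q'))"
    unfolding cp sum_pair_product by (simp add: comm_block_proj e_def mult_ac)
  also have "\<dots> = (\<Sum>p\<in>UNIV. \<Sum>q\<in>UNIV. \<Sum>p'\<in>UNIV. \<Sum>q'\<in>UNIV.
        (Z $ \<alpha> $ p * cnj (Z $ \<beta> $ q) * Z $ \<gamma> $ p' * cnj (Z $ \<delta> $ q') * (e j q - e j p) * (e l q' - e l p')) * (\<Sum>a\<in>UNIV. \<xi> a $ p $ q * \<xi> a $ p' $ q'))"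
    unfolding sum_distrib_left
    by (subst sum.swap, rule sum.cong[OF refl], subst sum.swap, rule sum.cong[OF refl],
        subst sum.swap, rule sum.cong[OF refl], rule sum.swap)
  \<comment> \<open>The condition that p and q lie in different blocks disappears because the weight
    \<open>e j q - e j p\<close> is zero otherwise. The sign of the Casimir identity is absorbed by
    reversing the second weight.\<close>
  also have "\<dots> = (\<Sum>p\<in>UNIV. \<Sum>q\<in>UNIV. \<Sum>p'\<in>UNIV. \<Sum>q'\<in>UNIV. if q' = p then if p' = q then
        (Z $ \<alpha> $ p * cnj (Z $ \<beta> $ q) * Z $ \<gamma> $ q * cnj (Z $ \<delta> $ p) * (e j q - e j p) * (e l q - e l p)) else 0 else 0)"
    by (intro sum.cong refl) (auto simp: frame_casimir e_def)
  also have "\<dots> = (\<Sum>p\<in>UNIV. \<Sum>q\<in>UNIV. (Z $ \<alpha> $ p * cnj (Z $ \<delta> $ p)) * (Z $ \<gamma> $ q * cnj (Z $ \<beta> $ q)) * ((e j q - e j p) * (e l q - e l p)))"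
    by (simp add: mult_ac)
  also have "\<dots> = (\<Sum>p\<in>UNIV. \<Sum>q\<in>UNIV.
      of_bool (j = l) * ((Z $ \<alpha> $ p * cnj (Z $ \<delta> $ p)) * (e j q * (Z $ \<gamma> $ q * cnj (Z $ \<beta> $ q)))
         + (e j p * (Z $ \<alpha> $ p * cnj (Z $ \<delta> $ p))) * (Z $ \<gamma> $ q * cnj (Z $ \<beta> $ q)))
      - (e l p * (Z $ \<alpha> $ p * cnj (Z $ \<delta> $ p))) * (e j q * (Z $ \<gamma> $ q * cnj (Z $ \<beta> $ q)))
      - (e j p * (Z $ \<alpha> $ p * cnj (Z $ \<delta> $ p))) * (e l q * (Z $ \<gamma> $ q * cnj (Z $ \<beta> $ q))))"
  proof (intro sum.cong refl)
    fix p q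
    \<comment> \<open>Indicators of blocks are idempotent and mutually orthogonal, so the diagonal
      products exist only for j = l.\<close>
    have ee: "e j i * e l i = of_bool (j = l) * e j i" for i by (auto simp: e_def)
    have "(e j q - e j p) * (e l q - e l p) = e j q * e l q + e j p * e l p - e l p * e j q - e j p * e l q"
      by (simp add: algebra_simps)
    then have "(e j q - e j p) * (e l q - e l p) = of_bool (j = l) * (e j q + e j p) - e l p * e j q - e j p * e l q"
      unfolding ee by (simp add: algebra_simps)
    then show "(Z $ \<alpha> $ p * cnj (Z $ \<delta> $ p)) * (Z $ \<gamma> $ q * cnj (Z $ \<beta> $ q)) * ((e j q - e j p) * (e l q - e l p)) =
      of_bool (j = l) * ((Z $ \<alpha> $ p * cnj (Z $ \<delta> $ p)) * (e j q * (Z $ \<gamma> $ q * cnj (Z $ \<beta> $ q)))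
         + (e j p * (Z $ \<alpha> $ p * cnj (Z $ \<delta> $ p))) * (Z $ \<gamma> $ q * cnj (Z $ \<beta> $ q)))
      - (e l p * (Z $ \<alpha> $ p * cnj (Z $ \<delta> $ p))) * (e j q * (Z $ \<gamma> $ q * cnj (Z $ \<beta> $ q)))
      - (e j p * (Z $ \<alpha> $ p * cnj (Z $ \<delta> $ p))) * (e l q * (Z $ \<gamma> $ q * cnj (Z $ \<beta> $ q)))"
      by (simp add: algebra_simps)
  qed
  also have "\<dots> = of_bool (j = l) * (mat 1 $ \<alpha> $ \<delta> * compress r (block_proj b j) U $ \<gamma> $ \<beta> + compress r (block_proj b j) U $ \<alpha> $ \<delta> * mat 1 $ \<gamma> $ \<beta>)
   - compress r (block_proj b l) U $ \<alpha> $ \<delta> * compress r (block_proj b j) U $ \<gamma> $ \<beta>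
   - compress r (block_proj b j) U $ \<alpha> $ \<delta> * compress r (block_proj b l) U $ \<gamma> $ \<beta>"
    unfolding sum.distrib sum_subtractf
    unfolding sum_distrib_left[symmetric] sum.distrib
    unfolding E I sum_distrib_right[symmetric] unfolding E I ..
  finally show ?thesis .
qed

end

section \<open>Assembly of the radial operator from the frame sums\<close>

lemma sum_swap_inner:
  "(\<Sum>a\<in>S. \<Sum>j\<in>A. \<Sum>\<alpha>\<in>B. \<Sum>\<beta>\<in>C. G a j \<alpha> \<beta>) = (\<Sum>j\<in>A. \<Sum>\<alpha>\<in>B. \<Sum>\<beta>\<in>C. \<Sum>a\<in>S. G a j \<alpha> \<beta>)"
  by (subst sum.swap, rule sum.cong[OF refl], subst sum.swap, rule sum.cong[OF refl], rule sum.swap)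

lemma sum_swap_pairs:
  "(\<Sum>\<alpha>\<in>A. \<Sum>\<beta>\<in>B. \<Sum>\<gamma>\<in>C. \<Sum>\<delta>\<in>D. G \<alpha> \<beta> \<gamma> \<delta>) = (\<Sum>\<gamma>\<in>C. \<Sum>\<delta>\<in>D. \<Sum>\<alpha>\<in>A. \<Sum>\<beta>\<in>B. G \<alpha> \<beta> \<gamma> \<delta>)"
proof -
  have "(\<Sum>\<alpha>\<in>A. \<Sum>\<beta>\<in>B. \<Sum>\<gamma>\<in>C. \<Sum>\<delta>\<in>D. G \<alpha> \<beta> \<gamma> \<delta>) = (\<Sum>\<alpha>\<in>A. \<Sum>\<gamma>\<in>C. \<Sum>\<delta>\<in>D. \<Sum>\<beta>\<in>B. G \<alpha> \<beta> \<gamma> \<delta>)"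
    by (rule sum.cong[OF refl], subst sum.swap, rule sum.cong[OF refl], rule sum.swap)
  also have "\<dots> = (\<Sum>\<gamma>\<in>C. \<Sum>\<delta>\<in>D. \<Sum>\<alpha>\<in>A. \<Sum>\<beta>\<in>B. G \<alpha> \<beta> \<gamma> \<delta>)"
    by (subst sum.swap, rule sum.cong[OF refl], rule sum.swap)
  finally show ?thesis .
qed

lemma sum_card_fibres:
  fixes b :: "'n::finite \<Rightarrow> 'b::finite"
  shows "(\<Sum>j\<in>UNIV. card {c. b c = j}) = CARD('n)"
proof -
  have "(\<Sum>j\<in>UNIV. card {c. b c = j}) = (\<Sum>j\<in>UNIV. \<Sum>c\<in>UNIV. of_bool (b c = j))"
    by (simp add: of_bool_def sum.If_cases)
  also have "\<dots> = (\<Sum>c\<in>UNIV. \<Sum>j\<in>UNIV. of_bool (b c = j))" by (rule sum.swap)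
  also have "\<dots> = CARD('n)" by (simp add: of_bool_def)
  finally show ?thesis .
qed

text \<open>Summation over the frame index is moved innermost, where \<open>frame_compress\<close>
  evaluates the second-order coefficients and \<open>frame_double_comm\<close> the first-order ones.
  The total n arises as the sum of the block sizes.\<close>

lemma sum_radial_d2:
  fixes N :: "'k::finite option \<Rightarrow> nat"
    and b :: "'n::finite \<Rightarrow> 'k option"
    and r :: "'m::finite \<Rightarrow> 'n" and \<xi> :: "'d::finite \<Rightarrow> complex^'n^'n"
  assumes frame: "flag_frame b \<xi>"
    and N: "\<And>j. card {c. b c = j} = N j"
    and r: "inj r" and f: "Ck_on 2 hermitian_tuples radial_domain f"
    and U: "U \<in> regular_set b r"
  shows "(\<Sum>a\<in>UNIV. radial_d2 b r f U (\<xi> a) (\<xi> a)) = radial_laplacian N f (radial_map b r U)"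
proof -
  interpret flag_frame b \<xi> by (rule frame)
  have uU: "U \<in> unitary_group" using U by (simp add: regular_set_iff)
  define \<Lambda> where "\<Lambda> = radial_map b r U"
  have \<Lambda>: "\<Lambda> \<in> radial_domain" unfolding \<Lambda>_def by (rule radial_map_regular[OF U r])
  define D1 where "D1 j \<alpha> \<beta> = entry_deriv j \<alpha> \<beta> f \<Lambda>" for j \<alpha> \<beta>
  define D2 where "D2 j \<alpha> \<beta> l \<gamma> \<delta> = entry_deriv j \<alpha> \<beta> (entry_deriv l \<gamma> \<delta> f) \<Lambda>" for j \<alpha> \<beta> l \<gamma> \<delta>
  \<comment> \<open>\<open>radial_d2\<close> produces the two entry derivatives in the order
    opposite to that of \<open>radial_laplacian\<close>.\<close>
  have D2: "entry_deriv l \<gamma> \<delta> (entry_deriv j \<alpha> \<beta> f) \<Lambda> = D2 j \<alpha> \<beta> l \<gamma> \<delta>" "D2 l \<gamma> \<delta> j \<alpha> \<beta> = D2 j \<alpha> \<beta> l \<gamma> \<delta>" for j \<alpha> \<beta> l \<gamma> \<delta>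
    unfolding D2_def by (rule entry_deriv_commute[OF f \<Lambda>])+
  define Q where "Q a j = compress r (comm (\<xi> a) (block_proj b (Some j))) U" for a j
  define Q2 where "Q2 a j = compress r (comm (\<xi> a) (comm (\<xi> a) (block_proj b (Some j)))) U" for a j
  define c where "c j \<alpha> \<beta> l \<gamma> \<delta> = (\<Sum>a\<in>UNIV. Q a j $ \<alpha> $ \<beta> * Q a l $ \<gamma> $ \<delta>)" for j \<alpha> \<beta> l \<gamma> \<delta>
  let ?I = "mat 1 :: complex^'m^'m"
  have c: "c j \<alpha> \<beta> l \<gamma> \<delta> = of_bool (j = l) * (?I $ \<alpha> $ \<delta> * \<Lambda> $ j $ \<gamma> $ \<beta> + \<Lambda> $ j $ \<alpha> $ \<delta> * ?I $ \<gamma> $ \<beta>)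
     - \<Lambda> $ l $ \<alpha> $ \<delta> * \<Lambda> $ j $ \<gamma> $ \<beta> - \<Lambda> $ j $ \<alpha> $ \<delta> * \<Lambda> $ l $ \<gamma> $ \<beta>" for j \<alpha> \<beta> l \<gamma> \<delta>
    unfolding c_def Q_def frame_compress[OF uU r] \<Lambda>_def radial_map_nth by simp
  define S where "S j l = (\<Sum>\<alpha>\<in>UNIV. \<Sum>\<beta>\<in>UNIV. \<Sum>\<gamma>\<in>UNIV. \<Sum>\<delta>\<in>UNIV. c j \<alpha> \<beta> l \<gamma> \<delta> * D2 j \<alpha> \<beta> l \<gamma> \<delta>)" for j l
  have "(\<Sum>a\<in>UNIV. radial_d2 b r f U (\<xi> a) (\<xi> a)) = (\<Sum>a\<in>UNIV. \<Sum>j\<in>UNIV. \<Sum>\<alpha>\<in>UNIV. \<Sum>\<beta>\<in>UNIV.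
     Q a j $ \<alpha> $ \<beta> * (\<Sum>l\<in>UNIV. \<Sum>\<gamma>\<in>UNIV. \<Sum>\<delta>\<in>UNIV. Q a l $ \<gamma> $ \<delta> * D2 j \<alpha> \<beta> l \<gamma> \<delta>) + Q2 a j $ \<alpha> $ \<beta> * D1 j \<alpha> \<beta>)"
    unfolding radial_d2_def radial_d1_def \<Lambda>_def[symmetric] D2(1) Q_def Q2_def D1_def ..
  also have "\<dots> = (\<Sum>j\<in>UNIV. \<Sum>\<alpha>\<in>UNIV. \<Sum>\<beta>\<in>UNIV. \<Sum>a\<in>UNIV.
     Q a j $ \<alpha> $ \<beta> * (\<Sum>l\<in>UNIV. \<Sum>\<gamma>\<in>UNIV. \<Sum>\<delta>\<in>UNIV. Q a l $ \<gamma> $ \<delta> * D2 j \<alpha> \<beta> l \<gamma> \<delta>) + Q2 a j $ \<alpha> $ \<beta> * D1 j \<alpha> \<beta>)"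
    by (rule sum_swap_inner)
  also have "\<dots> = (\<Sum>j\<in>UNIV. \<Sum>\<alpha>\<in>UNIV. \<Sum>\<beta>\<in>UNIV.
      (\<Sum>l\<in>UNIV. \<Sum>\<gamma>\<in>UNIV. \<Sum>\<delta>\<in>UNIV. c j \<alpha> \<beta> l \<gamma> \<delta> * D2 j \<alpha> \<beta> l \<gamma> \<delta>) + (\<Sum>a\<in>UNIV. Q2 a j $ \<alpha> $ \<beta>) * D1 j \<alpha> \<beta>)"
  proof (intro sum.cong refl)
    fix j \<alpha> \<beta>
    have "(\<Sum>a\<in>UNIV. Q a j $ \<alpha> $ \<beta> * (\<Sum>l\<in>UNIV. \<Sum>\<gamma>\<in>UNIV. \<Sum>\<delta>\<in>UNIV. Q a l $ \<gamma> $ \<delta> * D2 j \<alpha> \<beta> l \<gamma> \<delta>))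
       = (\<Sum>l\<in>UNIV. \<Sum>\<gamma>\<in>UNIV. \<Sum>\<delta>\<in>UNIV. \<Sum>a\<in>UNIV. Q a j $ \<alpha> $ \<beta> * (Q a l $ \<gamma> $ \<delta> * D2 j \<alpha> \<beta> l \<gamma> \<delta>))"
      unfolding sum_distrib_left by (rule sum_swap_inner)
    then show "(\<Sum>a\<in>UNIV. Q a j $ \<alpha> $ \<beta> * (\<Sum>l\<in>UNIV. \<Sum>\<gamma>\<in>UNIV. \<Sum>\<delta>\<in>UNIV. Q a l $ \<gamma> $ \<delta> * D2 j \<alpha> \<beta> l \<gamma> \<delta>) + Q2 a j $ \<alpha> $ \<beta> * D1 j \<alpha> \<beta>)
       = (\<Sum>l\<in>UNIV. \<Sum>\<gamma>\<in>UNIV. \<Sum>\<delta>\<in>UNIV. c j \<alpha> \<beta> l \<gamma> \<delta> * D2 j \<alpha> \<beta> l \<gamma> \<delta>) + (\<Sum>a\<in>UNIV. Q2 a j $ \<alpha> $ \<beta>) * D1 j \<alpha> \<beta>"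
      unfolding sum.distrib c_def sum_distrib_right by (simp add: mult.assoc)
  qed
  also have "\<dots> = (\<Sum>j\<in>UNIV. \<Sum>l\<in>UNIV. S j l) + (\<Sum>j\<in>UNIV. \<Sum>\<alpha>\<in>UNIV. \<Sum>\<beta>\<in>UNIV. (\<Sum>a\<in>UNIV. Q2 a j $ \<alpha> $ \<beta>) * D1 j \<alpha> \<beta>)"
  proof -
    have "(\<Sum>\<alpha>\<in>UNIV. \<Sum>\<beta>\<in>UNIV. \<Sum>l\<in>UNIV. \<Sum>\<gamma>\<in>UNIV. \<Sum>\<delta>\<in>UNIV. c j \<alpha> \<beta> l \<gamma> \<delta> * D2 j \<alpha> \<beta> l \<gamma> \<delta>) = (\<Sum>l\<in>UNIV. S j l)" for j
      unfolding S_def by (rule trans[OF sum.cong[OF refl sum.swap] sum.swap])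
    then show ?thesis by (simp add: sum.distrib)
  qed
  also have "(\<Sum>j\<in>UNIV. \<Sum>l\<in>UNIV. S j l) = (\<Sum>j\<in>UNIV. S j j) + (\<Sum>j\<in>UNIV. \<Sum>l\<in>UNIV - {j}. S j l)"
    unfolding sum.distrib[symmetric] by (intro sum.cong refl sum.remove) simp_all
  also have "(\<Sum>j\<in>UNIV. S j j) = 2 * (\<Sum>j\<in>UNIV. \<Sum>\<alpha>\<in>UNIV. \<Sum>\<beta>\<in>UNIV. \<Sum>\<gamma>\<in>UNIV. \<Sum>\<delta>\<in>UNIV.
            (?I - \<Lambda> $ j) $ \<alpha> $ \<delta> * \<Lambda> $ j $ \<gamma> $ \<beta> * D2 j \<alpha> \<beta> j \<gamma> \<delta>)"
  proof -
    have "S j j = 2 * (\<Sum>\<alpha>\<in>UNIV. \<Sum>\<beta>\<in>UNIV. \<Sum>\<gamma>\<in>UNIV. \<Sum>\<delta>\<in>UNIV. (?I - \<Lambda> $ j) $ \<alpha> $ \<delta> * \<Lambda> $ j $ \<gamma> $ \<beta> * D2 j \<alpha> \<beta> j \<gamma> \<delta>)" for j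
    proof -
      \<comment> \<open>For equal j the coefficient has two halves that are exchanged by swapping
        (\<alpha>, \<beta>) with (\<gamma>, \<delta>). Symmetry of the second derivatives makes
        their sums equal, whence the factor 2.\<close>
      have "S j j = (\<Sum>\<alpha>\<in>UNIV. \<Sum>\<beta>\<in>UNIV. \<Sum>\<gamma>\<in>UNIV. \<Sum>\<delta>\<in>UNIV. (?I - \<Lambda> $ j) $ \<alpha> $ \<delta> * \<Lambda> $ j $ \<gamma> $ \<beta> * D2 j \<alpha> \<beta> j \<gamma> \<delta>)
         + (\<Sum>\<alpha>\<in>UNIV. \<Sum>\<beta>\<in>UNIV. \<Sum>\<gamma>\<in>UNIV. \<Sum>\<delta>\<in>UNIV. (?I - \<Lambda> $ j) $ \<gamma> $ \<beta> * \<Lambda> $ j $ \<alpha> $ \<delta> * D2 j \<gamma> \<delta> j \<alpha> \<beta>)"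
        unfolding S_def sum.distrib[symmetric]
      proof (intro sum.cong refl)
        fix \<alpha> \<beta> \<gamma> \<delta>
        show "c j \<alpha> \<beta> j \<gamma> \<delta> * D2 j \<alpha> \<beta> j \<gamma> \<delta> = (?I - \<Lambda> $ j) $ \<alpha> $ \<delta> * \<Lambda> $ j $ \<gamma> $ \<beta> * D2 j \<alpha> \<beta> j \<gamma> \<delta> +
           (?I - \<Lambda> $ j) $ \<gamma> $ \<beta> * \<Lambda> $ j $ \<alpha> $ \<delta> * D2 j \<gamma> \<delta> j \<alpha> \<beta>"
          unfolding D2(2)[of j \<gamma> \<delta> j \<alpha> \<beta>] c by (simp add: algebra_simps)
      qed
      also have "(\<Sum>\<alpha>\<in>UNIV. \<Sum>\<beta>\<in>UNIV. \<Sum>\<gamma>\<in>UNIV. \<Sum>\<delta>\<in>UNIV. (?I - \<Lambda> $ j) $ \<gamma> $ \<beta> * \<Lambda> $ j $ \<alpha> $ \<delta> * D2 j \<gamma> \<delta> j \<alpha> \<beta>)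
        = (\<Sum>\<alpha>\<in>UNIV. \<Sum>\<beta>\<in>UNIV. \<Sum>\<gamma>\<in>UNIV. \<Sum>\<delta>\<in>UNIV. (?I - \<Lambda> $ j) $ \<alpha> $ \<delta> * \<Lambda> $ j $ \<gamma> $ \<beta> * D2 j \<alpha> \<beta> j \<gamma> \<delta>)"
        by (rule sum_swap_pairs)
      finally show "S j j = 2 * (\<Sum>\<alpha>\<in>UNIV. \<Sum>\<beta>\<in>UNIV. \<Sum>\<gamma>\<in>UNIV. \<Sum>\<delta>\<in>UNIV. (?I - \<Lambda> $ j) $ \<alpha> $ \<delta> * \<Lambda> $ j $ \<gamma> $ \<beta> * D2 j \<alpha> \<beta> j \<gamma> \<delta>)"
        by simp
    qed
    then show ?thesis by (simp only: sum_distrib_left)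
  qed
  also have "(\<Sum>j\<in>UNIV. \<Sum>l\<in>UNIV - {j}. S j l) = - (\<Sum>j\<in>UNIV. \<Sum>l\<in>UNIV - {j}. \<Sum>\<alpha>\<in>UNIV. \<Sum>\<beta>\<in>UNIV. \<Sum>\<gamma>\<in>UNIV. \<Sum>\<delta>\<in>UNIV.
            (\<Lambda> $ j $ \<alpha> $ \<delta> * \<Lambda> $ l $ \<gamma> $ \<beta> + \<Lambda> $ j $ \<gamma> $ \<beta> * \<Lambda> $ l $ \<alpha> $ \<delta>) * D2 j \<alpha> \<beta> l \<gamma> \<delta>)"
    unfolding S_def sum_negf[symmetric]
    by (intro sum.cong refl) (auto simp: c algebra_simps)
  also have "(\<Sum>j\<in>UNIV. \<Sum>\<alpha>\<in>UNIV. \<Sum>\<beta>\<in>UNIV. (\<Sum>a\<in>UNIV. Q2 a j $ \<alpha> $ \<beta>) * D1 j \<alpha> \<beta>) =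
     2 * (\<Sum>j\<in>UNIV. \<Sum>\<alpha>\<in>UNIV. \<Sum>\<beta>\<in>UNIV.
            (of_nat (N (Some j)) * ?I $ \<alpha> $ \<beta> - of_nat (\<Sum>i\<in>UNIV. N i) * \<Lambda> $ j $ \<alpha> $ \<beta>) * D1 j \<alpha> \<beta>)"
    unfolding sum_distrib_left[of 2]
  proof (intro sum.cong refl)
    fix j \<alpha> \<beta>
    have "(\<Sum>a\<in>UNIV. Q2 a j) = compress r ((2 * real (N (Some j))) *\<^sub>R mat 1 - (2 * real CARD('n)) *\<^sub>R block_proj b (Some j)) U"
      unfolding Q2_def linear_sum[OF linear_compress, symmetric] frame_double_comm[OF N] ..
    also have "\<dots> = (2 * real (N (Some j))) *\<^sub>R ?I - (2 * real CARD('n)) *\<^sub>R \<Lambda> $ j"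
      by (simp add: linear_diff[OF linear_compress] linear_cmul[OF linear_compress] compress_mat[OF uU r] \<Lambda>_def radial_map_nth)
    finally have q: "(\<Sum>a\<in>UNIV. Q2 a j) = (2 * real (N (Some j))) *\<^sub>R ?I - (2 * real CARD('n)) *\<^sub>R \<Lambda> $ j" .
    have "(\<Sum>i\<in>UNIV. N i) = CARD('n)" using sum_card_fibres[of b] by (simp add: N)
    moreover have "(\<Sum>a\<in>UNIV. Q2 a j $ \<alpha> $ \<beta>) = (2 * real (N (Some j))) *\<^sub>R (?I $ \<alpha> $ \<beta>) - (2 * real CARD('n)) *\<^sub>R (\<Lambda> $ j $ \<alpha> $ \<beta>)"
      using arg_cong[OF q, of "\<lambda>M. M $ \<alpha> $ \<beta>"] by simp
    ultimately have "(\<Sum>a\<in>UNIV. Q2 a j $ \<alpha> $ \<beta>) = 2 * (of_nat (N (Some j)) * ?I $ \<alpha> $ \<beta> - of_nat (\<Sum>i\<in>UNIV. N i) * \<Lambda> $ j $ \<alpha> $ \<beta>)"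
      by (simp add: scaleR_conv_of_real right_diff_distrib mult.assoc del: of_nat_sum)
    then show "(\<Sum>a\<in>UNIV. Q2 a j $ \<alpha> $ \<beta>) * D1 j \<alpha> \<beta> =
      2 * ((of_nat (N (Some j)) * ?I $ \<alpha> $ \<beta> - of_nat (\<Sum>i\<in>UNIV. N i) * \<Lambda> $ j $ \<alpha> $ \<beta>) * D1 j \<alpha> \<beta>)"
      by (simp only: mult.assoc)
  qed
  finally show ?thesis
    unfolding radial_laplacian_def \<Lambda>_def[symmetric] D1_def D2_def by simp
qed

section \<open>Existence of frames and charts\<close>

lemma flag_frame_exists:
  fixes b :: "'n::finite \<Rightarrow> 'b"
  assumes "CARD('d::finite) = dim (horizontal b)"
  obtains \<xi> :: "'d::finite \<Rightarrow> complex^'n^'n" where "flag_frame b \<xi>"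
proof -
  obtain B where B: "B \<subseteq> horizontal b" "pairwise orthogonal B" "\<And>x. x \<in> B \<Longrightarrow> norm x = 1"
      "independent B" "card B = dim (horizontal b)" "span B = horizontal b"
    using orthonormal_basis_subspace[OF subspace_horizontal] by metis
  have fin: "finite B" using B(4) independent_imp_finite by blast
  then obtain \<xi> :: "'d \<Rightarrow> complex^'n^'n" where \<xi>: "bij_betw \<xi> UNIV B"
    using finite_same_card_bij[of "UNIV :: 'd set" B] B(5) assms by auto
  have on: "inner (\<xi> a) (\<xi> c) = of_bool (a = c)" for a c
  proof (cases "a = c")
    case True
    have "norm (\<xi> a) = 1" using \<xi> B(3) bij_betwE by blast
    then show ?thesis using True by (simp add: dot_square_norm)
  next
    case False
    then have "\<xi> a \<noteq> \<xi> c" using \<xi> by (auto simp: bij_betw_def inj_on_def)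
    moreover have "\<xi> a \<in> B" "\<xi> c \<in> B" using \<xi> bij_betwE by blast+
    ultimately show ?thesis using B(2) False by (simp add: pairwise_def orthogonal_def)
  qed
  have "flag_frame b \<xi>"
  proof
    show "\<xi> a \<in> horizontal b" for a using \<xi> B(1) bij_betwE by blast
    show "inner (\<xi> a) (\<xi> c) = of_bool (a = c)" for a c by (rule on)
    fix X
    assume "X \<in> horizontal b"
    then obtain u where "X = (\<Sum>v\<in>B. u v *\<^sub>R v)" unfolding B(6)[symmetric] span_finite[OF fin] by blast
    also have "\<dots> = (\<Sum>a\<in>UNIV. u (\<xi> a) *\<^sub>R \<xi> a)" by (rule sum.reindex_bij_betw[OF \<xi>, symmetric])
    finally have X: "X = (\<Sum>a\<in>UNIV. u (\<xi> a) *\<^sub>R \<xi> a)" .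
    then have "inner X (\<xi> a) = u (\<xi> a)" for a by (simp add: inner_sum_left on)
    then show "X = (\<Sum>a\<in>UNIV. inner X (\<xi> a) *\<^sub>R \<xi> a)" using X by simp
  qed
  then show ?thesis by (rule that)
qed

section \<open>The Cayley transform and the local chart\<close>

lemma det_nonzeroI:
  fixes A :: "'f::field^'n^'n"
  assumes "\<And>v. A *v v = 0 \<Longrightarrow> v = 0"
  shows "det A \<noteq> 0"
  using assms matrix_left_invertible_ker[of A] by (simp add: invertible_det_nz[symmetric] invertible_left_inverse)

text \<open>A skew-Hermitian X satisfies inner v (X v) = 0 in the real product, so X v = v forces v
  = 0.\<close>

lemma det_one_minus_skew:
  fixes X :: "complex^'n^'n"
  assumes "X \<in> skew_hermitian"
  shows "det (mat 1 - X) \<noteq> 0"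
proof (rule det_nonzeroI)
  interpret m: bounded_bilinear "(*v) :: complex^'n^'n \<Rightarrow> complex^'n \<Rightarrow> complex^'n"
    by (rule bounded_bilinear_matrix_vector_mult)
  fix v
  assume "(mat 1 - X) *v v = 0"
  then have "X *v v = v" by (simp add: m.diff_left)
  moreover have "inner v (X *v v) = - inner (X *v v) v"
    using inner_matrix_vector_mult[of v X v] assms by (simp add: skew_hermitian_def m.minus_left)
  ultimately show "v = 0" by (simp add: inner_commute)
qed

text \<open>A rational replacement for the exponential map: its smoothness reduces to that of the
  matrix inverse, and it is defined on all skew-Hermitian matrices.\<close>

definition cayley :: "complex^'n^'n \<Rightarrow> complex^'n^'n" where
  "cayley X = matrix_inv (mat 1 - X) ** (mat 1 + X)"

text \<open>The factors 1 - X and 1 + X are adjoint to each other and commute, so the product with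
  the adjoint telescopes.\<close>

lemma cayley_unitary:
  assumes X: "X \<in> skew_hermitian"
  shows "cayley X \<in> unitary_group"
proof -
  let ?A = "mat 1 - X" and ?B = "mat 1 + X"
  have mX: "- X \<in> skew_hermitian" using X by (simp add: skew_hermitian_def ctranspose_minus)
  note dA = det_one_minus_skew[OF X]
  have dB: "det ?B \<noteq> 0" using det_one_minus_skew[OF mX] by simp
  have tA: "ctranspose ?A = ?B" and tB: "ctranspose ?B = ?A"
    using X by (simp_all add: skew_hermitian_def ctranspose_diff ctranspose_add ctranspose_mat)
  have tinv: "ctranspose (matrix_inv ?A) = matrix_inv ?B"
  proof -
    have "ctranspose (matrix_inv ?A ** ?A) = mat 1" by (simp add: matrix_inv_inverse[OF dA] ctranspose_mat)
    then show ?thesis by (simp add: ctranspose_mult tA matrix_inv_unique)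
  qed
  have com: "?B ** ?A = ?A ** ?B"
    by (simp add: matrix_diff_left matrix_diff_right bounded_bilinear.add_left[OF bounded_bilinear_matrix_mult]
        bounded_bilinear.add_right[OF bounded_bilinear_matrix_mult])
  have "cayley X ** ctranspose (cayley X) = matrix_inv ?A ** (?B ** ?A) ** matrix_inv ?B"
    by (simp add: cayley_def ctranspose_mult tB tinv matrix_mul_assoc)
  also have "\<dots> = (matrix_inv ?A ** ?A) ** (?B ** matrix_inv ?B)"
    unfolding com by (simp add: matrix_mul_assoc)
  also have "\<dots> = mat 1" by (simp add: matrix_inv_inverse[OF dA] matrix_inv_inverse[OF dB])
  finally have "cayley X ** ctranspose (cayley X) = mat 1" .
  then show ?thesis using matrix_left_right_inverse unfolding unitary_group_def by blast
qed

lemma unitary_group_mult: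
  assumes "U \<in> unitary_group" "W \<in> unitary_group"
  shows "U ** W \<in> unitary_group"
proof -
  have "(U ** W) ** ctranspose (U ** W) = U ** (W ** ctranspose W) ** ctranspose U"
    by (simp add: ctranspose_mult matrix_mul_assoc)
  also have "\<dots> = mat 1" using assms by (simp add: unitary_group_def)
  finally show ?thesis using matrix_left_right_inverse unfolding unitary_group_def by blast
qed

text \<open>In frame coordinates the differential is multiplication of a row vector by the frame
  matrix. This is the converse of \<open>det_frame_matrix\<close>, by which the constructed lift
  becomes a chart.\<close>

lemma (in flag_frame) bij_betw_flag_diff:
  assumes lift: "unitary_lift \<Omega> s" "y \<in> \<Omega>" and d: "det (frame_matrix s y) \<noteq> 0"
  shows "bij_betw (flag_diff b s y) UNIV (horizontal b)"
proof -
  let ?C = "frame_matrix s y"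
  have fd: "flag_diff b s y v = (\<Sum>a\<in>UNIV. (v v* ?C) $ a *\<^sub>R \<xi> a)" for v
  proof -
    have "flag_diff b s y v = (\<Sum>i\<in>UNIV. \<Sum>a\<in>UNIV. (v $ i * ?C $ i $ a) *\<^sub>R \<xi> a)"
      by (simp add: linear_flag_diff[OF lift] off_block_expansion[OF maurer_cartan_skew[OF lift]] frame_matrix_def scaleR_sum_right)
    also have "\<dots> = (\<Sum>a\<in>UNIV. (v v* ?C) $ a *\<^sub>R \<xi> a)"
      by (subst sum.swap) (simp add: vector_matrix_mult_def scaleR_sum_left mult.commute)
    finally show ?thesis .
  qed
  have inner_fd: "inner (flag_diff b s y v) (\<xi> c) = (v v* ?C) $ c" for v c
    by (simp add: fd inner_sum_left frame_orthonormal)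
  show ?thesis unfolding bij_betw_def
  proof (intro conjI injI equalityI subsetI)
    fix v w
    assume "flag_diff b s y v = flag_diff b s y w"
    then have "(v v* ?C) $ c = (w v* ?C) $ c" for c using inner_fd[of v c] inner_fd[of w c] by simp
    then have "v v* ?C = w v* ?C" by (simp add: vec_eq_iff)
    then have "v v* ?C v* matrix_inv ?C = w v* ?C v* matrix_inv ?C" by simp
    then show "v = w" by (simp add: vector_matrix_mul_assoc matrix_inv_inverse[OF d])
  next
    fix X
    assume "X \<in> range (flag_diff b s y)"
    then show "X \<in> horizontal b"
      by (auto simp: fd intro!: subspace_sum subspace_scale subspace_horizontal frame_horizontal)
  next
    fix X
    assume X: "X \<in> horizontal b"
    define v where "v = (\<chi> a. inner X (\<xi> a)) v* matrix_inv ?C"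
    have "v v* ?C = (\<chi> a. inner X (\<xi> a))"
      by (simp add: v_def vector_matrix_mul_assoc matrix_inv_inverse[OF d])
    then have "flag_diff b s y v = X" using frame_expansion[OF X] by (simp add: fd)
    then show "X \<in> range (flag_diff b s y)" by blast
  qed
qed

lemma (in flag_frame) frame_map_horizontal: "(\<Sum>a\<in>UNIV. v a *\<^sub>R \<xi> a) \<in> horizontal b"
  by (intro subspace_sum subspace_scale subspace_horizontal frame_horizontal)

text \<open>\<open>Ck_on\<close> gives continuity of the derivative in each fixed direction, while
  local injectivity is derived from continuity in the operator norm. The latter is bounded by a
  finite sum over the basis.\<close>

lemma Ck_locally_injective:
  fixes f :: "'a::euclidean_space \<Rightarrow> 'b::euclidean_space"
  assumes f: "Ck_on 1 UNIV UNIV f" and inj: "\<And>v. dir_deriv f a v = 0 \<Longrightarrow> v = 0"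
  obtains \<rho> where "\<rho> > 0" "inj_on f (ball a \<rho>)"
proof -
  have f1: "Ck_on (Suc 0) UNIV UNIV f" using f by simp
  have o: "rel_open UNIV (UNIV :: 'a set)" by (rule rel_open_UNIV) simp
  obtain f' where f': "\<And>x. (f has_derivative f' x) (at x)" "\<And>x v. f' x v = dir_deriv f x v"
    using Ck_on_Suc_dir_deriv[OF f1 o] by (metis UNIV_I)
  have lin: "linear (f' x)" for x by (rule has_derivative_linear[OF f'(1)])
  have "inj (f' a)" using inj f'(2) by (subst linear_injective_0[OF lin]) auto
  then obtain g' where g': "linear g'" "g' \<circ> f' a = id"
    using linear_injective_left_inverse[OF lin] by blast
  have cont: "isCont (\<lambda>x. f' x v) a" for v
    using Ck_on_dir_deriv[OF f1 o, of v] by (simp add: f'(2) continuous_on_eq_continuous_at)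
  show ?thesis
  proof (rule has_derivative_locally_injective[of a UNIV g' f' f])
    show "bounded_linear g'" using g'(1) by (simp add: linear_conv_bounded_linear)
    show "g' \<circ> f' a = id" by (rule g'(2))
    show "(f has_derivative f' x) (at x)" for x by (rule f'(1))
    fix e :: real
    assume "e > 0"
    have "((\<lambda>x. \<Sum>i\<in>Basis. norm (f' x i - f' a i)) \<longlongrightarrow> (\<Sum>i\<in>Basis. norm (f' a i - f' a i))) (at a)"
      using cont by (intro tendsto_intros) (simp add: isCont_def)
    then have "eventually (\<lambda>x. (\<Sum>i\<in>Basis. norm (f' x i - f' a i)) < e) (at a)"
      using \<open>e > 0\<close> by (intro order_tendstoD) auto
    then obtain d where d: "d > 0" "\<And>x. x \<noteq> a \<Longrightarrow> dist x a < d \<Longrightarrow> (\<Sum>i\<in>Basis. norm (f' x i - f' a i)) < e"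
      unfolding eventually_at by auto
    have "onorm (\<lambda>v. f' x v - f' a v) < e" if "dist a x < d" for x
    proof -
      have l: "linear (\<lambda>v. f' x v - f' a v)" by (rule linear_compose_sub[OF lin lin])
      have "norm (f' x v - f' a v) \<le> (\<Sum>i\<in>Basis. norm (f' x i - f' a i)) * norm v" for v
      proof -
        have "f' x v - f' a v = (\<Sum>i\<in>Basis. (inner v i) *\<^sub>R (f' x i - f' a i))"
          using linear_sum[OF l, of "\<lambda>i. inner v i *\<^sub>R i" Basis] by (simp add: linear_cmul[OF l] euclidean_representation)
        then have "norm (f' x v - f' a v) \<le> (\<Sum>i\<in>Basis. \<bar>inner v i\<bar> * norm (f' x i - f' a i))"
          by (simp add: sum_norm_le)
        also have "\<dots> \<le> (\<Sum>i\<in>Basis. norm v * norm (f' x i - f' a i))"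
          by (intro sum_mono mult_right_mono) (auto simp: Basis_le_norm)
        finally show ?thesis by (simp add: sum_distrib_left mult.commute)
      qed
      then have "onorm (\<lambda>v. f' x v - f' a v) \<le> (\<Sum>i\<in>Basis. norm (f' x i - f' a i))" by (rule onorm_bound[rotated]) (simp add: sum_nonneg)
      also have "\<dots> < e" using d(2)[of x] that \<open>e > 0\<close> by (cases "x = a") (auto simp: dist_commute)
      finally show ?thesis .
    qed
    with d(1) show "\<exists>d>0. \<forall>x. dist a x < d \<longrightarrow> onorm (\<lambda>v. f' x v - f' a v) < e" by blast
  qed (use that in auto)
qed

text \<open>A block-diagonal unitary commutes with a diagonal matrix that is constant on blocks.
  Equality of cosets thereby implies an equation between matrices, accessible to calculus.\<close>

lemma flag_proj_conjugate:
  assumes eq: "flag_proj b U = flag_proj b W"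
    and D: "\<And>p q. p \<noteq> q \<Longrightarrow> D $ p $ q = 0" "\<And>p q. b p = b q \<Longrightarrow> D $ p $ p = D $ q $ q"
  shows "U ** D ** ctranspose U = W ** D ** ctranspose W"
proof -
  obtain K where K: "K \<in> block_unitary b" "U = W ** K" using eq by (rule flag_proj_eqE)
  have "K $ p $ q * D $ q $ q = D $ p $ p * K $ p $ q" for p q
    using K(1) D(2)[of p q] by (cases "b p = b q") (auto simp: block_unitary_def)
  then have KD: "K ** D = D ** K" by (simp add: vec_eq_iff mult_diagonal D(1))
  have "U ** D ** ctranspose U = W ** (K ** D) ** ctranspose K ** ctranspose W"
    by (simp add: K(2) ctranspose_mult matrix_mul_assoc)
  also have "\<dots> = W ** D ** (K ** ctranspose K) ** ctranspose W" by (simp add: KD matrix_mul_assoc)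
  finally show ?thesis using K(1) by (simp add: block_unitary_def unitary_group_def)
qed

text \<open>The chart is \<open>U\<close> times the Cayley transform of the horizontal matrices. It is injective near the
  origin because \<open>s D s\<^sup>*\<close>, with \<open>D\<close> diagonal and taking distinct values on distinct blocks,
  depends only on the coset of \<open>s\<close> and has an injective differential.\<close>

lemma (in flag_frame) flag_chart_exists:
  assumes U: "U \<in> unitary_group"
  shows "\<exists>\<Omega> (s :: real^'d \<Rightarrow> complex^'n^'n). flag_chart b \<Omega> s \<and> 0 \<in> \<Omega> \<and> s 0 = U"
proof -
  define X where "X v = (\<Sum>a\<in>UNIV. v $ a *\<^sub>R \<xi> a)" for v :: "real^'d"
  define s where "s y = U ** cayley (X y)" for y
  have Xh: "X v \<in> horizontal b" for v unfolding X_def by (rule frame_map_horizontal)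
  then have Xs: "X v \<in> skew_hermitian" for v by (simp add: horizontal_iff)
  have X_lin: "linear X" unfolding X_def by (rule linearI) (simp_all add: scaleR_left_distrib sum.distrib scaleR_sum_right)
  then have Xbl: "bounded_linear X" by (simp add: linear_conv_bounded_linear)
  have X0: "X 0 = 0" by (rule linear_0[OF X_lin])
  have X_inner: "inner (X v) (\<xi> a) = v $ a" for v a
    by (simp add: X_def inner_sum_left frame_orthonormal)
  note mult_Ck = bounded_bilinear.Ck_on_prod[OF bounded_bilinear_matrix_mult]
  have CkA: "Ck_on q UNIV S (\<lambda>y. mat 1 - X y)" for q S
    using Ck_on_add[OF Ck_on_const Ck_on_linear[OF bounded_linear_minus[OF Xbl]]] by simp
  have CkB: "Ck_on q UNIV S (\<lambda>y. mat 1 + X y)" for q S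
    by (rule Ck_on_add[OF Ck_on_const Ck_on_linear[OF Xbl]])
  have Cks: "Ck_on q UNIV S s" for q S
    unfolding s_def cayley_def
    by (intro mult_Ck Ck_on_const CkB Ck_on_matrix_inv CkA det_one_minus_skew Xs)
  have su: "s y \<in> unitary_group" for y
    unfolding s_def by (intro unitary_group_mult U cayley_unitary Xs)
  have s0: "s 0 = U" by (simp add: s_def cayley_def X0 matrix_inv_unique)
  have lift: "unitary_lift \<Omega> s" if "open \<Omega>" for \<Omega>
    using that Cks su by (auto simp: unitary_lift_def smooth_on_def)
  have o: "rel_open UNIV (UNIV :: (real^'d) set)" by (rule rel_open_UNIV) simp
  \<comment> \<open>Both factors of the Cayley transform contribute X at the origin, hence the
    2.\<close>
  have ds0: "(s has_derivative (\<lambda>v. U ** (2 *\<^sub>R X v))) (at 0)"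
  proof -
    have A: "((\<lambda>y. mat 1 - X y) has_derivative (\<lambda>v. - X v)) (at 0)"
      and B: "((\<lambda>y. mat 1 + X y) has_derivative X) (at 0)"
      using bounded_linear_imp_has_derivative[OF Xbl] by (auto intro!: derivative_eq_intros)
    have "((\<lambda>y. matrix_inv (mat 1 - X y)) has_derivative (\<lambda>v. X v)) (at 0)"
      using has_derivative_matrix_inv[OF A det_one_minus_skew[OF Xs]]
      by (simp add: X0 matrix_inv_unique)
    from has_derivative_matrix_mult[OF this B]
    have "((\<lambda>y. cayley (X y)) has_derivative (\<lambda>v. 2 *\<^sub>R X v)) (at 0)"
      by (simp add: cayley_def X0 matrix_inv_unique scaleR_2)
    then show ?thesis unfolding s_def
      by (rule bounded_linear.has_derivative[OF bounded_bilinear.bounded_linear_right[OF bounded_bilinear_matrix_mult]])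
  qed
  have dir0: "dir_deriv s 0 v = U ** (2 *\<^sub>R X v)" for v
    using dir_deriv_eq[OF o _ _ ds0] by simp
  have UU: "ctranspose U ** U = mat 1" "U ** ctranspose U = mat 1" using U by (auto simp: unitary_group_def)
  have mc0: "maurer_cartan s i 0 = 2 *\<^sub>R X (axis i 1)" for i
    by (simp add: maurer_cartan_def dir0 s0 matrix_mul_assoc UU)
  have "frame_matrix s 0 = 2 *\<^sub>R mat 1"
    by (simp add: frame_matrix_def mc0 X_inner vec_eq_iff mat_def axis_def)
  then have "frame_matrix s 0 ** ((1 / 2) *\<^sub>R mat 1) = mat 1"
    by (simp add: bounded_bilinear.scaleR_left[OF bounded_bilinear_matrix_mult] bounded_bilinear.scaleR_right[OF bounded_bilinear_matrix_mult])
  from arg_cong[OF this, of det] have det0: "det (frame_matrix s 0) \<noteq> 0" by (auto simp: det_mul)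
  have "eventually (\<lambda>y. det (frame_matrix s y) \<noteq> 0) (nhds 0)"
    using eventually_det_nonzero[OF tendsto_frame_matrix[OF lift[OF open_UNIV]] det0] by simp
  then obtain \<rho>1 where \<rho>1: "\<rho>1 > 0" "\<And>y. dist y 0 < \<rho>1 \<Longrightarrow> det (frame_matrix s y) \<noteq> 0"
    unfolding eventually_nhds_metric by blast
  obtain w :: "'b \<Rightarrow> nat" where w: "inj_on w (range b)"
    using finite_imp_inj_to_nat_seg[of "range b"] by auto
  define D :: "complex^'n^'n" where "D = (\<chi> p q. if p = q then of_nat (w (b p)) else 0)"
  define \<Phi> where "\<Phi> y = s y ** D ** ctranspose (s y)" for y
  \<comment> \<open>The adjoint of the Cayley transform is again rational, (1 - X) times the inverse
    of 1 + X, so the rules for products and inverses apply to it.\<close>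
  have Ckt: "Ck_on q UNIV S (\<lambda>y. ctranspose (s y))" for q S
  proof -
    have "ctranspose (s y) = ctranspose (cayley (X y)) ** ctranspose U" for y by (simp add: s_def ctranspose_mult)
    moreover have "ctranspose (cayley (X y)) = (mat 1 - X y) ** matrix_inv (mat 1 + X y)" for y
    proof -
      note d = det_one_minus_skew[OF Xs[of y]]
      have t: "ctranspose (mat 1 - X y) = mat 1 + X y" "ctranspose (mat 1 + X y) = mat 1 - X y"
        using Xs[of y] by (simp_all add: skew_hermitian_def ctranspose_diff ctranspose_add ctranspose_mat)
      have "ctranspose (matrix_inv (mat 1 - X y) ** (mat 1 - X y)) = mat 1"
        by (simp only: matrix_inv_inverse[OF d] ctranspose_mat)
      then have "matrix_inv (mat 1 + X y) = ctranspose (matrix_inv (mat 1 - X y))"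
        by (intro matrix_inv_unique) (simp only: ctranspose_mult t)
      then show ?thesis by (simp add: cayley_def ctranspose_mult t)
    qed
    moreover have "det (mat 1 + X y) \<noteq> 0" for y
      using det_one_minus_skew[OF Xs[of "- y"]] by (simp add: linear_neg[OF X_lin])
    ultimately show ?thesis by (simp only:) (intro mult_Ck Ck_on_const CkA Ck_on_matrix_inv CkB)
  qed
  have Ck\<Phi>: "Ck_on 1 UNIV UNIV \<Phi>" unfolding \<Phi>_def by (intro mult_Ck Cks Ckt Ck_on_const)
  have d\<Phi>: "dir_deriv \<Phi> 0 v = U ** (2 *\<^sub>R comm (X v) D) ** ctranspose U" for v
  proof -
    note ds0t = bounded_linear.has_derivative[OF bounded_linear_ctranspose ds0]
    have "((\<lambda>y. s y ** D) has_derivative (\<lambda>v. U ** (2 *\<^sub>R X v) ** D)) (at 0)"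
      by (rule bounded_linear.has_derivative[OF bounded_bilinear.bounded_linear_left[OF bounded_bilinear_matrix_mult] ds0])
    from has_derivative_matrix_mult[OF this ds0t]
    have "(\<Phi> has_derivative (\<lambda>v. U ** D ** ctranspose (U ** (2 *\<^sub>R X v)) + U ** (2 *\<^sub>R X v) ** D ** ctranspose U)) (at 0)"
      unfolding \<Phi>_def[abs_def] by (simp add: s0)
    from dir_deriv_eq[OF o _ _ this]
    have "dir_deriv \<Phi> 0 v = U ** D ** ctranspose (U ** (2 *\<^sub>R X v)) + U ** (2 *\<^sub>R X v) ** D ** ctranspose U" by simp
    also have "ctranspose (U ** (2 *\<^sub>R X v)) = - (2 *\<^sub>R (X v ** ctranspose U))"
      using Xs[of v] by (simp add: ctranspose_mult ctranspose_scaleR skew_hermitian_def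
        bounded_bilinear.scaleR_left[OF bounded_bilinear_matrix_mult] matrix_mult_minus_left)
    finally show ?thesis
      by (simp add: comm_def matrix_mult_minus_right matrix_diff_left matrix_diff_right matrix_mul_assoc
        bounded_bilinear.scaleR_left[OF bounded_bilinear_matrix_mult] bounded_bilinear.scaleR_right[OF bounded_bilinear_matrix_mult]
        scaleR_diff_right)
  qed
  have inj\<Phi>: "v = 0" if "dir_deriv \<Phi> 0 v = 0" for v
  proof -
    have "ctranspose U ** (U ** (2 *\<^sub>R comm (X v) D) ** ctranspose U) ** U = 0"
      using that by (simp add: d\<Phi> bounded_bilinear.zero_right[OF bounded_bilinear_matrix_mult] bounded_bilinear.zero_left[OF bounded_bilinear_matrix_mult])
    moreover have "ctranspose U ** (U ** M ** ctranspose U) ** U = (ctranspose U ** U) ** M ** (ctranspose U ** U)" for M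
      by (simp only: matrix_mul_assoc)
    ultimately have c0: "comm (X v) D = 0" by (simp add: UU)
    have XD: "(X v ** D) $ p $ q = X v $ p $ q * of_nat (w (b q))"
      and DX: "(D ** X v) $ p $ q = of_nat (w (b p)) * X v $ p $ q" for p q
      by (simp_all add: mult_diagonal D_def)
    \<comment> \<open>The (p, q) entry of [X, D] is (w (b q) - w (b p)) times that of X, and the
      labels separate the blocks.\<close>
    have "X v $ p $ q = 0" for p q
    proof (cases "b p = b q")
      case True
      then show ?thesis using Xh[of v] by (simp add: horizontal_iff)
    next
      case False
      then have "w (b p) \<noteq> w (b q)" using w by (auto simp: inj_on_def)
      moreover have "X v $ p $ q * of_nat (w (b q)) = of_nat (w (b p)) * X v $ p $ q"
        using arg_cong[OF c0, of "\<lambda>M. M $ p $ q"] by (simp add: comm_def XD DX)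
      ultimately show ?thesis by (simp add: mult.commute)
    qed
    then have "X v = 0" by (simp add: vec_eq_iff)
    then have "v $ a = 0" for a using X_inner[of v a] by simp
    then show "v = 0" by (simp add: vec_eq_iff)
  qed
  obtain \<rho>2 where \<rho>2: "\<rho>2 > 0" "inj_on \<Phi> (ball 0 \<rho>2)"
    using Ck_locally_injective[OF Ck\<Phi> inj\<Phi>] by blast
  \<comment> \<open>Within \<rho>1 the differential is an isomorphism, within \<rho>2 the
    parametrization is injective.\<close>
  define \<Omega> where "\<Omega> = ball (0 :: real^'d) (min \<rho>1 \<rho>2)"
  have \<Omega>: "open \<Omega>" "0 \<in> \<Omega>" using \<rho>1(1) \<rho>2(1) by (auto simp: \<Omega>_def)
  have "flag_chart b \<Omega> s"
    unfolding flag_chart_def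
  proof (intro conjI ballI)
    show "open \<Omega>" "smooth_on UNIV \<Omega> s" "s ` \<Omega> \<subseteq> unitary_group"
      using lift[OF \<Omega>(1)] by (simp_all add: unitary_lift_def)
    show "inj_on (flag_proj b \<circ> s) \<Omega>"
    proof (rule inj_onI)
      fix y z
      assume yz: "y \<in> \<Omega>" "z \<in> \<Omega>" "(flag_proj b \<circ> s) y = (flag_proj b \<circ> s) z"
      have "\<Phi> y = \<Phi> z" unfolding \<Phi>_def
        by (rule flag_proj_conjugate[of b]) (use yz in \<open>auto simp: D_def\<close>)
      then show "y = z" using inj_onD[OF \<rho>2(2)] yz by (simp add: \<Omega>_def)
    qed
    fix y
    assume "y \<in> \<Omega>"
    then show "bij_betw (flag_diff b s y) UNIV (horizontal b)"
      by (intro bij_betw_flag_diff[OF lift[OF \<Omega>(1)]] \<rho>1(2)) (auto simp: \<Omega>_def dist_commute)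
  qed
  with \<Omega>(2) s0 show ?thesis by blast
qed

section \<open>Evaluation in an arbitrary chart and conclusion\<close>

lemma eventually_regular_set:
  fixes b :: "'n::finite \<Rightarrow> 'b::finite" and r :: "'m::finite \<Rightarrow> 'n"
  assumes lift: "unitary_lift \<Omega> s" and x: "x \<in> \<Omega>" and reg: "s x \<in> regular_set b r"
  shows "eventually (\<lambda>y. y \<in> \<Omega> \<and> s y \<in> regular_set b r) (nhds x)"
proof -
  have "continuous_on \<Omega> s" using chart_Ck[OF lift, of 0] by simp
  then have "isCont s x" using continuous_on_eq_continuous_at[OF chart_open[OF lift]] x by blast
  then have s: "(s \<longlongrightarrow> s x) (nhds x)"
    by (rule tendsto_at_iff_tendsto_nhds[THEN iffD1, OF isCont_def[THEN iffD1]])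
  note rs = bounded_linear.tendsto[OF bounded_linear_rows_of s]
  have "((\<lambda>y. compress r M (s y)) \<longlongrightarrow> compress r M (s x)) (nhds x)" for M
    unfolding compress_def
    by (intro bounded_bilinear.tendsto[OF bounded_bilinear_matrix_mult] bounded_linear.tendsto[OF bounded_linear_ctranspose] rs tendsto_const)
  then have "eventually (\<lambda>y. det (compress r (block_proj b j) (s y)) \<noteq> 0) (nhds x)" for j
    using reg by (intro eventually_det_nonzero) (auto simp: regular_set_iff)
  then have "eventually (\<lambda>y. \<forall>j. det (compress r (block_proj b j) (s y)) \<noteq> 0) (nhds x)"
    by (rule eventually_all_finite)
  with chart_eventually[OF lift x] show ?thesis
    by eventually_elim (use lift in \<open>auto simp: regular_set_iff unitary_lift_def\<close>)
qed

theorem theorem3p3: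
  fixes N :: "'k::finite option \<Rightarrow> nat"
    and b :: "'n::finite \<Rightarrow> 'k option"
    and r :: "'m::finite \<Rightarrow> 'n"
    and f :: "complex^'m^'m^'k \<Rightarrow> complex"
    and fhat :: "(complex^'n^'n) set \<Rightarrow> complex"
  assumes block_sizes: "\<And>j. card {c. b c = j} = N j"
    and m_le: "\<And>j. CARD('m) \<le> N j"
    and rows: "inj r"
    and coordinates: "CARD('d::finite) = dim (horizontal b)"
    and smooth: "smooth_on hermitian_tuples radial_domain f"
    and invariant: "\<And>V \<Lambda>. V \<in> unitary_group \<Longrightarrow> \<Lambda> \<in> radial_domain \<Longrightarrow>
          f (\<chi> j. V ** \<Lambda> $ j ** ctranspose V) = f \<Lambda>"
    and fhat: "\<And>U. U \<in> regular_set b r \<Longrightarrow> fhat (flag_proj b U) = f (radial_map b r U)"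
  shows "\<forall>U \<in> regular_set b r.
           flag_laplacian TYPE('d) b fhat (flag_proj b U) = radial_laplacian N f (radial_map b r U)"
proof
  fix U
  assume U: "U \<in> regular_set b r"
  have uU: "U \<in> unitary_group" using U by (simp add: regular_set_iff)
  obtain \<xi> :: "'d \<Rightarrow> complex^'n^'n" where frame: "flag_frame b \<xi>"
    using flag_frame_exists[OF coordinates] .
  interpret flag_frame b \<xi> by (rule frame)
  have Ckf: "Ck_on q hermitian_tuples radial_domain f" for q using smooth by (simp add: smooth_on_def)
  \<comment> \<open>The value is the same in every chart around the point, whatever representative
    the lift takes there.\<close>
  have local: "laplace_beltrami (flag_metric b s) (\<lambda>y. fhat (flag_proj b (s y))) x = radial_laplacian N f (radial_map b r U)"
    if chart: "flag_chart b \<Omega> s" and x: "x \<in> \<Omega>" and p: "flag_proj b (s x) = flag_proj b U"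
    for \<Omega> and s :: "real^'d \<Rightarrow> complex^'n^'n" and x
  proof -
    note lift = flag_chart_unitary_lift[OF chart]
    have "s x \<in> unitary_group" using lift x by (auto simp: unitary_lift_def)
    note sx = regular_set_coset[OF p U this]
    note reg = eventually_regular_set[OF lift x sx(1)]
    have lmc: "((\<lambda>t. s (y + t *\<^sub>R axis i 1)) has_vector_derivative s (y + 0 *\<^sub>R axis i 1) ** maurer_cartan s i y) (at 0)"
      if "y \<in> \<Omega>" for y i
      using chart_has_vector_derivative[OF lift that, of "axis i 1"]
      by (simp add: maurer_cartan_def matrix_mul_assoc chart_unitary(2)[OF lift that])
    have "laplace_beltrami (flag_metric b s) (\<lambda>y. fhat (flag_proj b (s y))) x = (\<Sum>a\<in>UNIV. radial_d2 b r f (s x) (\<xi> a) (\<xi> a))"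
    proof (rule laplace_beltrami_eq[OF chart x, where L = "radial_d1 b r f" and ?L2.0 = "radial_d2 b r f (s x)"])
      show "linear (\<lambda>X. radial_d1 b r f X W)" for W by (rule linear_radial_d1)
      show "radial_d1 b r f V W = 0" if "V \<in> vertical b" for V W using that by (rule radial_d1_vertical)
      show "linear (\<lambda>Y. radial_d2 b r f (s x) Y X)" for X by (rule linear_radial_d2)
      show "radial_d2 b r f (s x) V X = radial_d1 b r f (comm V X) (s x)" if "V \<in> vertical b" for V X
        using that by (rule radial_d2_vertical)
      show "((\<lambda>t. radial_d1 b r f (\<xi> a) (s (x + t *\<^sub>R axis i 1))) has_vector_derivative
          radial_d2 b r f (s x) (maurer_cartan s i x) (\<xi> a)) (at 0)" for a i
      proof -
        have "eventually (\<lambda>t. s (x + t *\<^sub>R axis i 1) \<in> regular_set b r) (nhds 0)"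
          using eventually_line[OF reg, of "axis i 1"] by (auto elim: eventually_mono)
        from has_vector_derivative_radial_d1[OF Ckf rows this lmc[OF x] maurer_cartan_skew[OF lift x], of "\<xi> a"]
        show ?thesis by simp
      qed
      \<comment> \<open>Differentiating at y requires regularity on a whole neighbourhood of y, and
        this for all y near x; hence the iterated neighbourhood filter.\<close>
      show "eventually (\<lambda>y. \<forall>i. dir_deriv (\<lambda>y. fhat (flag_proj b (s y))) y (axis i 1) = radial_d1 b r f (maurer_cartan s i y) (s y)) (nhds x)"
        using iffD2[OF eventually_eventually reg]
      proof eventually_elim
        case (elim y)
        show ?case
        proof
          fix i
          from eventually_nhds_x_imp_x[OF elim] have y: "y \<in> \<Omega>" by simp
          have e: "eventually (\<lambda>t. s (y + t *\<^sub>R axis i 1) \<in> regular_set b r) (nhds 0)"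
            using eventually_line[OF elim, of "axis i 1"] by (auto elim: eventually_mono)
          from has_vector_derivative_radial_chain[OF Ckf rows this lmc[OF y] maurer_cartan_skew[OF lift y]]
          have "((\<lambda>t. f (radial_map b r (s (y + t *\<^sub>R axis i 1)))) has_vector_derivative radial_d1 b r f (maurer_cartan s i y) (s y)) (at 0)"
            by (simp add: radial_d1_def)
          then have "((\<lambda>t. fhat (flag_proj b (s (y + t *\<^sub>R axis i 1)))) has_vector_derivative radial_d1 b r f (maurer_cartan s i y) (s y)) (at 0)"
            by (rule has_vector_derivative_cong_nhds) (use e in \<open>auto elim!: eventually_mono simp: fhat\<close>)
          then show "dir_deriv (\<lambda>y. fhat (flag_proj b (s y))) y (axis i 1) = radial_d1 b r f (maurer_cartan s i y) (s y)"
            unfolding dir_deriv_def by (rule vector_derivative_at)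
        qed
      qed
    qed
    also have "\<dots> = radial_laplacian N f (radial_map b r (s x))"
      by (rule sum_radial_d2[OF frame block_sizes rows Ckf sx(1)])
    finally show ?thesis by (simp add: sx(2))
  qed
  \<comment> \<open>Uniqueness in the definite description needs one actual chart at the point; its
    coordinate expression then determines L.\<close>
  obtain \<Omega>0 and s0 :: "real^'d \<Rightarrow> complex^'n^'n" where chart0: "flag_chart b \<Omega>0 s0" "0 \<in> \<Omega>0" "s0 0 = U"
    using flag_chart_exists[OF uU] by blast
  show "flag_laplacian TYPE('d) b fhat (flag_proj b U) = radial_laplacian N f (radial_map b r U)"
    unfolding flag_laplacian_def
  proof (rule the_equality)
    show "\<forall>\<Omega> (s :: real^'d \<Rightarrow> complex^'n^'n) x. flag_chart b \<Omega> s \<longrightarrow> x \<in> \<Omega> \<longrightarrow> flag_proj b (s x) = flag_proj b U \<longrightarrow>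
        laplace_beltrami (flag_metric b s) (\<lambda>y. fhat (flag_proj b (s y))) x = radial_laplacian N f (radial_map b r U)"
      using local by blast
    fix L
    assume "\<forall>\<Omega> (s :: real^'d \<Rightarrow> complex^'n^'n) x. flag_chart b \<Omega> s \<longrightarrow> x \<in> \<Omega> \<longrightarrow> flag_proj b (s x) = flag_proj b U \<longrightarrow>
        laplace_beltrami (flag_metric b s) (\<lambda>y. fhat (flag_proj b (s y))) x = L"
    then have "laplace_beltrami (flag_metric b s0) (\<lambda>y. fhat (flag_proj b (s0 y))) 0 = L"
      using chart0 by blast
    then show "L = radial_laplacian N f (radial_map b r U)"
      using local[OF chart0(1,2)] chart0(3) by simp
  qed
qed

end
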